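(* There exist a sequence of viscosities $\nu_m>0$ with $\nu_m\downarrow 0$, forces $f^{\nu_m}\in C^\infty(\mathbb T^3\times[0,1];\mathbb R^3)$, and a single initial datum $u_0\in C^\infty(\mathbb T^3;\mathbb R^3)$ (independent of $m$) such that $$\sup_m \|f^{\nu_m}\|_{C([0,1];W^{1,p}(\mathbb T^3))}<\infty\qquad\text{for all }p<\infty,$$ and such that for every $m$ there is a unique smooth solution $u^{\nu_m}\in C^\infty(\mathbb T^3\times[0,1];\mathbb R^3)$ of the forced incompressible Navier–Stokes equations on $\mathbb T^3\times[0,1]$ with viscosity $\nu_m$, force $f^{\nu_m}$ and initial datum $u_0$, with the property that $$\nu_m\int_0^1\int_{\mathbb T^3}|\nabla u^{\nu_m}(x,t)|^2\,dx\,dt\ \ge\ C\exp\{-\log^{2/3}(1/\nu_m)\}$$ for some constant $C>0$ independent of $m$.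
   Context: $\mathbb T^3=\mathbb R^3/\mathbb Z^3$ is the three-dimensional torus, and $\log^{2/3}(s)$ means $(\log s)^{2/3}$. The forced incompressible Navier–Stokes equations with viscosity $\nu>0$, force $f^\nu:\mathbb T^3\times[0,1]\to\mathbb R^3$ and initial datum $u_0^\nu$ are $$\partial_t u^\nu+u^\nu\cdot\nabla u^\nu+\nabla p^\nu=\nu\Delta u^\nu+f^\nu,\qquad \operatorname{div}u^\nu=0,\qquad u^\nu(\cdot,0)=u_0^\nu,$$ on $\mathbb T^3\times[0,1]$, where $u^\nu$ is the velocity and $p^\nu:\mathbb T^3\times[0,1]\to\mathbb R$ is the pressure. Solutions are classical: $u^\nu,p^\nu,f^\nu$ are smooth. Uniqueness refers to the velocity $u^\nu$. *)

theory Defs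
  imports "HOL-Analysis.Analysis"
begin

section \<open>Smooth functions on the torus\<close>

text \<open>
  Derivatives are taken within S, hence are one-sided at the boundary of S. They are unique when S
  is convex with nonempty interior, which covers the two sets used here: the whole space and
  the slab \<open>UNIV \<times> {0..1}\<close>.
\<close>

primrec Ck_on ::
  "nat \<Rightarrow> 'a::euclidean_space set \<Rightarrow> ('a \<Rightarrow> 'b::real_normed_vector) \<Rightarrow> bool" where
  "Ck_on 0 S f \<longleftrightarrow> continuous_on S f"
| "Ck_on (Suc k) S f \<longleftrightarrow>
     (\<exists>f'. (\<forall>x\<in>S. (f has_derivative f' x) (at x within S)) \<and> (\<forall>v. Ck_on k S (\<lambda>x. f' x v)))"

definition smooth_on :: "'a::euclidean_space set \<Rightarrow> ('a \<Rightarrow> 'b::real_normed_vector) \<Rightarrow> bool" where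
  "smooth_on S f \<longleftrightarrow> (\<forall>k. Ck_on k S f)"

text \<open>
  A function on the torus is represented by its periodic lift, and a time-dependent function by
  its curried form, time first; its values at times outside the unit interval are irrelevant.
\<close>

definition periodic :: "(real^3 \<Rightarrow> 'b) \<Rightarrow> bool" where
  "periodic g \<longleftrightarrow> (\<forall>x k. (\<forall>i. k $ i \<in> \<int>) \<longrightarrow> g (x + k) = g x)"

definition smooth_torus :: "(real^3 \<Rightarrow> 'b::real_normed_vector) \<Rightarrow> bool" where
  "smooth_torus g \<longleftrightarrow> periodic g \<and> smooth_on UNIV g"

definition smooth_torus_time :: "(real \<Rightarrow> real^3 \<Rightarrow> 'b::real_normed_vector) \<Rightarrow> bool" where
  "smooth_torus_time w \<longleftrightarrow>
     (\<forall>t\<in>{0..1}. periodic (w t)) \<and> smooth_on (UNIV \<times> {0..1}) (\<lambda>(x, t). w t x)"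

definition torus_integral :: "(real^3 \<Rightarrow> real) \<Rightarrow> real" where
  "torus_integral g = set_lebesgue_integral lborel (cbox 0 One) g"

section \<open>Spatial differential operators\<close>

definition partial :: "3 \<Rightarrow> (real^3 \<Rightarrow> 'b::real_normed_vector) \<Rightarrow> real^3 \<Rightarrow> 'b" where
  "partial j g x = frechet_derivative g (at x) (axis j 1)"

definition gradient :: "(real^3 \<Rightarrow> real) \<Rightarrow> real^3 \<Rightarrow> real^3" where
  "gradient q x = (\<chi> i. partial i q x)"

definition divergence :: "(real^3 \<Rightarrow> real^3) \<Rightarrow> real^3 \<Rightarrow> real" where
  "divergence v x = (\<Sum>j\<in>UNIV. partial j v x $ j)"

definition laplacian :: "(real^3 \<Rightarrow> real^3) \<Rightarrow> real^3 \<Rightarrow> real^3" where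
  "laplacian v x = (\<Sum>j\<in>UNIV. partial j (partial j v) x)"

definition advection :: "(real^3 \<Rightarrow> real^3) \<Rightarrow> (real^3 \<Rightarrow> real^3) \<Rightarrow> real^3 \<Rightarrow> real^3" where
  "advection v w x = (\<Sum>j\<in>UNIV. v x $ j *\<^sub>R partial j w x)"

text \<open>The Frobenius norm of the Jacobian matrix.\<close>

definition grad_norm :: "(real^3 \<Rightarrow> real^3) \<Rightarrow> real^3 \<Rightarrow> real" where
  "grad_norm v x = sqrt (\<Sum>j\<in>UNIV. (norm (partial j v x))\<^sup>2)"

text \<open>
  Both norms are applied to smooth functions only, for which weak and classical derivatives
  agree. The second one is the norm of continuous functions of time with values in the
  Sobolev space.
\<close>

definition W1p_norm :: "real \<Rightarrow> (real^3 \<Rightarrow> real^3) \<Rightarrow> real" where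
  "W1p_norm p v = (torus_integral (\<lambda>x. norm (v x) powr p + grad_norm v x powr p)) powr (1 / p)"

definition C_W1p_norm :: "real \<Rightarrow> (real \<Rightarrow> real^3 \<Rightarrow> real^3) \<Rightarrow> ennreal" where
  "C_W1p_norm p w = (SUP t\<in>{0..1}. ennreal (W1p_norm p (w t)))"

section \<open>The forced Navier-Stokes equations\<close>

definition NS_solution ::
  "real \<Rightarrow> (real \<Rightarrow> real^3 \<Rightarrow> real^3) \<Rightarrow> (real^3 \<Rightarrow> real^3) \<Rightarrow>
   (real \<Rightarrow> real^3 \<Rightarrow> real^3) \<Rightarrow> (real \<Rightarrow> real^3 \<Rightarrow> real) \<Rightarrow> bool" where
  "NS_solution \<nu> f u0 u p \<longleftrightarrow>
     smooth_torus_time u \<and> smooth_torus_time p \<and>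
     (\<forall>t\<in>{0..1}. \<forall>x.
        vector_derivative (\<lambda>s. u s x) (at t within {0..1})
          + advection (u t) (u t) x + gradient (p t) x
        = \<nu> *\<^sub>R laplacian (u t) x + f t x \<and>
        divergence (u t) x = 0) \<and>
     (\<forall>x. u 0 x = u0 x)"

definition NS_velocity ::
  "real \<Rightarrow> (real \<Rightarrow> real^3 \<Rightarrow> real^3) \<Rightarrow> (real^3 \<Rightarrow> real^3) \<Rightarrow> (real \<Rightarrow> real^3 \<Rightarrow> real^3) \<Rightarrow> bool" where
  "NS_velocity \<nu> f u0 u \<longleftrightarrow> (\<exists>p. NS_solution \<nu> f u0 u p)"

definition dissipation :: "real \<Rightarrow> (real \<Rightarrow> real^3 \<Rightarrow> real^3) \<Rightarrow> real" where
  "dissipation \<nu> u =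
     \<nu> * set_lebesgue_integral lborel {0..1} (\<lambda>t. torus_integral (\<lambda>x. (grad_norm (u t) x)\<^sup>2))"

end

theory Submission
  imports Defs "HOL-Real_Asymp.Real_Asymp"
begin

text \<open>
  The velocity is \<open>u = U + w\<close>, without pressure, and the force is what remains of the equation.
  The large scale part \<open>U\<close> is a two-dimensional flow, supported in a thin column of radius \<open>r\<close> around
  a vertical axis and linear in space near that axis, with a gradient of size \<open>lam = ln N\<close>. It
  is a strain that rotates, combined with a rigid rotation, such that particles move on closed
  ellipses and yet the stretching term \<open>w \<bullet> \<nabla> U\<close> makes a rotating direction \<open>d(t)\<close> grow exponentially.
  The wave \<open>w\<close> is \<open>a(x1, x2, t) d(t) cos (2 \<pi> N x3)\<close> plus a small vertical component that makes it
  divergence free, where the envelope \<open>a\<close> is constant along the ellipses. It grows from size \<open>r\<^sup>2 / N\<close> to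
  size \<open>r\<^sup>2\<close> in unit time without leaving the column, and no frequency is created: the second
  harmonics of \<open>w \<bullet> \<nabla> w\<close> cancel to leading order, since the direction of \<open>d\<close> is constant in space.
  Hence the gradient of the force is at most a power of \<open>lam\<close> inside the column and zero outside,
  which is bounded in every \<open>L\<^sup>p\<close> if \<open>r\<close> is smaller than all powers of \<open>1 / lam\<close>. With \<open>\<nu> = (2 \<pi> N) ^ (-2)\<close>, \<open>N = 2 ^ M\<^sup>2\<close> and
  \<open>r = 2 ^ (-M)\<close>, the dissipation is of order \<open>r ^ 6 / lam\<close>, which exceeds \<open>exp (- M powr (4/3))\<close>. Uniqueness
  is the usual energy estimate for the difference of two solutions.
\<close>

section \<open>Smooth functions\<close>

text \<open>Why the strain rotates: near the axis, per unit of angle, particles obey x' = (S + J) x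
  with S the strain and J the rigid rotation, while the wave amplitude obeys w' = - (S + J) w,
  because the stretching term stands on the left of the equation. In the frame turning with S the
  rotation enters the two laws differently: particles see S + 2 J, which has imaginary eigenvalues,
  and the wave sees - S, which has the eigenvalue 1. Hence closed orbits coexist with exponential
  growth; a steady strain would squeeze the envelope and push it out of the column.

  Sizes: amplification by N in unit time forces a gradient of order \<open>lam\<close>, so no bound
  in the sup norm is available; a thin column makes this harmless for finite p. On the other hand
  the dissipation loses r^6, namely r^4 from the squared amplitude and r^2 from the cross-section of
  the column, so r must not be too small. With ln N of order M^2, the value r = 2^(-M) beats every
  power of \<open>lam\<close>, and its cost, an exponent linear in M, is below M^(4/3).\<close>

lemma Ck_on_SucD: "Ck_on (Suc k) S f \<Longrightarrow> Ck_on k S f"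
proof (induction k arbitrary: f)
  case 0
  then show ?case
    by (auto simp: continuous_on_eq_continuous_within intro: has_derivative_continuous)
next
  case (Suc k)
  then obtain f' where f': "\<forall>x\<in>S. (f has_derivative f' x) (at x within S)"
    and "\<forall>v. Ck_on (Suc k) S (\<lambda>x. f' x v)" by auto
  then have "\<forall>v. Ck_on k S (\<lambda>x. f' x v)" using Suc.IH by blast
  with f' show ?case by auto
qed

lemma Ck_on_subset: "Ck_on k S f \<Longrightarrow> T \<subseteq> S \<Longrightarrow> Ck_on k T f"
proof (induction k arbitrary: f)
  case 0
  then show ?case by (auto intro: continuous_on_subset)
next
  case (Suc k)
  then obtain f' where "\<forall>x\<in>S. (f has_derivative f' x) (at x within S)"
    and "\<forall>v. Ck_on k S (\<lambda>x. f' x v)" by auto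
  with Suc show ?case
    by (auto intro!: exI[of _ f'] has_derivative_subset[of f _ _ S T])
qed

lemma Ck_on_cong:
  assumes "Ck_on k S f" "\<And>x. x \<in> S \<Longrightarrow> g x = f x"
  shows "Ck_on k S g"
proof (cases k)
  case 0
  with assms show ?thesis by (auto cong: continuous_on_cong)
next
  case (Suc j)
  with assms obtain f' where f': "\<And>x. x \<in> S \<Longrightarrow> (f has_derivative f' x) (at x within S)"
    and c: "\<forall>v. Ck_on j S (\<lambda>x. f' x v)" by auto
  have "(g has_derivative f' x) (at x within S)" if "x \<in> S" for x
    by (rule has_derivative_transform[OF that assms(2) f'[OF that]])
  with Suc c show ?thesis by auto
qed

lemma Ck_on_const: "Ck_on k S (\<lambda>x. c)"
proof (induction k arbitrary: c)
  case (Suc k)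
  then show ?case by (auto intro!: exI[of _ "\<lambda>x v. 0"])
qed simp

lemma Ck_on_bounded_linear:
  assumes "bounded_linear L"
  shows "Ck_on k S L"
proof (cases k)
  case 0
  then show ?thesis using linear_continuous_on[OF assms] by simp
next
  case (Suc j)
  then show ?thesis
    by (auto intro!: exI[of _ "\<lambda>x. L"] bounded_linear_imp_has_derivative[OF assms] Ck_on_const)
qed

lemma Ck_on_linear_image:
  assumes L: "bounded_linear L"
  shows "Ck_on k S f \<Longrightarrow> Ck_on k S (\<lambda>x. L (f x))"
proof (induction k arbitrary: f)
  case 0
  then show ?case by (simp add: bounded_linear.continuous_on[OF L])
next
  case (Suc k)
  then obtain f' where "\<forall>x\<in>S. (f has_derivative f' x) (at x within S)"
    and "\<forall>v. Ck_on k S (\<lambda>x. f' x v)" by auto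
  with Suc.IH show ?case
    by (auto intro!: exI[of _ "\<lambda>x v. L (f' x v)"] bounded_linear.has_derivative[OF L])
qed

lemma Ck_on_add: "Ck_on k S f \<Longrightarrow> Ck_on k S g \<Longrightarrow> Ck_on k S (\<lambda>x. f x + g x)"
proof (induction k arbitrary: f g)
  case 0
  then show ?case by (auto intro: continuous_on_add)
next
  case (Suc k)
  then obtain f' g' where "\<forall>x\<in>S. (f has_derivative f' x) (at x within S)"
    "\<forall>v. Ck_on k S (\<lambda>x. f' x v)" "\<forall>x\<in>S. (g has_derivative g' x) (at x within S)"
    "\<forall>v. Ck_on k S (\<lambda>x. g' x v)" by auto
  with Suc.IH show ?case
    by (auto intro!: exI[of _ "\<lambda>x v. f' x v + g' x v"] has_derivative_add)
qed

lemma Ck_on_bilinear: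
  assumes B: "bounded_bilinear B"
  shows "Ck_on k S f \<Longrightarrow> Ck_on k S g \<Longrightarrow> Ck_on k S (\<lambda>x. B (f x) (g x))"
proof (induction k arbitrary: f g)
  case 0
  then show ?case by (auto intro: bounded_bilinear.continuous_on[OF B])
next
  case (Suc k)
  note fg = Ck_on_SucD[OF Suc.prems(1)] Ck_on_SucD[OF Suc.prems(2)]
  from Suc obtain f' g' where "\<forall>x\<in>S. (f has_derivative f' x) (at x within S)"
    "\<forall>v. Ck_on k S (\<lambda>x. f' x v)" "\<forall>x\<in>S. (g has_derivative g' x) (at x within S)"
    "\<forall>v. Ck_on k S (\<lambda>x. g' x v)" by auto
  with Suc.IH fg show ?case
    by (auto intro!: exI[of _ "\<lambda>x v. B (f x) (g' x v) + B (f' x v) (g x)"]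
        bounded_bilinear.FDERIV[OF B] Ck_on_add)
qed

lemma Ck_on_sum: "(\<And>i. i \<in> I \<Longrightarrow> Ck_on k S (f i)) \<Longrightarrow> Ck_on k S (\<lambda>x. \<Sum>i\<in>I. f i x)"
  by (induction I rule: infinite_finite_induct) (auto intro!: Ck_on_const Ck_on_add)

lemma Ck_on_compose:
  fixes f :: "'a::euclidean_space \<Rightarrow> 'b::euclidean_space" and g :: "'b \<Rightarrow> 'c::real_normed_vector"
  shows "Ck_on k T g \<Longrightarrow> Ck_on k S f \<Longrightarrow> f ` S \<subseteq> T \<Longrightarrow> Ck_on k S (\<lambda>x. g (f x))"
proof (induction k arbitrary: g)
  case 0
  then show ?case by (auto intro: continuous_on_compose2)
next
  case (Suc k)
  note f = Ck_on_SucD[OF Suc.prems(2)]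
  from Suc.prems obtain f' g' where f': "\<forall>x\<in>S. (f has_derivative f' x) (at x within S)"
    "\<forall>v. Ck_on k S (\<lambda>x. f' x v)" and g': "\<forall>x\<in>T. (g has_derivative g' x) (at x within T)"
    "\<forall>v. Ck_on k T (\<lambda>x. g' x v)" by auto
  have d: "((\<lambda>x. g (f x)) has_derivative (\<lambda>v. g' (f x) (f' x v))) (at x within S)" if "x \<in> S" for x
  proof (rule has_derivative_in_compose[of f "f' x" x S g "g' (f x)"])
    show "(f has_derivative f' x) (at x within S)" using f' that by blast
    show "(g has_derivative g' (f x)) (at (f x) within f ` S)"
    proof (rule has_derivative_subset)
      show "(g has_derivative g' (f x)) (at (f x) within T)" using g' that Suc.prems(3) by blast
    qed (rule Suc.prems(3))
  qed
  \<comment> \<open>The direction \<open>f' x v\<close> moves with \<open>x\<close>, whereas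
    \<open>Ck_on\<close> speaks of fixed directions only. Expanding it in \<open>Basis\<close>
    leaves scalar coefficients times \<open>g' (f x) b\<close>, to which the induction hypothesis
    applies.\<close>
  have "Ck_on k S (\<lambda>x. g' (f x) (f' x v))" for v
  proof (rule Ck_on_cong)
    show "Ck_on k S (\<lambda>x. \<Sum>b\<in>Basis. (f' x v \<bullet> b) *\<^sub>R g' (f x) b)"
      by (intro Ck_on_sum Ck_on_bilinear[OF bounded_bilinear_scaleR]
          Ck_on_linear_image[OF bounded_linear_inner_left] Suc.IH f f'(2)[rule_format]
          g'(2)[rule_format] Suc.prems)
  next
    fix x assume "x \<in> S"
    then have l: "linear (g' (f x))"
      using g' Suc.prems(3) has_derivative_linear by blast
    have "g' (f x) (f' x v) = g' (f x) (\<Sum>b\<in>Basis. (f' x v \<bullet> b) *\<^sub>R b)"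
      by (simp add: euclidean_representation)
    then show "g' (f x) (f' x v) = (\<Sum>b\<in>Basis. (f' x v \<bullet> b) *\<^sub>R g' (f x) b)"
      by (simp add: linear_sum[OF l] linear_scale[OF l])
  qed
  with d show ?case by (auto intro!: exI[of _ "\<lambda>x v. g' (f x) (f' x v)"])
qed

named_theorems smooth

lemma smooth_on_const [smooth]: "smooth_on S (\<lambda>x. c)"
  by (simp add: smooth_on_def Ck_on_const)

lemma smooth_on_bounded_linear: "bounded_linear L \<Longrightarrow> smooth_on S L"
  by (simp add: smooth_on_def Ck_on_bounded_linear)

lemma smooth_on_linear_image: "bounded_linear L \<Longrightarrow> smooth_on S f \<Longrightarrow> smooth_on S (\<lambda>x. L (f x))"
  by (simp add: smooth_on_def Ck_on_linear_image)

lemma smooth_on_add [smooth]: "smooth_on S f \<Longrightarrow> smooth_on S g \<Longrightarrow> smooth_on S (\<lambda>x. f x + g x)"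
  by (simp add: smooth_on_def Ck_on_add)

lemma smooth_on_bilinear:
  "bounded_bilinear B \<Longrightarrow> smooth_on S f \<Longrightarrow> smooth_on S g \<Longrightarrow> smooth_on S (\<lambda>x. B (f x) (g x))"
  by (simp add: smooth_on_def Ck_on_bilinear)

lemmas smooth_on_scaleR [smooth] = smooth_on_bilinear[OF bounded_bilinear_scaleR]
lemmas smooth_on_inner [smooth] = smooth_on_bilinear[OF bounded_bilinear_inner]

lemma smooth_on_mult [smooth]:
  fixes f g :: "'a::euclidean_space \<Rightarrow> real"
  shows "smooth_on S f \<Longrightarrow> smooth_on S g \<Longrightarrow> smooth_on S (\<lambda>x. f x * g x)"
  by (rule smooth_on_bilinear[OF bounded_bilinear_mult])

lemma smooth_on_sum [smooth]:
  "(\<And>i. i \<in> I \<Longrightarrow> smooth_on S (f i)) \<Longrightarrow> smooth_on S (\<lambda>x. \<Sum>i\<in>I. f i x)"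
  by (simp add: smooth_on_def Ck_on_sum)

lemma smooth_on_minus [smooth]: "smooth_on S f \<Longrightarrow> smooth_on S (\<lambda>x. - f x)"
  by (rule smooth_on_linear_image[OF bounded_linear_minus[OF bounded_linear_ident]])

lemma smooth_on_diff [smooth]: "smooth_on S f \<Longrightarrow> smooth_on S g \<Longrightarrow> smooth_on S (\<lambda>x. f x - g x)"
  using smooth_on_add[OF _ smooth_on_minus, of S f g] by simp

lemma smooth_on_power [smooth]:
  fixes f :: "'a::euclidean_space \<Rightarrow> real"
  shows "smooth_on S f \<Longrightarrow> smooth_on S (\<lambda>x. f x ^ n)"
  by (induction n) (auto intro!: smooth)

lemma smooth_on_divide_const [smooth]:
  fixes f :: "'a::euclidean_space \<Rightarrow> real"
  shows "smooth_on S f \<Longrightarrow> smooth_on S (\<lambda>x. f x / c)"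
  by (rule smooth_on_linear_image[OF bounded_linear_divide])

lemma smooth_on_nth [smooth]: "smooth_on S f \<Longrightarrow> smooth_on S (\<lambda>x. f x $ i)"
  by (rule smooth_on_linear_image[OF bounded_linear_vec_nth])

lemma smooth_on_fst [smooth]: "smooth_on S f \<Longrightarrow> smooth_on S (\<lambda>x. fst (f x))"
  by (rule smooth_on_linear_image[OF bounded_linear_fst])

lemma smooth_on_snd [smooth]: "smooth_on S f \<Longrightarrow> smooth_on S (\<lambda>x. snd (f x))"
  by (rule smooth_on_linear_image[OF bounded_linear_snd])

lemma smooth_on_id [smooth]: "smooth_on S (\<lambda>x. x)"
  by (rule smooth_on_bounded_linear[OF bounded_linear_ident])

lemma smooth_on_pair_const: "smooth_on UNIV (\<lambda>x::'a::euclidean_space. (x, c :: 'b::euclidean_space))"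
proof -
  have "smooth_on UNIV (\<lambda>x::'a. (x, 0::'b) + (0, c))"
    by (intro smooth_on_add smooth_on_const smooth_on_bounded_linear bounded_linear_Pair
        bounded_linear_ident bounded_linear_zero)
  then show ?thesis by simp
qed

lemma smooth_on_compose:
  fixes f :: "'a::euclidean_space \<Rightarrow> 'b::euclidean_space"
  shows "smooth_on T g \<Longrightarrow> smooth_on S f \<Longrightarrow> f ` S \<subseteq> T \<Longrightarrow> smooth_on S (\<lambda>x. g (f x))"
  unfolding smooth_on_def using Ck_on_compose by blast

lemma smooth_on_subset: "smooth_on S f \<Longrightarrow> T \<subseteq> S \<Longrightarrow> smooth_on T f"
  unfolding smooth_on_def using Ck_on_subset by blast

lemma smooth_on_cong:
  "smooth_on S f \<Longrightarrow> (\<And>x. x \<in> S \<Longrightarrow> g x = f x) \<Longrightarrow> smooth_on S g"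
  unfolding smooth_on_def using Ck_on_cong by blast

lemma smooth_on_vector3 [smooth]:
  fixes f g h :: "'a::euclidean_space \<Rightarrow> real"
  assumes "smooth_on S f" "smooth_on S g" "smooth_on S h"
  shows "smooth_on S (\<lambda>x. vector [f x, g x, h x] :: real^3)"
proof (rule smooth_on_cong)
  show "smooth_on S (\<lambda>x. f x *\<^sub>R axis 1 (1::real) + g x *\<^sub>R axis 2 1 + h x *\<^sub>R (axis 3 1 :: real^3))"
    by (intro smooth assms)
qed (simp add: vec_eq_iff axis_def forall_3)

lemma Ck_on_realI:
  fixes f :: "real \<Rightarrow> real"
  assumes "\<And>x. (f has_real_derivative f' x) (at x)" "Ck_on k UNIV f'"
  shows "Ck_on (Suc k) UNIV f"
  using assms
  by (auto intro!: exI[of _ "\<lambda>x v. f' x * v"] Ck_on_bilinear[OF bounded_bilinear_mult] Ck_on_const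
      simp: has_field_derivative_def)

lemma smooth_on_sin_cos: "smooth_on UNIV (sin :: real \<Rightarrow> real)" "smooth_on UNIV (cos :: real \<Rightarrow> real)"
proof -
  have "Ck_on k UNIV (sin :: real \<Rightarrow> real) \<and> Ck_on k UNIV (cos :: real \<Rightarrow> real)" for k
  proof (induction k)
    case 0
    then show ?case by (auto intro!: continuous_intros)
  next
    case (Suc k)
    then have "Ck_on k UNIV (\<lambda>x::real. - sin x)"
      by (intro Ck_on_linear_image[OF bounded_linear_minus[OF bounded_linear_ident]]) auto
    with Suc show ?case
      by (intro conjI Ck_on_realI[of sin cos] Ck_on_realI[of cos "\<lambda>x. - sin x"])
         (auto intro: DERIV_sin DERIV_cos)
  qed
  then show "smooth_on UNIV (sin :: real \<Rightarrow> real)" "smooth_on UNIV (cos :: real \<Rightarrow> real)"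
    by (auto simp: smooth_on_def)
qed

lemma smooth_on_exp_real: "smooth_on UNIV (exp :: real \<Rightarrow> real)"
proof -
  have "Ck_on k UNIV (exp :: real \<Rightarrow> real)" for k
  proof (induction k)
    case 0
    then show ?case by (auto intro!: continuous_intros)
  next
    case (Suc k)
    then show ?case by (intro Ck_on_realI[of exp exp]) (auto intro: DERIV_exp)
  qed
  then show ?thesis by (auto simp: smooth_on_def)
qed

lemma smooth_on_sin [smooth]: "smooth_on S f \<Longrightarrow> smooth_on S (\<lambda>x. sin (f x :: real))"
  and smooth_on_cos [smooth]: "smooth_on S f \<Longrightarrow> smooth_on S (\<lambda>x. cos (f x :: real))"
  and smooth_on_exp [smooth]: "smooth_on S f \<Longrightarrow> smooth_on S (\<lambda>x. exp (f x :: real))"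
  using smooth_on_compose[of UNIV _ S f] smooth_on_sin_cos smooth_on_exp_real by blast+

text \<open>The derivative contains the reciprocal only in undifferentiated form, so the order can
  be raised one at a time.\<close>

lemma smooth_on_inverse [smooth]:
  fixes f :: "'a::euclidean_space \<Rightarrow> real"
  assumes f: "smooth_on S f" and nz: "\<And>x. x \<in> S \<Longrightarrow> f x \<noteq> 0"
  shows "smooth_on S (\<lambda>x. inverse (f x))"
proof -
  have "Ck_on k S (\<lambda>x. inverse (f x))" for k
  proof (induction k)
    case 0
    show ?case using f nz by (auto simp: smooth_on_def intro!: continuous_intros dest: spec[of _ 0])
  next
    case (Suc k)
    from f have "Ck_on (Suc k) S f" by (simp add: smooth_on_def)
    then obtain f' where f': "\<forall>x\<in>S. (f has_derivative f' x) (at x within S)"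
      "\<forall>v. Ck_on k S (\<lambda>x. f' x v)" by auto
    have "((\<lambda>x. inverse (f x)) has_derivative (\<lambda>v. - (inverse (f x) * f' x v * inverse (f x))))
        (at x within S)" if "x \<in> S" for x
      using f' nz that by (auto intro!: has_derivative_inverse)
    moreover have "Ck_on k S (\<lambda>x. - (inverse (f x) * f' x v * inverse (f x)))" for v
      by (intro Ck_on_linear_image[OF bounded_linear_minus[OF bounded_linear_ident]]
          Ck_on_bilinear[OF bounded_bilinear_mult] f'(2)[rule_format] Suc.IH)
    ultimately show ?case
      by (auto intro!: exI[of _ "\<lambda>x v. - (inverse (f x) * f' x v * inverse (f x))"])
  qed
  then show ?thesis by (auto simp: smooth_on_def)
qed

lemma smooth_on_imp_continuous_on: "smooth_on S f \<Longrightarrow> continuous_on S f"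
  unfolding smooth_on_def by (metis Ck_on.simps(1))

lemma smooth_on_imp_has_derivative:
  assumes "smooth_on S f" "x \<in> S"
  obtains D where "(f has_derivative D) (at x within S)"
proof -
  from assms(1) have "Ck_on (Suc 0) S f" unfolding smooth_on_def by blast
  with assms(2) that show thesis by auto
qed

text \<open>The witnesses of \<^const>\<open>Ck_on\<close> may a priori depend on \<open>k\<close>; uniqueness of derivatives glues them.\<close>

lemma smooth_on_directional:
  assumes f: "smooth_on S f"
    and D: "\<And>x f'. x \<in> S \<Longrightarrow> (f has_derivative f') (at x within S) \<Longrightarrow> D x = f' v"
  shows "smooth_on S D"
  unfolding smooth_on_def
proof
  fix k
  from f have "Ck_on (Suc k) S f" unfolding smooth_on_def by blast
  then obtain f' where "\<forall>x\<in>S. (f has_derivative f' x) (at x within S)"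
      "Ck_on k S (\<lambda>x. f' x v)" by auto
  with D show "Ck_on k S D" by (auto intro: Ck_on_cong)
qed

section \<open>Cut-off functions built from exp (- 1 / x)\<close>

definition flat :: "real \<Rightarrow> real" where
  "flat x = (if x > 0 then exp (- (1 / x)) else 0)"

lemma flat_le_0 [simp]: "x \<le> 0 \<Longrightarrow> flat x = 0"
  by (simp add: flat_def)

lemma flat_nonneg: "flat x \<ge> 0" and flat_pos: "x > 0 \<Longrightarrow> flat x > 0"
  by (auto simp: flat_def)

lemma flat_mono: "x \<le> y \<Longrightarrow> flat x \<le> flat y"
  by (auto simp: flat_def frac_le)

text \<open>The formula also covers \<open>x = 0\<close>, where both sides vanish because of \<open>a / 0 = 0\<close>.\<close>

lemma flat_div_power_deriv:
  "((\<lambda>x. flat x / x ^ k) has_real_derivative flat x / x ^ (k + 2) - k * (flat x / x ^ (k + 1))) (at x)"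
proof -
  consider "x > 0" | "x < 0" | "x = 0" by linarith
  then show ?thesis
  proof cases
    case 1
    have "((\<lambda>x. exp (- (1 / x))) has_real_derivative exp (- (1 / x)) / x\<^sup>2) (at x)"
      using 1 by (auto intro!: derivative_eq_intros simp: power2_eq_square)
    moreover have "((\<lambda>x. x ^ k) has_real_derivative k * x ^ k / x) (at x)"
    proof (cases k)
      case (Suc j)
      then show ?thesis using 1 DERIV_pow[of k x] by simp
    qed simp
    ultimately have "((\<lambda>x. exp (- (1 / x)) / x ^ k) has_real_derivative
        (exp (- (1 / x)) / x\<^sup>2 * x ^ k - exp (- (1 / x)) * (k * x ^ k / x)) / (x ^ k * x ^ k)) (at x)"
      using 1 by (intro DERIV_divide) auto
    also have "(exp (- (1 / x)) / x\<^sup>2 * x ^ k - exp (- (1 / x)) * (k * x ^ k / x)) / (x ^ k * x ^ k)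
        = flat x / x ^ (k + 2) - k * (flat x / x ^ (k + 1))"
      using 1 by (simp add: flat_def power_add diff_divide_distrib power2_eq_square)
    finally have "((\<lambda>x. exp (- (1 / x)) / x ^ k) has_real_derivative
        flat x / x ^ (k + 2) - k * (flat x / x ^ (k + 1))) (at x)" .
    then show ?thesis
      by (rule has_field_derivative_transform_within_open[of _ _ _ "{0<..}"]) (use 1 in \<open>auto simp: flat_def\<close>)
  next
    case 2
    have "((\<lambda>x. 0) has_real_derivative flat x / x ^ (k + 2) - k * (flat x / x ^ (k + 1))) (at x)"
      using 2 by auto
    then show ?thesis
      by (rule has_field_derivative_transform_within_open[of _ _ _ "{..<0}"]) (use 2 in auto)
  next
    case 3
    have "((\<lambda>h::real. exp (- (1 / h)) / h ^ k / h) \<longlongrightarrow> 0) (at_right 0)"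
      by real_asymp
    then have r: "((\<lambda>h. flat h / h ^ k / h) \<longlongrightarrow> 0) (at_right 0)"
      by (rule Lim_transform_eventually) (auto simp: eventually_at_filter flat_def)
    have l: "((\<lambda>h. flat h / h ^ k / h) \<longlongrightarrow> 0) (at_left 0)"
      by (rule tendsto_eventually) (auto simp: eventually_at_filter)
    from l r have "((\<lambda>h. flat h / h ^ k / h) \<longlongrightarrow> 0) (at 0)"
      by (simp add: filterlim_at_split)
    then show ?thesis using 3 by (simp add: DERIV_def)
  qed
qed

lemma flat_deriv: "(flat has_real_derivative flat x / x\<^sup>2) (at x)"
  using flat_div_power_deriv[of 0 x] by (simp add: power2_eq_square)

text \<open>The family of all \<open>flat x / x ^ j\<close> is closed under differentiation up to
  linear combinations, so the induction runs over all \<open>j\<close> at once.\<close>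

lemma smooth_on_flat_UNIV: "smooth_on UNIV flat"
proof -
  have "Ck_on k UNIV (\<lambda>x. flat x / x ^ j)" for k j
  proof (induction k arbitrary: j)
    case 0
    show ?case
      using flat_div_power_deriv[of j] by (auto simp: continuous_on_eq_continuous_at intro: DERIV_isCont)
  next
    case (Suc k)
    have "Ck_on k UNIV (\<lambda>x. flat x / x ^ (j + 2) + (- real j) * (flat x / x ^ (j + 1)))"
      by (intro Ck_on_add Ck_on_bilinear[OF bounded_bilinear_mult] Ck_on_const Suc.IH)
    then show ?case
      using flat_div_power_deriv[of j]
      by (intro Ck_on_realI[of _ "\<lambda>x. flat x / x ^ (j + 2) - j * (flat x / x ^ (j + 1))"]) auto
  qed
  from this[of _ 0] show ?thesis by (simp add: smooth_on_def)
qed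

lemma smooth_on_flat [smooth]: "smooth_on S f \<Longrightarrow> smooth_on S (\<lambda>x. flat (f x))"
  using smooth_on_compose[of UNIV flat S f] smooth_on_flat_UNIV by simp

text \<open>Squares avoid the corner of the absolute value. Since 9/4 < 4, the two terms of the
  denominator never vanish together. The value 1 is needed up to 3/2, where the wave lives, and 2 is
  the edge of every profile.\<close>

definition plateau :: "real \<Rightarrow> real" where
  "plateau x = flat (4 - x\<^sup>2) / (flat (4 - x\<^sup>2) + flat (x\<^sup>2 - 9/4))"

lemma plateau_eq_1: "\<bar>x\<bar> \<le> 3/2 \<Longrightarrow> plateau x = 1"
proof -
  assume "\<bar>x\<bar> \<le> 3/2"
  then have "x\<^sup>2 \<le> (3/2)\<^sup>2" by (metis abs_ge_zero power2_abs power_mono)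
  then have "x\<^sup>2 - 9/4 \<le> 0" "4 - x\<^sup>2 > 0" by (auto simp: power2_eq_square)
  then show ?thesis using flat_pos[of "4 - x\<^sup>2"] by (simp add: plateau_def)
qed

lemma plateau_eq_0: "\<bar>x\<bar> \<ge> 2 \<Longrightarrow> plateau x = 0"
proof -
  assume "\<bar>x\<bar> \<ge> 2"
  then have "x\<^sup>2 \<ge> 2\<^sup>2" by (metis abs_le_square_iff abs_numeral)
  then show ?thesis by (simp add: plateau_def)
qed

lemma smooth_on_plateau [smooth]:
  assumes "smooth_on S f" shows "smooth_on S (\<lambda>x. plateau (f x))"
proof -
  have "flat (4 - y\<^sup>2) + flat (y\<^sup>2 - 9/4) > 0" for y
    using flat_pos[of "4 - y\<^sup>2"] flat_pos[of "y\<^sup>2 - 9/4"] flat_nonneg[of "4 - y\<^sup>2"]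
      flat_nonneg[of "y\<^sup>2 - 9/4"]
    by (cases "y\<^sup>2 < 4") (auto intro: add_pos_nonneg add_nonneg_pos)
  then have "flat (4 - y\<^sup>2) + flat (y\<^sup>2 - 9/4) \<noteq> 0" for y by (metis less_irrefl)
  then show ?thesis
    unfolding plateau_def divide_inverse by (intro smooth assms)
qed

section \<open>Derivatives and integrals on the torus\<close>

lemma has_derivative_imp_partial: "(g has_derivative D) (at x) \<Longrightarrow> partial j g x = D (axis j 1)"
  unfolding partial_def using frechet_derivative_at by metis

lemma smooth_on_differentiable:
  assumes "smooth_on UNIV g"
  shows "(g has_derivative frechet_derivative g (at x)) (at x)"
  using smooth_on_imp_has_derivative[OF assms, of x] frechet_derivative_at by (metis UNIV_I)

lemma smooth_on_partial [smooth]: "smooth_on UNIV g \<Longrightarrow> smooth_on UNIV (partial j g)"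
  by (rule smooth_on_directional[where v = "axis j 1"]) (auto simp: has_derivative_imp_partial)

lemma One_nth: "(One :: real^3) $ i = 1"
proof -
  have "(One :: real^3) $ i = One \<bullet> axis i (1::real)" by (simp add: inner_axis)
  also have "\<dots> = 1" by (rule inner_sum_Basis) (simp add: axis_in_Basis_iff)
  finally show ?thesis .
qed

lemma One_eq_1: "(One :: real^3) = 1"
  unfolding vec_eq_iff One_nth by simp

lemma mem_unit_cube: "x \<in> cbox 0 (One :: real^3) \<longleftrightarrow> (\<forall>i. 0 \<le> x $ i \<and> x $ i \<le> 1)"
  unfolding One_eq_1 by (simp add: mem_box_cart)

lemma torus_integral_eq:
  assumes "continuous_on UNIV g"
  shows "torus_integral g = integral (cbox 0 One) g"
proof -
  have "continuous_on (cbox 0 One) g" using assms continuous_on_subset by blast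
  then have "set_integrable lborel (cbox 0 One) g"
    unfolding set_integrable_def by (intro borel_integrable_compact compact_cbox)
  then show ?thesis
    unfolding torus_integral_def by (rule set_borel_integral_eq_integral(2))
qed

lemma periodic_axis: "periodic g \<Longrightarrow> g (x + axis j 1) = g x"
  unfolding periodic_def by (auto simp: axis_def)

text \<open>Cut the shifted cube along the plane where coordinate \<open>j\<close> equals 1. The
  part beyond it, moved back by one period, fills exactly the slab that the other part
  misses.\<close>

lemma integral_cube_shift:
  fixes g :: "real^3 \<Rightarrow> real"
  assumes g: "continuous_on UNIV g" "periodic g" and s: "0 \<le> s" "s \<le> 1"
  shows "integral (cbox 0 One) (\<lambda>x. g (x + s *\<^sub>R axis j 1)) = integral (cbox 0 One) g"
proof -
  define e :: "real^3" where "e = axis j 1"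
  have e: "e \<in> Basis" "\<And>x. x \<bullet> e = x $ j" "\<And>i. e $ i = (if i = j then 1 else 0)"
    by (simp_all add: e_def axis_in_Basis_iff inner_axis) (simp add: axis_def)
  have int: "g integrable_on cbox a b" for a b
    using g(1) continuous_on_subset integrable_continuous by blast
  have "integral (cbox 0 One) (\<lambda>x. g (x + s *\<^sub>R e)) = integral (cbox (s *\<^sub>R e) (One + s *\<^sub>R e)) g"
    using integral_shift_cbox[of "s *\<^sub>R e" "s *\<^sub>R e" "One + s *\<^sub>R e" g] by simp
  also have "\<dots> = integral (cbox (s *\<^sub>R e) (One + s *\<^sub>R e) \<inter> {x. x \<bullet> e \<le> 1}) g
      + integral (cbox (s *\<^sub>R e) (One + s *\<^sub>R e) \<inter> {x. x \<bullet> e \<ge> 1}) g"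
    by (rule integral_split[OF int e(1)])
  also have "cbox (s *\<^sub>R e) (One + s *\<^sub>R e) \<inter> {x. x \<bullet> e \<le> 1} = cbox 0 One \<inter> {x. x \<bullet> e \<ge> s}"
    using s unfolding One_eq_1 set_eq_iff Int_iff mem_Collect_eq mem_box_cart e(2)
    by (simp add: e(3)) (smt (verit, best))
  also have "cbox (s *\<^sub>R e) (One + s *\<^sub>R e) \<inter> {x. x \<bullet> e \<ge> 1} = cbox e (One + s *\<^sub>R e)"
    using s unfolding One_eq_1 set_eq_iff Int_iff mem_Collect_eq mem_box_cart e(2)
    by (simp add: e(3)) (smt (verit, best))
  also have "integral (cbox e (One + s *\<^sub>R e)) g = integral (cbox 0 (One + s *\<^sub>R e - e)) (\<lambda>x. g (x + e))"
    using integral_shift_cbox[of e e "One + s *\<^sub>R e" g] by simp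
  also have "cbox 0 (One + s *\<^sub>R e - e) = cbox 0 One \<inter> {x. x \<bullet> e \<le> s}"
    using s unfolding One_eq_1 set_eq_iff Int_iff mem_Collect_eq mem_box_cart e(2)
    by (simp add: e(3)) (smt (verit, best))
  also have "(\<lambda>x. g (x + e)) = g"
    using periodic_axis[OF g(2)] by (simp add: e_def)
  also have "integral (cbox 0 One \<inter> {x. x \<bullet> e \<ge> s}) g + integral (cbox 0 One \<inter> {x. x \<bullet> e \<le> s}) g
      = integral (cbox 0 One) g"
    using integral_split[OF int e(1), of 0 One s] by simp
  finally show ?thesis by (simp add: e_def)
qed

text \<open>Differentiate the translation invariance of the integral.\<close>

lemma integral_cube_partial:
  fixes g :: "real^3 \<Rightarrow> real"
  assumes g: "smooth_on UNIV g" "periodic g"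
  shows "integral (cbox 0 One) (partial j g) = 0"
proof -
  define h where "h s x = g (x + s *\<^sub>R axis j 1)" for s x
  define h' where "h' s x = partial j g (x + s *\<^sub>R axis j 1)" for s x
  have c: "continuous_on UNIV g" "continuous_on UNIV (partial j g)"
    using g smooth_on_partial smooth_on_imp_continuous_on by blast+
  have "((\<lambda>s. integral (cbox 0 One) (h s)) has_vector_derivative integral (cbox 0 One) (h' 0))
      (at 0 within {0..1})"
  proof (rule leibniz_rule_vector_derivative)
    fix s x assume "s \<in> {0..1::real}"
    have "(g has_derivative frechet_derivative g (at (x + s *\<^sub>R axis j 1))) (at (x + s *\<^sub>R axis j 1))"
      by (rule smooth_on_differentiable[OF g(1)])
    then have "((\<lambda>s. g (x + s *\<^sub>R axis j 1)) has_derivative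
        (\<lambda>v. frechet_derivative g (at (x + s *\<^sub>R axis j 1)) (v *\<^sub>R axis j 1))) (at s within {0..1})"
      by (rule has_derivative_compose[rotated, of g]) (auto intro!: derivative_eq_intros)
    moreover have "frechet_derivative g (at (x + s *\<^sub>R axis j 1)) (v *\<^sub>R axis j 1) = v *\<^sub>R h' s x" for v
      using linear_scale[OF has_derivative_linear[OF smooth_on_differentiable[OF g(1)]]]
      by (simp add: h'_def partial_def)
    ultimately show "((\<lambda>s. h s x) has_vector_derivative h' s x) (at s within {0..1})"
      by (simp add: has_vector_derivative_def h_def)
  next
    show "continuous_on ({0..1} \<times> cbox 0 One) (\<lambda>(s, x). h' s x)"
      unfolding h'_def case_prod_beta
      by (intro continuous_on_compose2[OF c(2)] continuous_intros) auto
    show "h s integrable_on cbox 0 One" for s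
      unfolding h_def
      by (intro integrable_continuous continuous_on_compose2[OF c(1)] continuous_intros) auto
  qed auto
  moreover have "((\<lambda>s. integral (cbox 0 One) (h s)) has_vector_derivative 0) (at 0 within {0..1})"
  proof (rule has_vector_derivative_transform[of _ "{0..1}" _ "\<lambda>_. integral (cbox 0 One) g"])
    show "integral (cbox 0 One) (h s) = integral (cbox 0 One) g" if "s \<in> {0..1}" for s
      unfolding h_def using integral_cube_shift[OF c(1) g(2)] that by auto
  qed (auto intro: has_vector_derivative_const)
  ultimately have "integral (cbox 0 One) (h' 0) = 0"
    by (rule vector_derivative_unique_within[rotated])
       (simp add: trivial_limit_within islimpt_Icc)
  moreover have "h' 0 = partial j g" by (simp add: h'_def fun_eq_iff)
  ultimately show ?thesis by simp
qed

lemma periodic_partial: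
  assumes "smooth_on UNIV g" "periodic g"
  shows "periodic (partial j g)"
  unfolding periodic_def
proof (intro allI impI)
  fix x k :: "real^3" assume k: "\<forall>i. k $ i \<in> \<int>"
  have "(g has_derivative frechet_derivative g (at (x + k))) (at (x + k))"
    by (rule smooth_on_differentiable[OF assms(1)])
  then have "((\<lambda>y. g (y + k)) has_derivative frechet_derivative g (at (x + k))) (at x)"
    by (rule has_derivative_compose[rotated, of g _ "\<lambda>y. y + k" x "\<lambda>h. h"])
       (auto intro!: derivative_eq_intros)
  moreover have "(\<lambda>y. g (y + k)) = g" using assms(2) k by (auto simp: periodic_def)
  ultimately show "partial j g (x + k) = partial j g x"
    using has_derivative_imp_partial by (metis (no_types) partial_def)
qed

section \<open>Slices in space and time of functions smooth up to the ends of the time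
  interval\<close>

lemma smooth_torus_time_derivs:
  fixes w :: "real \<Rightarrow> real^3 \<Rightarrow> 'b::real_normed_vector"
  assumes "((\<lambda>(x, t). w t x) has_derivative D) (at (x, t) within UNIV \<times> {0..1})" "t \<in> {0..1}"
  shows "(w t has_derivative (\<lambda>h. D (h, 0))) (at x)"
    "((\<lambda>s. w s x) has_vector_derivative D (0, 1)) (at t within {0..1})"
proof -
  have "((\<lambda>y. (\<lambda>(x, t). w t x) (y, t)) has_derivative (\<lambda>h. D (h, 0))) (at x within UNIV)"
  proof (rule has_derivative_in_compose[of "\<lambda>y. (y, t)" "\<lambda>h. (h, 0)" x UNIV "\<lambda>(x, t). w t x" D])
    show "((\<lambda>y. (y, t)) has_derivative (\<lambda>h. (h, 0))) (at x)"
      by (intro has_derivative_Pair has_derivative_ident has_derivative_const)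
    show "((\<lambda>(x, t). w t x) has_derivative D) (at (x, t) within range (\<lambda>y. (y, t)))"
      by (rule has_derivative_subset[OF assms(1)]) (use assms(2) in auto)
  qed
  then show "(w t has_derivative (\<lambda>h. D (h, 0))) (at x)" by simp
  have "((\<lambda>s. (\<lambda>(x, t). w t x) (x, s)) has_derivative (\<lambda>h. D (0, h))) (at t within {0..1})"
  proof (rule has_derivative_in_compose[of "\<lambda>s. (x, s)" "\<lambda>h. (0, h)" t "{0..1}" "\<lambda>(x, t). w t x" D])
    show "((\<lambda>s. (x, s)) has_derivative (\<lambda>h. (0, h))) (at t within {0..1})"
      by (intro has_derivative_Pair has_derivative_ident has_derivative_const)
    show "((\<lambda>(x, t). w t x) has_derivative D) (at (x, t) within (\<lambda>s. (x, s)) ` {0..1})"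
      by (rule has_derivative_subset[OF assms(1)]) auto
  qed
  also have "(\<lambda>h. D (0, h)) = (\<lambda>h. h *\<^sub>R D (0, 1))"
  proof
    show "D (0, h) = h *\<^sub>R D (0, 1)" for h
      using linear_scale[OF has_derivative_linear[OF assms(1)], of h "(0, 1)"] by simp
  qed
  finally show "((\<lambda>s. w s x) has_vector_derivative D (0, 1)) (at t within {0..1})"
    by (simp only: has_vector_derivative_def prod.case)
qed

text \<open>Taken within \<open>{0..1}\<close> to agree literally with the time derivative in
  \<open>NS_solution\<close>, one-sided at both ends.\<close>

definition time_deriv :: "(real \<Rightarrow> 'a \<Rightarrow> 'b::real_normed_vector) \<Rightarrow> real \<Rightarrow> 'a \<Rightarrow> 'b" where
  "time_deriv w t x = vector_derivative (\<lambda>s. w s x) (at t within {0..1})"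

lemma time_deriv_eq:
  assumes "((\<lambda>s. w s x) has_vector_derivative d) (at t within {0..1})" "t \<in> {0..1}"
  shows "time_deriv w t x = d"
  using assms vector_derivative_within_cbox[of 0 1 t "\<lambda>s. w s x" d] by (simp add: time_deriv_def)

lemma smooth_torus_time_slice:
  assumes "smooth_torus_time w" "t \<in> {0..1}"
  shows "smooth_on UNIV (w t)" "periodic (w t)"
proof -
  have "smooth_on UNIV (\<lambda>x. (\<lambda>(x, t). w t x) (x, t))"
    by (rule smooth_on_compose[OF _ smooth_on_pair_const, of "UNIV \<times> {0..1}"])
       (use assms in \<open>auto simp: smooth_torus_time_def\<close>)
  then show "smooth_on UNIV (w t)" by simp
  show "periodic (w t)" using assms by (simp add: smooth_torus_time_def)
qed

lemma smooth_torus_time_partial: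
  assumes "smooth_torus_time w"
  shows "smooth_torus_time (\<lambda>t. partial j (w t))"
  unfolding smooth_torus_time_def
proof
  show "\<forall>t\<in>{0..1}. periodic (partial j (w t))"
    using periodic_partial smooth_torus_time_slice[OF assms] by blast
  show "smooth_on (UNIV \<times> {0..1}) (\<lambda>(x, t). partial j (w t) x)"
  proof (rule smooth_on_directional)
    show "smooth_on (UNIV \<times> {0..1}) (\<lambda>(x, t). w t x)"
      using assms by (simp add: smooth_torus_time_def)
    show "(\<lambda>(x, t). partial j (w t) x) z = D (axis j 1, 0)"
      if "z \<in> UNIV \<times> {0..1}" "((\<lambda>(x, t). w t x) has_derivative D) (at z within UNIV \<times> {0..1})" for z D
      using that has_derivative_imp_partial[OF smooth_torus_time_derivs(1)[of w D "fst z" "snd z"]]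
      by (cases z) auto
  qed
qed

lemma smooth_torus_time_deriv:
  assumes "smooth_torus_time w"
  shows "smooth_on (UNIV \<times> {0..1}) (\<lambda>(x, t). time_deriv w t x)"
proof (rule smooth_on_directional)
  show "smooth_on (UNIV \<times> {0..1}) (\<lambda>(x, t). w t x)"
    using assms by (simp add: smooth_torus_time_def)
  show "(\<lambda>(x, t). time_deriv w t x) z = D (0, 1)"
    if "z \<in> UNIV \<times> {0..1}" "((\<lambda>(x, t). w t x) has_derivative D) (at z within UNIV \<times> {0..1})" for z D
    using that time_deriv_eq[where w = w and x = "fst z", OF smooth_torus_time_derivs(2)[of w D "fst z" "snd z"]]
    by (cases z) auto
qed

lemma smooth_torus_time_has_time_deriv:
  assumes "smooth_torus_time w" "t \<in> {0..1}"
  shows "((\<lambda>s. w s x) has_vector_derivative time_deriv w t x) (at t within {0..1})"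
proof -
  obtain D where "((\<lambda>(x, t). w t x) has_derivative D) (at (x, t) within UNIV \<times> {0..1})"
    using smooth_on_imp_has_derivative[of "UNIV \<times> {0..1}" "\<lambda>(x, t). w t x" "(x, t)"] assms
    by (auto simp: smooth_torus_time_def)
  from smooth_torus_time_derivs(2)[OF this assms(2)] show ?thesis
    using time_deriv_eq assms(2) by metis
qed

section \<open>Uniqueness\<close>

lemma partial_diff:
  assumes "smooth_on UNIV f" "smooth_on UNIV g"
  shows "partial j (\<lambda>x. f x - g x) x = partial j f x - partial j g x"
  unfolding partial_def[of j f] partial_def[of j g]
  by (rule has_derivative_imp_partial[OF has_derivative_diff[OF assms[THEN smooth_on_differentiable]]])

lemma partial_inner:
  fixes f g :: "real^3 \<Rightarrow> 'a::real_inner"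
  assumes "smooth_on UNIV f" "smooth_on UNIV g"
  shows "partial j (\<lambda>x. f x \<bullet> g x) x = f x \<bullet> partial j g x + partial j f x \<bullet> g x"
  unfolding partial_def[of j f] partial_def[of j g]
  by (rule has_derivative_imp_partial[OF has_derivative_inner[OF assms[THEN smooth_on_differentiable]]])

lemma partial_mult:
  fixes f g :: "real^3 \<Rightarrow> real"
  assumes "smooth_on UNIV f" "smooth_on UNIV g"
  shows "partial j (\<lambda>x. f x * g x) x = f x * partial j g x + partial j f x * g x"
  using partial_inner[OF assms] by simp

lemma partial_const: "partial j (\<lambda>x. c) x = 0"
  by (rule has_derivative_imp_partial[OF has_derivative_const])

lemma partial_nth:
  fixes f :: "real^3 \<Rightarrow> real^3"
  assumes "smooth_on UNIV f"
  shows "partial j (\<lambda>x. f x $ i) x = partial j f x $ i"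
  unfolding partial_def[of j f]
  by (rule has_derivative_imp_partial[OF bounded_linear.has_derivative[OF bounded_linear_vec_nth
        smooth_on_differentiable[OF assms]]])

lemma smooth_torus_time_diff:
  assumes "smooth_torus_time v" "smooth_torus_time w"
  shows "smooth_torus_time (\<lambda>t x. v t x - w t x)"
  using assms smooth_on_diff[of "UNIV \<times> {0..1}" "\<lambda>(x, t). v t x" "\<lambda>(x, t). w t x"]
  unfolding smooth_torus_time_def periodic_def case_prod_beta by auto

lemma smooth_torus_time_continuous:
  assumes "smooth_torus_time w" shows "continuous_on (UNIV \<times> {0..1}) (\<lambda>(x, t). w t x)"
  using assms smooth_on_imp_continuous_on unfolding smooth_torus_time_def by blast

lemma continuous_on_swap:
  assumes "continuous_on (UNIV \<times> T) (\<lambda>(x, t). w t x)"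
  shows "continuous_on (T \<times> S) (\<lambda>(t, x). w t x)"
proof -
  have "continuous_on (T \<times> S) (\<lambda>z. (\<lambda>(x, t). w t x) (snd z, fst z))"
    by (rule continuous_on_compose2[OF assms]) (auto intro!: continuous_intros)
  then show ?thesis by (simp add: case_prod_beta)
qed

text \<open>Subtract the equations, split the advection as v . grad e + e . grad u, and test with
  \<open>2 * e\<close>. As \<open>v\<close> and \<open>e\<close> are divergence free, transport by
  \<open>v\<close> and the pressure are pure divergences, and so is the viscous term up to a
  negative square. \<open>G\<close> collects these fluxes, whose integrals vanish by periodicity;
  only e . grad u can feed the energy.\<close>

lemma NS_energy_identity:
  fixes u v :: "real \<Rightarrow> real^3 \<Rightarrow> real^3"
  assumes u: "NS_solution \<nu> f u0 u p" and v: "NS_solution \<nu> f u0 v q" and t: "t \<in> {0..1}"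
  defines "e \<equiv> \<lambda>t x. v t x - u t x"
  defines "G \<equiv> \<lambda>j x. 2 * \<nu> * (e t x \<bullet> partial j (e t) x) - v t x $ j * (e t x \<bullet> e t x)
    - 2 * (e t x $ j * (q t x - p t x))"
  shows "2 * (e t x \<bullet> time_deriv e t x) = - 2 * (\<Sum>j\<in>UNIV. e t x $ j * (partial j (u t) x \<bullet> e t x))
      - 2 * \<nu> * (\<Sum>j\<in>UNIV. (norm (partial j (e t) x))\<^sup>2) + (\<Sum>j\<in>UNIV. partial j (G j) x)" (is ?A)
    and "smooth_on UNIV (G j)" and "periodic (G j)"
proof -
  have st: "smooth_torus_time u" "smooth_torus_time v" "smooth_torus_time p" "smooth_torus_time q"
    using u v by (auto simp: NS_solution_def)
  note s [smooth] = st[THEN smooth_torus_time_slice(1), OF t]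
  note per = st[THEN smooth_torus_time_slice(2), OF t]
  have e [smooth]: "smooth_on UNIV (e t)" unfolding e_def by (intro smooth)
  show "smooth_on UNIV (G j)" unfolding G_def by (intro smooth)
  have "periodic (e t)" using per by (simp add: e_def periodic_def)
  with periodic_partial[OF e this] per show "periodic (G j)"
    unfolding periodic_def G_def by simp
  have pe: "partial j (e t) = (\<lambda>x. partial j (v t) x - partial j (u t) x)" for j
    unfolding e_def by (intro ext partial_diff s)
  have ex: "e t x = v t x - u t x" by (simp add: e_def)
  have ppe: "partial j (partial j (e t)) x = partial j (partial j (v t)) x - partial j (partial j (u t)) x" for j
    unfolding pe by (intro partial_diff smooth)
  have ns: "time_deriv w t x + advection (w t) (w t) x + gradient (r t) x = \<nu> *\<^sub>R laplacian (w t) x + f t x"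
    "divergence (w t) x = 0" if "NS_solution \<nu> f u0 w r" for w r
    using that t unfolding NS_solution_def time_deriv_def by blast+
  have "time_deriv e t x = time_deriv v t x - time_deriv u t x"
    unfolding e_def using st t
    by (intro time_deriv_eq has_vector_derivative_diff smooth_torus_time_has_time_deriv)
  also have "\<dots> = \<nu> *\<^sub>R (laplacian (v t) x - laplacian (u t) x)
      - (advection (v t) (v t) x - advection (u t) (u t) x) - (gradient (q t) x - gradient (p t) x)"
    using ns(1)[OF u, unfolded add.assoc, folded eq_diff_eq] ns(1)[OF v, unfolded add.assoc, folded eq_diff_eq]
    by (simp add: scaleR_right_diff_distrib)
  also have "laplacian (v t) x - laplacian (u t) x = (\<Sum>j\<in>UNIV. partial j (partial j (e t)) x)"
    by (simp add: laplacian_def ppe sum_subtractf)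
  also have "advection (v t) (v t) x - advection (u t) (u t) x =
      (\<Sum>j\<in>UNIV. v t x $ j *\<^sub>R partial j (e t) x + e t x $ j *\<^sub>R partial j (u t) x)"
    unfolding advection_def sum_subtractf[symmetric]
    by (rule sum.cong) (auto simp: pe ex algebra_simps)
  finally have td: "e t x \<bullet> time_deriv e t x = \<nu> * (\<Sum>j\<in>UNIV. e t x \<bullet> partial j (partial j (e t)) x)
      - (\<Sum>j\<in>UNIV. v t x $ j * (e t x \<bullet> partial j (e t) x) + e t x $ j * (e t x \<bullet> partial j (u t) x))
      - e t x \<bullet> (gradient (q t) x - gradient (p t) x)"
    by (simp add: inner_diff_right inner_sum_right inner_add_right)
  have grad: "e t x \<bullet> (gradient (q t) x - gradient (p t) x) =
      (\<Sum>j\<in>UNIV. e t x $ j * (partial j (q t) x - partial j (p t) x))"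
    by (simp add: inner_vec_def gradient_def)
  have G: "partial j (G j) x = 2 * \<nu> * (e t x \<bullet> partial j (partial j (e t)) x + (norm (partial j (e t) x))\<^sup>2)
      - (2 * (v t x $ j * (e t x \<bullet> partial j (e t) x)) + partial j (v t) x $ j * (e t x \<bullet> e t x))
      - 2 * (e t x $ j * (partial j (q t) x - partial j (p t) x)
        + partial j (e t) x $ j * (q t x - p t x))" for j
    unfolding G_def
    apply (subst partial_diff partial_mult partial_inner partial_nth partial_const; (intro smooth)?)+
    apply (simp add: inner_commute power2_norm_eq_inner algebra_simps)
    done
  have dv: "(\<Sum>j\<in>UNIV. partial j (v t) x $ j) = 0" and du: "(\<Sum>j\<in>UNIV. partial j (u t) x $ j) = 0"
    using ns(2)[OF v] ns(2)[OF u] by (simp_all add: divergence_def)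
  have de: "(\<Sum>j\<in>UNIV. partial j (e t) x $ j) = 0"
    using dv du by (simp add: pe sum_subtractf)
  have "(\<Sum>j\<in>UNIV. partial j (v t) x $ j * (e t x \<bullet> e t x)) = 0"
    "(\<Sum>j\<in>UNIV. partial j (e t) x $ j * (q t x - p t x)) = 0"
    using dv de by (simp_all add: sum_distrib_right[symmetric])
  then show ?A
    unfolding td grad G
    by (simp add: sum.distrib sum_subtractf sum_distrib_left[symmetric] inner_commute algebra_simps)
qed

text \<open>Gronwall's inequality for the squared L2 norm \<open>E\<close> of the difference. Its
  rate \<open>K\<close> comes from a bound of the gradient of \<open>u\<close> on the compact
  cylinder; the viscous term has the good sign and is dropped.\<close>

lemma NS_unique:
  fixes u v :: "real \<Rightarrow> real^3 \<Rightarrow> real^3"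
  assumes u: "NS_solution \<nu> f u0 u p" and v: "NS_solution \<nu> f u0 v q" and \<nu>: "\<nu> \<ge> 0"
    and t: "t \<in> {0..1}"
  shows "v t x = u t x"
proof -
  define e where "e = (\<lambda>t x. v t x - u t x)"
  define E where "E = (\<lambda>t. integral (cbox 0 One) (\<lambda>x. e t x \<bullet> e t x))"
  define E' where "E' = (\<lambda>t. integral (cbox 0 One) (\<lambda>x. 2 * (e t x \<bullet> time_deriv e t x)))"
  have st: "smooth_torus_time u" "smooth_torus_time v"
    using u v by (auto simp: NS_solution_def)
  have e: "smooth_torus_time e"
    unfolding e_def using st by (intro smooth_torus_time_diff)
  have ce: "continuous_on ({0..1} \<times> cbox 0 One) (\<lambda>(t, x). e t x)"
    by (rule continuous_on_swap[OF smooth_torus_time_continuous[OF e]])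
  have cet: "continuous_on ({0..1} \<times> cbox 0 One) (\<lambda>(t, x). time_deriv e t x)"
    by (rule continuous_on_swap[OF smooth_on_imp_continuous_on[OF smooth_torus_time_deriv[OF e]]])
  note se [smooth] = smooth_torus_time_slice(1)[OF e]
  have cs: "continuous_on S g" if "smooth_on UNIV g" for S and g :: "real^3 \<Rightarrow> real"
    using smooth_on_imp_continuous_on[OF that] continuous_on_subset by blast
  have E': "(E has_vector_derivative E' s) (at s within {0..1})" if "s \<in> {0..1}" for s
    unfolding E_def E'_def
  proof (rule leibniz_rule_vector_derivative[where fx = "\<lambda>s x. 2 * (e s x \<bullet> time_deriv e s x)"])
    fix s y assume "s \<in> {0..1::real}"
    from smooth_torus_time_has_time_deriv[OF e this, of y]
    have "((\<lambda>s. e s y \<bullet> e s y) has_vector_derivative e s y \<bullet> time_deriv e s y + time_deriv e s y \<bullet> e s y)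
        (at s within {0..1})"
      by (intro bounded_bilinear.has_vector_derivative[OF bounded_bilinear_inner])
    then show "((\<lambda>s. e s y \<bullet> e s y) has_vector_derivative 2 * (e s y \<bullet> time_deriv e s y))
        (at s within {0..1})" by (simp add: inner_commute)
  next
    show "(\<lambda>x. e s x \<bullet> e s x) integrable_on cbox 0 One" if "s \<in> {0..1}" for s
      using that by (intro integrable_continuous cs smooth)
    show "continuous_on ({0..1} \<times> cbox 0 One) (\<lambda>(s, x). 2 * (e s x \<bullet> time_deriv e s x))"
      using ce cet unfolding case_prod_beta by (intro continuous_intros)
  qed (use that in auto)
  have "\<exists>B. \<forall>s\<in>{0..1}. \<forall>x\<in>cbox 0 One. norm (partial j (u s) x) \<le> B" for j
  proof -
    have "compact ((\<lambda>(s, x). partial j (u s) x) ` ({0..1} \<times> cbox 0 One))"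
      by (intro compact_continuous_image compact_Times compact_cbox compact_Icc
          continuous_on_swap[OF smooth_torus_time_continuous[OF smooth_torus_time_partial[OF st(1)]]])
    from compact_imp_bounded[OF this] obtain B
      where B: "\<And>z. z \<in> (\<lambda>(s, x). partial j (u s) x) ` ({0..1} \<times> cbox 0 One) \<Longrightarrow> norm z \<le> B"
      unfolding bounded_iff by blast
    have "norm (partial j (u s) x) \<le> B" if "s \<in> {0..1}" "x \<in> cbox 0 One" for s x
      by (rule B, rule image_eqI[of _ _ "(s, x)"]) (use that in simp_all)
    then show ?thesis by blast
  qed
  then obtain B where B: "\<And>j s x. s \<in> {0..1} \<Longrightarrow> x \<in> cbox 0 One \<Longrightarrow> norm (partial j (u s) x) \<le> B j"
    by metis
  define K where "K = 2 * (\<Sum>j\<in>UNIV. B j)"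
  have E'_le: "E' s \<le> K * E s" if s: "s \<in> {0..1}" for s
  proof -
    define G where "G = (\<lambda>j x. 2 * \<nu> * (e s x \<bullet> partial j (e s) x) - v s x $ j * (e s x \<bullet> e s x)
      - 2 * (e s x $ j * (q s x - p s x)))"
    have id: "2 * (e s x \<bullet> time_deriv e s x) = - 2 * (\<Sum>j\<in>UNIV. e s x $ j * (partial j (u s) x \<bullet> e s x))
      - 2 * \<nu> * (\<Sum>j\<in>UNIV. (norm (partial j (e s) x))\<^sup>2) + (\<Sum>j\<in>UNIV. partial j (G j) x)"
      "smooth_on UNIV (G j)" "periodic (G j)" for x j
      using NS_energy_identity(1)[OF u v s, of x] NS_energy_identity(2,3)[OF u v s, of j]
      unfolding e_def G_def by blast+
    have sp: "smooth_on UNIV (partial j (G j))" "smooth_on UNIV (\<lambda>x. e s x \<bullet> e s x)" for j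
      using id(2) s by (auto intro!: smooth)
    have i: "partial j (G j) integrable_on cbox 0 One" for j
      by (intro integrable_continuous cs sp)
    have "E' s \<le> integral (cbox 0 One) (\<lambda>x. K * (e s x \<bullet> e s x) + (\<Sum>j\<in>UNIV. partial j (G j) x))"
      unfolding E'_def
    proof (rule integral_le)
      have "continuous_on (cbox 0 One) (\<lambda>x. (\<lambda>(t, x). e t x) (s, x))"
        "continuous_on (cbox 0 One) (\<lambda>x. (\<lambda>(t, x). time_deriv e t x) (s, x))"
        using s by (intro continuous_on_compose2[OF ce] continuous_on_compose2[OF cet];
            auto intro!: continuous_intros)+
      then show "(\<lambda>x. 2 * (e s x \<bullet> time_deriv e s x)) integrable_on cbox 0 One"
        by (intro integrable_continuous continuous_intros) auto
      show "(\<lambda>x. K * (e s x \<bullet> e s x) + (\<Sum>j\<in>UNIV. partial j (G j) x)) integrable_on cbox 0 One"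
        by (intro integrable_continuous cs smooth sp)
      fix x :: "real^3" assume x: "x \<in> cbox 0 One"
      have "- (e s x $ j * (partial j (u s) x \<bullet> e s x)) \<le> B j * (e s x \<bullet> e s x)" for j
      proof -
        have "- (e s x $ j * (partial j (u s) x \<bullet> e s x)) \<le> \<bar>e s x $ j\<bar> * \<bar>partial j (u s) x \<bullet> e s x\<bar>"
          by (metis abs_ge_minus_self abs_mult)
        also have "\<dots> \<le> norm (e s x) * (norm (partial j (u s) x) * norm (e s x))"
          by (intro mult_mono component_le_norm_cart Cauchy_Schwarz_ineq2) auto
        also have "\<dots> \<le> norm (e s x) * (B j * norm (e s x))"
          by (intro mult_left_mono mult_right_mono B s x) auto
        finally show ?thesis by (simp add: dot_square_norm power2_eq_square algebra_simps)
      qed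
      then have "(\<Sum>j\<in>UNIV. - (e s x $ j * (partial j (u s) x \<bullet> e s x))) \<le> (\<Sum>j\<in>UNIV. B j * (e s x \<bullet> e s x))"
        by (rule sum_mono)
      moreover have "0 \<le> \<nu> * (\<Sum>j\<in>UNIV. (norm (partial j (e s) x))\<^sup>2)"
        using \<nu> by (intro mult_nonneg_nonneg sum_nonneg) auto
      ultimately show "2 * (e s x \<bullet> time_deriv e s x) \<le> K * (e s x \<bullet> e s x) + (\<Sum>j\<in>UNIV. partial j (G j) x)"
        unfolding id(1) by (simp add: K_def sum_negf sum_distrib_right[symmetric])
    qed
    also have "\<dots> = K * E s + (\<Sum>j\<in>UNIV. integral (cbox 0 One) (partial j (G j)))"
      unfolding E_def using i sp
      by (subst integral_add)
         (auto intro!: integrable_continuous cs smooth_on_sum smooth_on_mult smooth_on_const simp: integral_sum)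
    also have "(\<Sum>j\<in>UNIV. integral (cbox 0 One) (partial j (G j))) = 0"
      using integral_cube_partial[OF id(2) id(3)] by simp
    finally show ?thesis by simp
  qed
  \<comment> \<open>A non-integrable integrand has integral 0 by convention, so this holds for every
    real \<open>s\<close>.\<close>
  have E_nonneg: "E s \<ge> 0" for s
    unfolding E_def
    by (cases "(\<lambda>x. e s x \<bullet> e s x) integrable_on cbox 0 One")
       (simp_all add: Henstock_Kurzweil_Integration.integral_nonneg not_integrable_integral)
  have E0: "E 0 = 0"
    using u v by (simp add: E_def e_def NS_solution_def)
  have "E t = 0"
  proof (cases "t = 0")
    case False
    with t have t: "0 < t" "t \<le> 1" by auto
    \<comment> \<open>The integrating factor turns the differential inequality into monotonicity:
      \<open>F\<close> cannot increase, starts at 0 and is nonnegative.\<close>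
    define F where "F = (\<lambda>s. exp (- K * s) * E s)"
    have "(F has_derivative (\<lambda>h. h *\<^sub>R (exp (- K * s) * (E' s - K * E s)))) (at s within {0..t})"
      if "0 \<le> s" "s \<le> t" for s
    proof -
      have "(E has_vector_derivative E' s) (at s within {0..t})"
        by (rule has_vector_derivative_within_subset[OF E']) (use that t in auto)
      then have "(E has_real_derivative E' s) (at s within {0..t})"
        by (simp add: has_real_derivative_iff_has_vector_derivative)
      then have "(F has_real_derivative exp (- K * s) * (E' s - K * E s)) (at s within {0..t})"
        unfolding F_def by (auto intro!: derivative_eq_intros simp: algebra_simps)
      then show ?thesis
        by (simp add: has_field_derivative_def mult_commute_abs)
    qed
    then obtain s where s: "s \<in> {0<..<t}" "F t - F 0 = (t - 0) *\<^sub>R (exp (- K * s) * (E' s - K * E s))"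
      using mvt_simple[OF t(1), of F "\<lambda>s h. h *\<^sub>R (exp (- K * s) * (E' s - K * E s))"] by auto
    have "F t - F 0 \<le> 0"
      unfolding s(2) using E'_le[of s] s(1) t
      by (auto intro!: mult_nonneg_nonpos)
    then have "E t \<le> 0" using E0 by (simp add: F_def mult_le_0_iff)
    with E_nonneg show ?thesis by (simp add: antisym)
  qed (use E0 in simp)
  have i: "continuous_on (cbox 0 One) (\<lambda>x. e t x \<bullet> e t x)"
    using t by (intro cs smooth)
  have "((\<lambda>x. e t x \<bullet> e t x) has_integral 0) (cbox 0 One)"
    using integrable_integral[OF integrable_continuous[OF i]] \<open>E t = 0\<close> by (simp add: E_def)
  then have z: "e t y \<bullet> e t y = 0" if "y \<in> cbox 0 One" for y
    using i that by (intro has_integral_0_cbox_imp_0[of 0 One]) (auto simp: box_ne_empty)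
  \<comment> \<open>So far \<open>e\<close> vanishes on the unit cube only; this integer vector
    brings an arbitrary point there.\<close>
  define k :: "real^3" where "k = (\<chi> i. of_int (- \<lfloor>x $ i\<rfloor>))"
  have "x + k \<in> cbox 0 One"
    unfolding mem_unit_cube by (auto simp: k_def) linarith+
  from z[OF this] have "e t (x + k) = 0" by simp
  moreover have "periodic (e t)" using smooth_torus_time_slice(2)[OF e t] .
  ultimately have "e t x = 0" by (auto simp: periodic_def k_def)
  then show ?thesis by (simp add: e_def)
qed

section \<open>Profiles and their periodic lifts\<close>

lemma vector3_eq_axis:
  "(vector [a, b, c] :: real^3) = a *\<^sub>R axis 1 1 + b *\<^sub>R axis 2 1 + c *\<^sub>R axis 3 1"
  by (simp add: vec_eq_iff axis_def forall_3)

lemma has_derivative_vector3: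
  fixes f g h :: "'a::real_normed_vector \<Rightarrow> real"
  assumes "(f has_derivative f') F" "(g has_derivative g') F" "(h has_derivative h') F"
  shows "((\<lambda>x. vector [f x, g x, h x] :: real^3) has_derivative (\<lambda>v. vector [f' v, g' v, h' v])) F"
  unfolding vector3_eq_axis
  by (intro has_derivative_add has_derivative_scaleR_left assms)

lemma linear_vector3:
  fixes D :: "real^3 \<Rightarrow> 'b::real_vector"
  assumes "linear D"
  shows "D (vector [a, b, c]) = a *\<^sub>R D (axis 1 1) + b *\<^sub>R D (axis 2 1) + c *\<^sub>R D (axis 3 1)"
  unfolding vector3_eq_axis by (simp add: linear_add[OF assms] linear_scale[OF assms])

lemma partial_add:
  assumes "smooth_on UNIV f" "smooth_on UNIV g"
  shows "partial j (\<lambda>x. f x + g x) x = partial j f x + partial j g x"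
  unfolding partial_def[of j f] partial_def[of j g]
  by (rule has_derivative_imp_partial[OF has_derivative_add[OF assms[THEN smooth_on_differentiable]]])

lemma partial_cmult:
  fixes f :: "real^3 \<Rightarrow> real"
  assumes "smooth_on UNIV f"
  shows "partial j (\<lambda>x. c * f x) x = c * partial j f x"
  unfolding partial_def[of j f]
  by (rule has_derivative_imp_partial[OF has_derivative_mult_right[OF smooth_on_differentiable[OF assms]]])

lemma partial_vector3:
  fixes f g h :: "real^3 \<Rightarrow> real"
  assumes "smooth_on UNIV f" "smooth_on UNIV g" "smooth_on UNIV h"
  shows "partial j (\<lambda>x. vector [f x, g x, h x] :: real^3) x = vector [partial j f x, partial j g x, partial j h x]"
  unfolding partial_def[of j f] partial_def[of j g] partial_def[of j h]
  by (rule has_derivative_imp_partial[OF has_derivative_vector3[OF assms[THEN smooth_on_differentiable]]])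

text \<open>
  A profile is a function of an angle (first coordinate) and of two rescaled space coordinates.
\<close>

definition profile :: "(real^3 \<Rightarrow> real) \<Rightarrow> bool" where
  "profile P \<longleftrightarrow> smooth_on UNIV P \<and> (\<forall>y. \<bar>y $ 2\<bar> > 2 \<or> \<bar>y $ 3\<bar> > 2 \<longrightarrow> P y = 0) \<and>
    (\<forall>y (k::int). P (y + axis 1 (2 * pi * of_int k)) = P y)"

lemma profile_smooth: "profile P \<Longrightarrow> smooth_on UNIV P"
  by (simp add: profile_def)

lemma profile_add: "profile P \<Longrightarrow> profile Q \<Longrightarrow> profile (\<lambda>y. P y + Q y)"
  by (auto simp: profile_def intro: smooth)

lemma profile_minus: "profile P \<Longrightarrow> profile (\<lambda>y. - P y)"
  by (auto simp: profile_def intro: smooth)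

lemma profile_diff: "profile P \<Longrightarrow> profile Q \<Longrightarrow> profile (\<lambda>y. P y - Q y)"
  by (auto simp: profile_def intro: smooth)

lemma profile_mult: "profile P \<Longrightarrow> profile Q \<Longrightarrow> profile (\<lambda>y. P y * Q y)"
  by (auto simp: profile_def intro: smooth)

lemma profile_partial:
  assumes P: "profile P"
  shows "profile (partial j P)"
  unfolding profile_def
proof (intro conjI allI impI)
  show "smooth_on UNIV (partial j P)" by (intro smooth_on_partial profile_smooth P)
next
  fix y :: "real^3" assume y: "\<bar>y $ 2\<bar> > 2 \<or> \<bar>y $ 3\<bar> > 2"
  have "open {y::real^3. \<bar>y $ 2\<bar> > 2 \<or> \<bar>y $ 3\<bar> > 2}"
    by (intro open_Collect_disj open_Collect_less continuous_intros)
  moreover have "((\<lambda>y::real^3. 0::real) has_derivative (\<lambda>h. 0)) (at y)" by simp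
  ultimately have "(P has_derivative (\<lambda>h. 0)) (at y)"
    by (intro has_derivative_transform_within_open[of "\<lambda>y. 0" "\<lambda>h. 0" y UNIV
          "{y. \<bar>y $ 2\<bar> > 2 \<or> \<bar>y $ 3\<bar> > 2}" P])
       (use y P in \<open>auto simp: profile_def\<close>)
  then show "partial j P y = 0" by (rule has_derivative_imp_partial)
next
  fix y :: "real^3" and k :: int
  let ?c = "axis 1 (2 * pi * of_int k) :: real^3"
  have "(P has_derivative frechet_derivative P (at (y + ?c))) (at (y + ?c))"
    by (intro smooth_on_differentiable profile_smooth P)
  then have "((\<lambda>y. P (y + ?c)) has_derivative frechet_derivative P (at (y + ?c))) (at y)"
    by (rule has_derivative_compose[rotated, of P _ "\<lambda>y. y + ?c" y "\<lambda>h. h"])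
       (auto intro!: derivative_eq_intros)
  moreover have "(\<lambda>y. P (y + ?c)) = P" using P by (auto simp: profile_def)
  ultimately show "partial j P (y + ?c) = partial j P y"
    using has_derivative_imp_partial by (metis (no_types) partial_def)
qed

text \<open>Periodicity in the angle and bounded support in the other two coordinates reduce this to
  continuity on a compact box.\<close>

lemma profile_bounded:
  assumes P: "profile P"
  obtains B where "\<And>y. \<bar>P y\<bar> \<le> B"
proof -
  define K :: "(real^3) set" where "K = cbox (vector [0, -2, -2]) (vector [2 * pi, 2, 2])"
  have "compact (P ` K)"
    unfolding K_def
    by (intro compact_continuous_image compact_cbox
        continuous_on_subset[OF smooth_on_imp_continuous_on[OF profile_smooth[OF P]]]) auto
  from compact_imp_bounded[OF this] obtain B where B: "\<And>z. z \<in> P ` K \<Longrightarrow> norm z \<le> B"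
    unfolding bounded_iff by blast
  have "\<bar>P y\<bar> \<le> \<bar>B\<bar>" for y
  proof (cases "\<bar>y $ 2\<bar> > 2 \<or> \<bar>y $ 3\<bar> > 2")
    case True
    then show ?thesis using P by (auto simp: profile_def)
  next
    case False
    define k where "k = \<lfloor>y $ 1 / (2 * pi)\<rfloor>"
    have k: "of_int k \<le> y $ 1 / (2 * pi)" "y $ 1 / (2 * pi) \<le> of_int k + 1"
      unfolding k_def by linarith+
    then have "2 * pi * of_int k \<le> y $ 1" "y $ 1 \<le> 2 * pi * of_int k + 2 * pi"
      by (simp_all add: field_simps)
    then have "y + axis 1 (2 * pi * of_int (- k)) \<in> K"
      using False by (auto simp: K_def mem_box_cart forall_3 axis_def)
    then have "norm (P (y + axis 1 (2 * pi * of_int (- k)))) \<le> B" using B by blast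
    moreover have "P (y + axis 1 (2 * pi * of_int (- k))) = P y"
      using P unfolding profile_def by blast
    ultimately show ?thesis by simp
  qed
  then show thesis by (rule that)
qed

text \<open>A single constant, fixed before \<open>lam\<close>, \<open>r\<close> and
  \<open>N\<close>, will make the bounds on the forces uniform in \<open>m\<close>. No derivative in
  the angle occurs because only space derivatives of the force are measured.\<close>

lemma finite_profiles_bounded:
  assumes "finite \<P>" "\<And>P. P \<in> \<P> \<Longrightarrow> profile P"
  shows "\<exists>B\<ge>1. \<forall>P\<in>\<P>. \<forall>y. \<bar>P y\<bar> \<le> B \<and> \<bar>partial 2 P y\<bar> \<le> B \<and> \<bar>partial 3 P y\<bar> \<le> B"
  using assms
proof (induction \<P>)
  case (insert P \<P>)
  then obtain B where B: "B \<ge> 1"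
    "\<forall>P\<in>\<P>. \<forall>y. \<bar>P y\<bar> \<le> B \<and> \<bar>partial 2 P y\<bar> \<le> B \<and> \<bar>partial 3 P y\<bar> \<le> B" by auto
  from insert have P: "profile P" by auto
  obtain B1 where B1: "\<And>y. \<bar>P y\<bar> \<le> B1" using profile_bounded[OF P] by blast
  obtain B2 where B2: "\<And>y. \<bar>partial 2 P y\<bar> \<le> B2" using profile_bounded[OF profile_partial[OF P]] by blast
  obtain B3 where B3: "\<And>y. \<bar>partial 3 P y\<bar> \<le> B3" using profile_bounded[OF profile_partial[OF P]] by blast
  have "1 \<le> max B (max B1 (max B2 B3))" using B by simp
  moreover have "\<forall>Q\<in>insert P \<P>. \<forall>y. \<bar>Q y\<bar> \<le> max B (max B1 (max B2 B3)) \<and>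
      \<bar>partial 2 Q y\<bar> \<le> max B (max B1 (max B2 B3)) \<and> \<bar>partial 3 Q y\<bar> \<le> max B (max B1 (max B2 B3))"
    using B(2) B1 B2 B3 by (auto simp: le_max_iff_disj)
  ultimately show ?case by blast
qed (auto intro: exI[of _ 1])

section \<open>Periodic lifts of rescaled profiles\<close>

definition centred :: "real \<Rightarrow> real" where
  "centred s = s - \<lfloor>s\<rfloor> - 1/2"

lemma centred_add_Ints: "k \<in> \<int> \<Longrightarrow> centred (s + k) = centred s"
  by (auto simp: centred_def elim!: Ints_cases)

text \<open>Near a cell, \<open>centred\<close> either agrees with the affine coordinate of that
  cell, or both are larger than 1/4. In the second case both versions of a rescaled profile vanish,
  so the jumps of \<open>centred\<close> are invisible.\<close>

lemma centred_alternatives: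
  assumes "\<bar>s - of_int k - 1/2\<bar> < 3/4"
  shows "centred s = s - of_int k - 1/2 \<or> \<bar>centred s\<bar> > 1/4 \<and> \<bar>s - of_int k - 1/2\<bar> > 1/4"
proof (cases "\<lfloor>s\<rfloor> = k")
  case True
  then show ?thesis by (simp add: centred_def)
next
  case False
  have fl: "real_of_int \<lfloor>s\<rfloor> \<le> s" "s < real_of_int \<lfloor>s\<rfloor> + 1" by linarith+
  have d: "s - of_int k - 1/2 < 3/4" "- (3/4) < s - of_int k - 1/2"
    using assms by (simp_all only: abs_less_iff) linarith
  from False consider "\<lfloor>s\<rfloor> \<le> k - 1" | "\<lfloor>s\<rfloor> \<ge> k + 1" by linarith
  then show ?thesis
  proof cases
    case 1
    then have "real_of_int \<lfloor>s\<rfloor> \<le> of_int k - 1" by linarith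
    with d fl have "centred s > 1/4" "s - of_int k - 1/2 < - 1/4"
      unfolding centred_def by linarith+
    then show ?thesis by auto
  next
    case 2
    then have "real_of_int \<lfloor>s\<rfloor> \<ge> of_int k + 1" by linarith
    with d fl have "centred s < - 1/4" "s - of_int k - 1/2 > 1/4"
      unfolding centred_def by linarith+
    then show ?thesis by auto
  qed
qed

lemma angle_shift:
  "sin (s + 2 * pi * of_int k) = sin s" "cos (s + 2 * pi * of_int k) = cos s"
  using sin_int_2pin[of k] cos_int_2pin[of k] by (simp_all add: sin_add cos_add)

text \<open>\<open>exp lam = real N\<close> is the available growth factor, matched to the
  frequency. The bound on \<open>r\<close> keeps the column, of half-width \<open>2 * r\<close>,
  within 1/4 of the cell centre. By \<open>1 / r \<le> real N\<close>, horizontal derivatives are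
  never worse than vertical ones.\<close>

locale cell =
  fixes lam r :: real and N :: nat
  assumes lam: "exp lam = real N" and r: "0 < r" "r \<le> 1/8" and N: "N \<ge> 1" "1 / r \<le> real N"
begin

definition n :: real where "n = 2 * pi * real N"

text \<open>The angle is quadratic in time so that its speed \<open>2 * lam * t\<close> vanishes at
  time 0 and the large scale flow starts from rest.\<close>

definition coord :: "real \<Rightarrow> real^3 \<Rightarrow> real^3" where
  "coord t x = vector [lam * t\<^sup>2, centred (x $ 1) / r, centred (x $ 2) / r]"

definition lift :: "(real^3 \<Rightarrow> real) \<Rightarrow> real \<Rightarrow> real^3 \<Rightarrow> real" where
  "lift P t x = P (coord t x)"

text \<open>Freezing the two integer parts at the base point replaces \<open>coord\<close> by a
  smooth map \<open>A\<close>. On the neighbourhood \<open>U\<close>, \<open>P\<close> has the same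
  value at \<open>A z\<close> as at \<open>coord\<close>, by
  \<open>centred_alternatives\<close>.\<close>

lemma lift_has_derivative:
  assumes P: "profile P"
  shows "((\<lambda>z. lift P (snd z) (fst z)) has_derivative (\<lambda>h. 2 * lam * t * snd h * lift (partial 1 P) t x
    + fst h $ 1 / r * lift (partial 2 P) t x + fst h $ 2 / r * lift (partial 3 P) t x)) (at (x, t))"
proof -
  define k1 k2 where k: "k1 = \<lfloor>x $ 1\<rfloor>" "k2 = \<lfloor>x $ 2\<rfloor>"
  define A :: "(real^3) \<times> real \<Rightarrow> real^3" where
    "A z = vector [lam * (snd z)\<^sup>2, (fst z $ 1 - of_int k1 - 1/2) / r, (fst z $ 2 - of_int k2 - 1/2) / r]" for z
  define U :: "((real^3) \<times> real) set" where
    "U = {z. \<bar>fst z $ 1 - of_int k1 - 1/2\<bar> < 3/4 \<and> \<bar>fst z $ 2 - of_int k2 - 1/2\<bar> < 3/4}"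
  have A: "A (x, t) = coord t x"
    by (simp add: A_def coord_def centred_def k)
  define D where "D = frechet_derivative P (at (A (x, t)))"
  have D: "(P has_derivative D) (at (A (x, t)))"
    unfolding D_def by (intro smooth_on_differentiable profile_smooth P)
  have "(A has_derivative (\<lambda>h. vector [2 * lam * t * snd h, fst h $ 1 / r, fst h $ 2 / r])) (at (x, t))"
    unfolding A_def using r
    by (intro has_derivative_vector3)
       (auto intro!: derivative_eq_intros bounded_linear.has_derivative[OF bounded_linear_vec_nth])
  then have "((\<lambda>z. P (A z)) has_derivative
      (\<lambda>h. D (vector [2 * lam * t * snd h, fst h $ 1 / r, fst h $ 2 / r]))) (at (x, t))"
    by (rule has_derivative_compose[where f = A and g = P, OF _ D])
  also have "(\<lambda>h. D (vector [2 * lam * t * snd h, fst h $ 1 / r, fst h $ 2 / r])) =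
      (\<lambda>h. 2 * lam * t * snd h * lift (partial 1 P) t x
        + fst h $ 1 / r * lift (partial 2 P) t x + fst h $ 2 / r * lift (partial 3 P) t x)"
    using has_derivative_linear[OF D]
    by (simp add: fun_eq_iff linear_vector3 lift_def partial_def D_def A)
  finally have d: "((\<lambda>z. P (A z)) has_derivative \<dots>) (at (x, t))" .
  show ?thesis
  proof (rule has_derivative_transform_within_open[OF d, of U])
    show "open U"
      unfolding U_def by (intro open_Collect_conj open_Collect_less continuous_intros)
    show "(x, t) \<in> U"
      unfolding U_def k mem_Collect_eq fst_conv by linarith
    show "P (A z) = lift P (snd z) (fst z)" if "z \<in> U" for z
    proof -
      \<comment> \<open>This is where \<open>r \<le> 1/8\<close> enters: a distance above 1/4 is
        rescaled beyond the support.\<close>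
      have big: "\<bar>c / r\<bar> > 2" if "\<bar>c\<bar> > 1/4" for c :: real
        using that r by (simp add: field_simps abs_divide)
      have a: "centred (fst z $ 1) = fst z $ 1 - of_int k1 - 1/2 \<or>
          \<bar>centred (fst z $ 1) / r\<bar> > 2 \<and> \<bar>(fst z $ 1 - of_int k1 - 1/2) / r\<bar> > 2"
        "centred (fst z $ 2) = fst z $ 2 - of_int k2 - 1/2 \<or>
          \<bar>centred (fst z $ 2) / r\<bar> > 2 \<and> \<bar>(fst z $ 2 - of_int k2 - 1/2) / r\<bar> > 2"
        using centred_alternatives[of "fst z $ 1" k1] centred_alternatives[of "fst z $ 2" k2] that big
        unfolding U_def by blast+
      have z: "P y = 0" if "\<bar>y $ 2\<bar> > 2 \<or> \<bar>y $ 3\<bar> > 2" for y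
        using P that by (auto simp: profile_def)
      show ?thesis
      proof (cases "centred (fst z $ 1) = fst z $ 1 - of_int k1 - 1/2 \<and>
          centred (fst z $ 2) = fst z $ 2 - of_int k2 - 1/2")
        case True
        then show ?thesis by (simp add: lift_def A_def coord_def)
      next
        case False
        have "P (A z) = 0"
          by (rule z) (use a False in \<open>auto simp: A_def\<close>)
        moreover have "P (coord (snd z) (fst z)) = 0"
          by (rule z) (use a False in \<open>auto simp: coord_def\<close>)
        ultimately show ?thesis by (simp add: lift_def)
      qed
    qed
  qed
qed

lemma lift_space_derivative:
  assumes P: "profile P"
  shows "(lift P t has_derivative (\<lambda>h. h $ 1 / r * lift (partial 2 P) t x + h $ 2 / r * lift (partial 3 P) t x)) (at x)"
proof -
  have "((\<lambda>x. (x, t)) has_derivative (\<lambda>h. (h, 0))) (at x)"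
    by (intro has_derivative_Pair has_derivative_ident has_derivative_const)
  from has_derivative_compose[OF this lift_has_derivative[OF P]] show ?thesis by simp
qed

lemma lift_time_derivative:
  assumes P: "profile P"
  shows "((\<lambda>t. lift P t x) has_real_derivative 2 * lam * t * lift (partial 1 P) t x) (at t)"
proof -
  have "((\<lambda>t. (x, t)) has_derivative (\<lambda>h. (0, h))) (at t)"
    by (intro has_derivative_Pair has_derivative_ident has_derivative_const)
  from has_derivative_compose[OF this lift_has_derivative[OF P]]
  have "((\<lambda>t. lift P t x) has_derivative (\<lambda>h. 2 * lam * t * h * lift (partial 1 P) t x)) (at t)" by simp
  also have "(\<lambda>h. 2 * lam * t * h * lift (partial 1 P) t x) = (*) (2 * lam * t * lift (partial 1 P) t x)"
    by (simp add: fun_eq_iff)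
  finally show ?thesis by (simp only: has_field_derivative_def)
qed

text \<open>Derivatives of lifts are combinations of lifts of the partial derivatives, which are
  again profiles; hence the induction over all profiles simultaneously.\<close>

lemma smooth_lift:
  assumes "profile P"
  shows "smooth_on S (\<lambda>z. lift P (snd z) (fst z))"
proof -
  have "Ck_on k UNIV (\<lambda>z. lift P (snd z) (fst z))" for k
    using assms
  proof (induction k arbitrary: P)
    case 0
    have "isCont (\<lambda>z. lift P (snd z) (fst z)) z" for z
      using has_derivative_continuous[OF lift_has_derivative[OF 0, of "snd z" "fst z"]] by simp
    then show ?case by (simp add: continuous_on_eq_continuous_at)
  next
    case (Suc k)
    have "Ck_on k UNIV (\<lambda>z. 2 * lam * snd z * snd h * lift (partial 1 P) (snd z) (fst z)
        + fst h $ 1 / r * lift (partial 2 P) (snd z) (fst z) + fst h $ 2 / r * lift (partial 3 P) (snd z) (fst z))"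
      for h :: "(real^3) \<times> real"
      by (intro Ck_on_add Ck_on_bilinear[OF bounded_bilinear_mult] Ck_on_const Suc.IH profile_partial
          Suc.prems Ck_on_bounded_linear bounded_linear_snd)
    with lift_has_derivative[OF Suc.prems] show ?case
      by (auto intro!: exI[of _ "\<lambda>z h. 2 * lam * snd z * snd h * lift (partial 1 P) (snd z) (fst z)
        + fst h $ 1 / r * lift (partial 2 P) (snd z) (fst z) + fst h $ 2 / r * lift (partial 3 P) (snd z) (fst z)"])
  qed
  then have "smooth_on UNIV (\<lambda>z. lift P (snd z) (fst z))" by (simp add: smooth_on_def)
  then show ?thesis by (rule smooth_on_subset) simp
qed

lemma smooth_lift_space:
  assumes "profile P"
  shows "smooth_on UNIV (lift P t)"
proof -
  from smooth_on_compose[OF smooth_lift[OF assms, of UNIV] smooth_on_pair_const] show ?thesis by simp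
qed

lemma periodic_lift: "periodic (lift P t)"
  unfolding periodic_def by (simp add: lift_def coord_def centred_add_Ints)

section \<open>Lifted profiles times a vertical oscillation\<close>

definition wave :: "(real^3 \<Rightarrow> real) \<Rightarrow> (real \<Rightarrow> real) \<Rightarrow> real \<Rightarrow> real^3 \<Rightarrow> real" where
  "wave P T t x = lift P t x * T (n * x $ 3)"

lemma wave_space_derivative:
  assumes P: "profile P" and T: "\<And>s. (T has_real_derivative T' s) (at s)"
  shows "(wave P T t has_derivative (\<lambda>h. h $ 1 / r * wave (partial 2 P) T t x
    + h $ 2 / r * wave (partial 3 P) T t x + h $ 3 * n * wave P T' t x)) (at x)"
proof -
  have "((\<lambda>x::real^3. n * x $ 3) has_derivative (\<lambda>h. n * h $ 3)) (at x)"
    by (intro has_derivative_mult_right bounded_linear.has_derivative[OF bounded_linear_vec_nth]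
        has_derivative_ident)
  moreover have "(T has_derivative (*) (T' (n * x $ 3))) (at (n * x $ 3))"
    using T by (simp add: has_field_derivative_def)
  ultimately have "((\<lambda>x. T (n * x $ 3)) has_derivative (\<lambda>h. T' (n * x $ 3) * (n * h $ 3))) (at x)"
    by (rule has_derivative_compose)
  from has_derivative_mult[OF lift_space_derivative[OF P] this, of t]
  have "(wave P T t has_derivative (\<lambda>h. lift P t x * (T' (n * x $ 3) * (n * h $ 3)) +
      (h $ 1 / r * lift (partial 2 P) t x + h $ 2 / r * lift (partial 3 P) t x) * T (n * x $ 3))) (at x)"
    by (simp add: wave_def[abs_def])
  also have "(\<lambda>h::real^3. lift P t x * (T' (n * x $ 3) * (n * h $ 3)) +
      (h $ 1 / r * lift (partial 2 P) t x + h $ 2 / r * lift (partial 3 P) t x) * T (n * x $ 3)) =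
    (\<lambda>h. h $ 1 / r * wave (partial 2 P) T t x
    + h $ 2 / r * wave (partial 3 P) T t x + h $ 3 * n * wave P T' t x)"
    by (simp add: wave_def algebra_simps)
  finally show ?thesis .
qed

lemma partial_wave:
  assumes "profile P" "\<And>s. (T has_real_derivative T' s) (at s)"
  shows "partial 1 (wave P T t) = (\<lambda>x. wave (partial 2 P) T t x / r)"
    "partial 2 (wave P T t) = (\<lambda>x. wave (partial 3 P) T t x / r)"
    "partial 3 (wave P T t) = (\<lambda>x. n * wave P T' t x)"
  using has_derivative_imp_partial[OF wave_space_derivative[OF assms]]
  by (auto simp: fun_eq_iff axis_def)

lemma smooth_wave:
  assumes P: "profile P" and T: "smooth_on UNIV T"
  shows "smooth_on S (\<lambda>z. wave P T (snd z) (fst z))" "smooth_on UNIV (wave P T t)"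
proof -
  have "smooth_on S (\<lambda>z::(real^3) \<times> real. T (n * fst z $ 3))"
    by (rule smooth_on_compose[OF T]) (auto intro!: smooth)
  then show "smooth_on S (\<lambda>z. wave P T (snd z) (fst z))"
    unfolding wave_def by (intro smooth_on_mult smooth_lift P)
  have "smooth_on UNIV (\<lambda>x::real^3. T (n * x $ 3))"
    by (rule smooth_on_compose[OF T]) (auto intro!: smooth)
  then have "smooth_on UNIV (\<lambda>x. lift P t x * T (n * x $ 3))"
    by (intro smooth_on_mult smooth_lift_space[OF P])
  then show "smooth_on UNIV (wave P T t)" by (simp add: wave_def[abs_def])
qed

lemma periodic_wave:
  assumes "\<And>s (k::int). T (s + 2 * pi * of_int k) = T s"
  shows "periodic (wave P T t)"
  unfolding periodic_def
proof (intro allI impI)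
  fix x k :: "real^3" assume k: "\<forall>i. k $ i \<in> \<int>"
  then obtain l where l: "k $ 3 = of_int l" by (metis Ints_cases)
  have "n * (x + k) $ 3 = n * x $ 3 + 2 * pi * of_int (int N * l)"
    by (simp add: n_def l algebra_simps)
  then have "T (n * (x + k) $ 3) = T (n * x $ 3)" using assms by metis
  then show "wave P T t (x + k) = wave P T t x"
    using periodic_lift[of P t] k by (simp add: wave_def periodic_def)
qed

end

section \<open>The explicit solution\<close>

lemma partial_lincomb:
  fixes f g :: "real^3 \<Rightarrow> real"
  assumes "smooth_on UNIV f" "smooth_on UNIV g"
  shows "partial j (\<lambda>x. a * f x + c * g x) = (\<lambda>x. a * partial j f x + c * partial j g x)"
  using assms by (simp add: fun_eq_iff partial_add partial_cmult smooth)

lemma partial_cmult_fun: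
  fixes f :: "real^3 \<Rightarrow> real"
  assumes "smooth_on UNIV f"
  shows "partial j (\<lambda>x. c * f x) = (\<lambda>x. c * partial j f x)"
  using assms by (simp add: fun_eq_iff partial_cmult)

text \<open>Kept apart from \<open>cell\<close> so that the finite set \<open>profiles\<close>, and
  with it the constant \<open>B\<close>, cannot depend on \<open>lam\<close>, \<open>r\<close> or
  \<open>N\<close>.\<close>

locale flow_profiles =
  fixes V1 V2 A1 A2 :: "real^3 \<Rightarrow> real"
  assumes V: "profile V1" "profile V2" and A: "profile A1" "profile A2"
begin

definition divA :: "real^3 \<Rightarrow> real" where
  "divA y = partial 2 A1 y + partial 3 A2 y"

definition hlap :: "(real^3 \<Rightarrow> real) \<Rightarrow> real^3 \<Rightarrow> real" where
  "hlap P y = partial 2 (partial 2 P) y + partial 3 (partial 3 P) y"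

text \<open>The derivative along particle paths, with the angle as time.\<close>

definition material :: "(real^3 \<Rightarrow> real) \<Rightarrow> real^3 \<Rightarrow> real" where
  "material P y = partial 1 P y + (V1 y * partial 2 P y + V2 y * partial 3 P y)"

text \<open>The one second harmonic that survives in the self-interaction of the wave. It sits in
  the vertical component, where it carries a factor 1 / n.\<close>

definition second_harmonic :: "real^3 \<Rightarrow> real" where
  "second_harmonic y = divA y * divA y - (A1 y * partial 2 divA y + A2 y * partial 3 divA y)"

lemma profile_hlap: "profile P \<Longrightarrow> profile (hlap P)"
  unfolding hlap_def by (intro profile_add profile_partial)

lemma profile_material: "profile P \<Longrightarrow> profile (material P)"
  unfolding material_def by (intro profile_add profile_mult profile_partial V)

lemma profile_divA: "profile divA"
  unfolding divA_def by (intro profile_add profile_partial A)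

lemma profile_second_harmonic: "profile second_harmonic"
  unfolding second_harmonic_def by (intro profile_add profile_diff profile_mult profile_partial A profile_divA)

text \<open>Exactly the profiles that occur in the terms of \<open>fh\<close> and \<open>f3\<close>,
  for both horizontal components.\<close>

definition profiles :: "(real^3 \<Rightarrow> real) set" where
  "profiles = {V1, V2, material V1, material V2, hlap V1, hlap V2, A1, A2, hlap A1, hlap A2,
    \<lambda>y. divA y * A1 y, \<lambda>y. divA y * A2 y, divA, material divA, hlap divA, second_harmonic}"

lemma profile_profiles: "P \<in> profiles \<Longrightarrow> profile P"
  unfolding profiles_def
  by (auto intro: V A profile_material profile_hlap profile_divA profile_second_harmonic profile_mult)

lemma finite_profiles: "finite profiles"
  by (simp add: profiles_def)

end

text \<open>
  \<open>A1, A2\<close> are the components of an envelope times a unit vector that depends on the angle only.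
  By \<open>stretch1, stretch2\<close>, the flow transports the envelope and amplifies the unit vector at rate 1
  per unit of angle. As this vector is constant in space, \<open>self1, self2\<close> hold, which
  cancels the second harmonic in the horizontal self-interaction of the wave.
\<close>

locale flow = cell + flow_profiles +
  assumes stretch1: "partial 1 A1 y + V1 y * partial 2 A1 y + V2 y * partial 3 A1 y
      + A1 y * partial 2 V1 y + A2 y * partial 3 V1 y = - A1 y"
    and stretch2: "partial 1 A2 y + V1 y * partial 2 A2 y + V2 y * partial 3 A2 y
      + A1 y * partial 2 V2 y + A2 y * partial 3 V2 y = - A2 y"
    and self1: "A1 y * partial 2 A1 y + A2 y * partial 3 A1 y = divA y * A1 y"
    and self2: "A1 y * partial 2 A2 y + A2 y * partial 3 A2 y = divA y * A2 y"
    and divV: "partial 2 V1 y + partial 3 V2 y = 0"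
begin

abbreviation one :: "real \<Rightarrow> real" where "one \<equiv> \<lambda>_. 1"
abbreviation sc :: "real \<Rightarrow> real" where "sc \<equiv> \<lambda>s. sin s * cos s"

text \<open>With \<open>nu * n\<^sup>2 = 1\<close>, viscosity damps the vertical oscillation at unit
  rate; this is the \<open>- t\<close> in the exponent of \<open>amp\<close>.\<close>

definition nu :: real where "nu = 1 / n\<^sup>2"
definition seed :: real where "seed = r\<^sup>2 / n"
text \<open>The wave must be born from 0. Subtracting the initial value of the exponential gives
  amp' = (rate - 1) (amp + seed), so the force only has to supply
  \<open>seed * (rate t - 1)\<close>. As \<open>seed * n = r\<^sup>2\<close>, that source has a
  small vertical derivative, and growth by \<open>exp lam\<close> makes \<open>amp\<close>
  comparable to \<open>r\<^sup>2\<close>.\<close>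

definition amp :: "real \<Rightarrow> real" where "amp t = seed * (exp (lam * t\<^sup>2 - t) - 1)"
definition rate :: "real \<Rightarrow> real" where "rate t = 2 * lam * t"

text \<open>The prefactor \<open>rate t * r\<close> makes the derivative along the large scale flow
  of a lifted profile equal to \<open>rate t\<close> times the lift of its \<open>material\<close>
  derivative.\<close>

definition uh :: "(real^3 \<Rightarrow> real) \<Rightarrow> (real^3 \<Rightarrow> real) \<Rightarrow> real \<Rightarrow> real^3 \<Rightarrow> real" where
  "uh P Q t x = (rate t * r) * wave P one t x + amp t * wave Q cos t x"

text \<open>Forced by incompressibility: integrating the horizontal divergence of the wave in
  \<open>x $ 3\<close> gains 1 / n.\<close>

definition u3 :: "real \<Rightarrow> real^3 \<Rightarrow> real" where
  "u3 t x = (- (amp t / (n * r))) * wave divA sin t x"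

text \<open>The terms are, in order: spin-up of the large scale flow, its acceleration along paths,
  its viscosity, the birth of the wave, the horizontal viscosity of the wave, and the mean part of
  its self-interaction.\<close>

definition fh :: "(real^3 \<Rightarrow> real) \<Rightarrow> (real^3 \<Rightarrow> real) \<Rightarrow> real \<Rightarrow> real^3 \<Rightarrow> real" where
  "fh P Q t x = (2 * lam * r) * wave P one t x + ((rate t)\<^sup>2 * r) * wave (material P) one t x
    + (- (nu * rate t / r)) * wave (hlap P) one t x + (seed * (rate t - 1)) * wave Q cos t x
    + (- (nu * amp t / r\<^sup>2)) * wave (hlap Q) cos t x + ((amp t)\<^sup>2 / r) * wave (\<lambda>y. divA y * Q y) one t x"

text \<open>Every coefficient carries 1 / n, which pays for the vertical derivative in the
  norm.\<close>

definition f3 :: "real \<Rightarrow> real^3 \<Rightarrow> real" where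
  "f3 t x = (- ((rate t * (amp t + seed) - seed) / (n * r))) * wave divA sin t x
    + (- (amp t * rate t / (n * r))) * wave (material divA) sin t x
    + (nu * amp t / (n * r ^ 3)) * wave (hlap divA) sin t x
    + ((amp t)\<^sup>2 / (n * r\<^sup>2)) * wave second_harmonic sc t x"

definition u :: "real \<Rightarrow> real^3 \<Rightarrow> real^3" where
  "u t x = vector [uh V1 A1 t x, uh V2 A2 t x, u3 t x]"

definition f :: "real \<Rightarrow> real^3 \<Rightarrow> real^3" where
  "f t x = vector [fh V1 A1 t x, fh V2 A2 t x, f3 t x]"

lemma n_pos: "n > 0" using N by (simp add: n_def)

lemma smooth_one: "smooth_on UNIV one" by (rule smooth_on_const)
lemma smooth_sc: "smooth_on UNIV sc" by (intro smooth)
lemmas smooth_waveforms = smooth_one smooth_sc smooth_on_sin_cos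

lemma smooth_time: "smooth_on S (\<lambda>z. rate (snd z))" "smooth_on S (\<lambda>z. amp (snd z))"
  unfolding rate_def amp_def by (intro smooth)+

lemma smooth_uh: "profile P \<Longrightarrow> profile Q \<Longrightarrow> smooth_on S (\<lambda>z. uh P Q (snd z) (fst z))"
  unfolding uh_def by (intro smooth smooth_time smooth_wave smooth_waveforms)

lemma smooth_u3: "smooth_on S (\<lambda>z. u3 (snd z) (fst z))"
  unfolding u3_def by (intro smooth smooth_time smooth_wave profile_divA smooth_waveforms)

lemma smooth_fh: "profile P \<Longrightarrow> profile Q \<Longrightarrow> smooth_on S (\<lambda>z. fh P Q (snd z) (fst z))"
  unfolding fh_def
  by (intro smooth smooth_time smooth_wave profile_material profile_hlap profile_mult profile_divA smooth_waveforms)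

lemma smooth_f3: "smooth_on S (\<lambda>z. f3 (snd z) (fst z))"
  unfolding f3_def
  by (intro smooth smooth_time smooth_wave profile_material profile_hlap profile_mult profile_divA profile_second_harmonic smooth_waveforms)

lemma periodic_waves: "periodic (wave P one t)" "periodic (wave P sin t)" "periodic (wave P cos t)"
  "periodic (wave P sc t)"
  by (intro periodic_wave; simp add: angle_shift)+

lemma smooth_torus_time_u: "smooth_torus_time u"
  unfolding smooth_torus_time_def
proof
  show "\<forall>t\<in>{0..1}. periodic (u t)"
    using periodic_waves by (simp add: periodic_def u_def uh_def u3_def)
  have "smooth_on (UNIV \<times> {0..1}) (\<lambda>z. u (snd z) (fst z))"
    unfolding u_def by (intro smooth smooth_uh smooth_u3 V A)
  then show "smooth_on (UNIV \<times> {0..1}) (\<lambda>(x, t). u t x)" by (simp only: case_prod_unfold)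
qed

lemma smooth_torus_time_f: "smooth_torus_time f"
  unfolding smooth_torus_time_def
proof
  show "\<forall>t\<in>{0..1}. periodic (f t)"
    using periodic_waves by (simp add: periodic_def f_def fh_def f3_def)
  have "smooth_on (UNIV \<times> {0..1}) (\<lambda>z. f (snd z) (fst z))"
    unfolding f_def by (intro smooth smooth_fh smooth_f3 V A)
  then show "smooth_on (UNIV \<times> {0..1}) (\<lambda>(x, t). f t x)" by (simp only: case_prod_unfold)
qed

lemma partial_wave_one:
  assumes "profile P"
  shows "partial 1 (wave P one t) = (\<lambda>x. 1 / r * wave (partial 2 P) one t x)"
    "partial 2 (wave P one t) = (\<lambda>x. 1 / r * wave (partial 3 P) one t x)"
    "partial 3 (wave P one t) = (\<lambda>x. 0)"
  using partial_wave[OF assms, of one "\<lambda>_. 0" t] by (auto simp: wave_def)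

lemma partial_wave_cos:
  assumes "profile P"
  shows "partial 1 (wave P cos t) = (\<lambda>x. 1 / r * wave (partial 2 P) cos t x)"
    "partial 2 (wave P cos t) = (\<lambda>x. 1 / r * wave (partial 3 P) cos t x)"
    "partial 3 (wave P cos t) = (\<lambda>x. - n * wave P sin t x)"
  using partial_wave[OF assms, of cos "\<lambda>s. - sin s" t] by (auto simp: wave_def)

lemma partial_wave_sin:
  assumes "profile P"
  shows "partial 1 (wave P sin t) = (\<lambda>x. 1 / r * wave (partial 2 P) sin t x)"
    "partial 2 (wave P sin t) = (\<lambda>x. 1 / r * wave (partial 3 P) sin t x)"
    "partial 3 (wave P sin t) = (\<lambda>x. n * wave P cos t x)"
  using partial_wave[OF assms, of sin cos t] by (auto simp: wave_def)

lemma partial_uh: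
  assumes P: "profile P" "profile Q"
  shows "partial 1 (uh P Q t) = (\<lambda>x. rate t * wave (partial 2 P) one t x + amp t / r * wave (partial 2 Q) cos t x)"
    "partial 2 (uh P Q t) = (\<lambda>x. rate t * wave (partial 3 P) one t x + amp t / r * wave (partial 3 Q) cos t x)"
    "partial 3 (uh P Q t) = (\<lambda>x. (- (n * amp t)) * wave Q sin t x)"
  unfolding uh_def[abs_def] using r
  by (simp_all only: partial_lincomb smooth_wave smooth_waveforms P partial_wave_one partial_wave_cos)
     (simp_all add: fun_eq_iff)

lemma partial2_uh:
  assumes P: "profile P" "profile Q"
  shows "partial 1 (partial 1 (uh P Q t)) x
      = rate t / r * wave (partial 2 (partial 2 P)) one t x + amp t / r\<^sup>2 * wave (partial 2 (partial 2 Q)) cos t x"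
    "partial 2 (partial 2 (uh P Q t)) x
      = rate t / r * wave (partial 3 (partial 3 P)) one t x + amp t / r\<^sup>2 * wave (partial 3 (partial 3 Q)) cos t x"
    "partial 3 (partial 3 (uh P Q t)) x = - (n\<^sup>2 * amp t) * wave Q cos t x"
  unfolding partial_uh[OF P]
  by (simp_all only: partial_lincomb partial_cmult_fun smooth_wave smooth_waveforms P profile_partial partial_wave_one
      partial_wave_cos partial_wave_sin)
     (simp_all add: power2_eq_square)

lemma partial_u3:
  shows "partial 1 (u3 t) = (\<lambda>x. (- (amp t / (n * r\<^sup>2))) * wave (partial 2 divA) sin t x)"
    "partial 2 (u3 t) = (\<lambda>x. (- (amp t / (n * r\<^sup>2))) * wave (partial 3 divA) sin t x)"
    "partial 3 (u3 t) = (\<lambda>x. (- (amp t / r)) * wave divA cos t x)"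
  unfolding u3_def[abs_def] using n_pos
  by (simp_all only: partial_cmult_fun smooth_wave smooth_waveforms profile_divA partial_wave_sin)
     (simp_all add: power2_eq_square mult.assoc)

lemma partial2_u3:
  shows "partial 1 (partial 1 (u3 t)) x = - (amp t / (n * r ^ 3)) * wave (partial 2 (partial 2 divA)) sin t x"
    "partial 2 (partial 2 (u3 t)) x = - (amp t / (n * r ^ 3)) * wave (partial 3 (partial 3 divA)) sin t x"
    "partial 3 (partial 3 (u3 t)) x = (amp t * n / r) * wave divA sin t x"
  unfolding partial_u3
  by (simp_all only: partial_cmult_fun smooth_wave smooth_waveforms profile_divA profile_partial partial_wave_sin partial_wave_cos)
     (simp_all add: power2_eq_square power3_eq_cube)

lemma smooth_space: "profile P \<Longrightarrow> profile Q \<Longrightarrow> smooth_on UNIV (uh P Q t)" "smooth_on UNIV (u3 t)"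
  unfolding uh_def[abs_def] u3_def[abs_def]
  by (intro smooth smooth_wave profile_divA smooth_waveforms; assumption)+

lemma partial_u: "partial j (u t) = (\<lambda>x. vector [partial j (uh V1 A1 t) x, partial j (uh V2 A2 t) x, partial j (u3 t) x])"
  unfolding u_def[abs_def] by (rule ext) (intro partial_vector3 smooth_space V A)

lemma partial2_u: "partial j (partial j (u t)) x = vector [partial j (partial j (uh V1 A1 t)) x,
    partial j (partial j (uh V2 A2 t)) x, partial j (partial j (u3 t)) x]"
  unfolding partial_u by (intro partial_vector3 smooth_on_partial smooth_space V A)

lemma wave_time_derivative:
  assumes "profile P"
  shows "((\<lambda>t. wave P T t x) has_real_derivative rate t * wave (partial 1 P) T t x) (at t)"
  unfolding wave_def rate_def
  using lift_time_derivative[OF assms] by (auto intro!: derivative_eq_intros)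

lemma amp_derivative: "(amp has_real_derivative (rate t - 1) * (amp t + seed)) (at t)"
  unfolding amp_def[abs_def] rate_def
  by (auto intro!: derivative_eq_intros simp: algebra_simps)

lemma uh_time_derivative:
  assumes P: "profile P" "profile Q"
  shows "((\<lambda>t. uh P Q t x) has_real_derivative 2 * lam * r * wave P one t x
      + (rate t)\<^sup>2 * r * wave (partial 1 P) one t x + (rate t - 1) * (amp t + seed) * wave Q cos t x
      + amp t * rate t * wave (partial 1 Q) cos t x) (at t)"
  unfolding uh_def rate_def[of t for t]
  by (auto intro!: derivative_eq_intros amp_derivative wave_time_derivative P
      simp: rate_def power2_eq_square algebra_simps)

lemma u3_time_derivative:
  "((\<lambda>t. u3 t x) has_real_derivative - ((rate t - 1) * (amp t + seed) / (n * r)) * wave divA sin t x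
      - amp t * rate t / (n * r) * wave (partial 1 divA) sin t x) (at t)"
  unfolding u3_def using r n_pos
  by (auto intro!: derivative_eq_intros amp_derivative wave_time_derivative profile_divA
      simp: field_simps)

lemma u_time_derivative:
  assumes "t \<in> {0..1}"
  shows "vector_derivative (\<lambda>s. u s x) (at t within {0..1}) = vector [
      2 * lam * r * wave V1 one t x
      + (rate t)\<^sup>2 * r * wave (partial 1 V1) one t x + (rate t - 1) * (amp t + seed) * wave A1 cos t x
      + amp t * rate t * wave (partial 1 A1) cos t x,
      2 * lam * r * wave V2 one t x
      + (rate t)\<^sup>2 * r * wave (partial 1 V2) one t x + (rate t - 1) * (amp t + seed) * wave A2 cos t x
      + amp t * rate t * wave (partial 1 A2) cos t x,
      - ((rate t - 1) * (amp t + seed) / (n * r)) * wave divA sin t x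
      - amp t * rate t / (n * r) * wave (partial 1 divA) sin t x]" (is "_ = vector [?a, ?divA, ?c]")
proof -
  have "((\<lambda>s. u s x) has_derivative (\<lambda>h. vector [?a * h, ?divA * h, ?c * h])) (at t)"
    unfolding u_def
    by (intro has_derivative_vector3 has_field_derivative_imp_has_derivative
        uh_time_derivative u3_time_derivative V A)
  also have "(\<lambda>h. vector [?a * h, ?divA * h, ?c * h] :: real^3) = (\<lambda>h. h *\<^sub>R vector [?a, ?divA, ?c])"
    by (simp add: fun_eq_iff vec_eq_iff forall_3)
  finally have "((\<lambda>s. u s x) has_vector_derivative vector [?a, ?divA, ?c]) (at t)"
    by (simp only: has_vector_derivative_def)
  then have "((\<lambda>s. u s x) has_vector_derivative vector [?a, ?divA, ?c]) (at t within {0..1})"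
    by (rule has_vector_derivative_at_within)
  from time_deriv_eq[where w = u and x = x, OF this assms] show ?thesis by (simp only: time_deriv_def)
qed

lemma horizontal_identity:
  fixes p1 :: real
  assumes stretch: "p1 + v1 * p2 + v2 * p3 + a1 * q2 + a2 * q3 = - a"
    and self: "a1 * p2 + a2 * p3 = bb * a" and cs: "C\<^sup>2 + S\<^sup>2 = 1" and rp: "(r::real) \<noteq> 0" and np: "(n::real) \<noteq> 0"
  shows "(L * q + s\<^sup>2 * r * q1 + (s - 1) * (g + B0) * (a * C) + g * s * (p1 * C))
      + ((s * r * v1 + g * (a1 * C)) * (s * q2 + g / r * (p2 * C))
        + (s * r * v2 + g * (a2 * C)) * (s * q3 + g / r * (p3 * C))
        + (- (g / (n * r)) * (bb * S)) * (- (n * g) * (a * S)))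
    = 1 / n\<^sup>2 * ((s / r * q22 + g / r\<^sup>2 * (p22 * C)) + (s / r * q33 + g / r\<^sup>2 * (p33 * C)) + (- (n\<^sup>2 * g) * (a * C)))
      + (L * q + s\<^sup>2 * r * (q1 + (v1 * q2 + v2 * q3)) + (- (1 / n\<^sup>2 * s / r)) * (q22 + q33)
        + B0 * (s - 1) * (a * C) + (- (1 / n\<^sup>2 * g / r\<^sup>2)) * ((p22 + p33) * C) + g\<^sup>2 / r * (bb * a))"
proof -
  have p1: "p1 = - a - (v1 * p2 + v2 * p3 + a1 * q2 + a2 * q3)" using stretch by simp
  have adv: "(s * r * v1 + g * (a1 * C)) * (s * q2 + g / r * (p2 * C))
        + (s * r * v2 + g * (a2 * C)) * (s * q3 + g / r * (p3 * C))
        + (- (g / (n * r)) * (bb * S)) * (- (n * g) * (a * S))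
      = s\<^sup>2 * r * (v1 * q2 + v2 * q3) + s * g * C * (v1 * p2 + v2 * p3 + a1 * q2 + a2 * q3)
        + g\<^sup>2 / r * C\<^sup>2 * (a1 * p2 + a2 * p3) + g\<^sup>2 / r * S\<^sup>2 * (bb * a)"
    using rp np by (simp add: field_simps power2_eq_square)
  have "g\<^sup>2 / r * C\<^sup>2 * (bb * a) + g\<^sup>2 / r * S\<^sup>2 * (bb * a) = g\<^sup>2 / r * (bb * a) * (C\<^sup>2 + S\<^sup>2)"
    by (simp add: algebra_simps add_divide_distrib)
  then have cs': "g\<^sup>2 / r * C\<^sup>2 * (bb * a) + g\<^sup>2 / r * S\<^sup>2 * (bb * a) = g\<^sup>2 / r * (bb * a)"
    by (simp add: cs)
  have hlap: "1 / n\<^sup>2 * ((s / r * q22 + g / r\<^sup>2 * (p22 * C)) + (s / r * q33 + g / r\<^sup>2 * (p33 * C)) + (- (n\<^sup>2 * g) * (a * C)))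
      = 1 / n\<^sup>2 * s / r * (q22 + q33) + 1 / n\<^sup>2 * g / r\<^sup>2 * ((p22 + p33) * C) - g * a * C"
    using rp np by (simp add: field_simps power2_eq_square)
  show ?thesis
    unfolding adv hlap self p1 using cs' by (simp add: algebra_simps)
qed

lemma vertical_identity:
  assumes rp: "(r::real) \<noteq> 0" and np: "(n::real) \<noteq> 0"
  shows "(- ((s - 1) * (g + B0) / (n * r)) * (bb * S) - g * s / (n * r) * (b1 * S))
      + ((s * r * v1 + g * (a1 * C)) * (- (g / (n * r\<^sup>2)) * (b2 * S))
        + (s * r * v2 + g * (a2 * C)) * (- (g / (n * r\<^sup>2)) * (b3 * S))
        + (- (g / (n * r)) * (bb * S)) * (- (g / r) * (bb * C)))
    = 1 / n\<^sup>2 * (- (g / (n * r ^ 3)) * (b22 * S) + - (g / (n * r ^ 3)) * (b33 * S) + g * n / r * (bb * S))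
      + (- ((s * (g + B0) - B0) / (n * r)) * (bb * S) + - (g * s / (n * r)) * ((b1 + (v1 * b2 + v2 * b3)) * S)
        + 1 / n\<^sup>2 * g / (n * r ^ 3) * ((b22 + b33) * S)
        + g\<^sup>2 / (n * r\<^sup>2) * ((bb * bb - (a1 * b2 + a2 * b3)) * (S * C)))"
proof -
  have adv: "(s * r * v1 + g * (a1 * C)) * (- (g / (n * r\<^sup>2)) * (b2 * S))
        + (s * r * v2 + g * (a2 * C)) * (- (g / (n * r\<^sup>2)) * (b3 * S))
        + (- (g / (n * r)) * (bb * S)) * (- (g / r) * (bb * C))
      = - (g * s / (n * r)) * ((v1 * b2 + v2 * b3) * S)
        + g\<^sup>2 / (n * r\<^sup>2) * ((bb * bb - (a1 * b2 + a2 * b3)) * (S * C))"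
    using rp np by (simp add: field_simps power2_eq_square)
  have hlap: "1 / n\<^sup>2 * (- (g / (n * r ^ 3)) * (b22 * S) + - (g / (n * r ^ 3)) * (b33 * S) + g * n / r * (bb * S))
      = - (1 / n\<^sup>2 * g / (n * r ^ 3) * ((b22 + b33) * S)) + g / (n * r) * (bb * S)"
    using rp np by (simp add: field_simps power2_eq_square)
  have g: "- ((s - 1) * (g + B0) / (n * r)) = g / (n * r) - (s * (g + B0) - B0) / (n * r)"
    using rp np by (simp add: field_simps)
  show ?thesis
    unfolding adv hlap g by (simp add: algebra_simps)
qed

lemma NS_solution_u: "NS_solution nu f (\<lambda>_. 0) u (\<lambda>_ _. 0)"
  unfolding NS_solution_def
proof (intro conjI ballI allI)
  show "smooth_torus_time u" by (rule smooth_torus_time_u)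
  show "smooth_torus_time (\<lambda>_ _. 0::real)"
    by (simp add: smooth_torus_time_def periodic_def case_prod_unfold smooth_on_const)
  show "u 0 x = 0" for x
    by (simp add: u_def uh_def u3_def rate_def amp_def vec_eq_iff forall_3)
  fix t :: real and x assume t: "t \<in> {0..1}"
  have g0: "gradient (\<lambda>_. 0) x = 0" by (simp add: gradient_def partial_const vec_eq_iff)
  have rn: "r \<noteq> 0" "n \<noteq> 0" using r n_pos by auto
  have cs: "(cos (n * x $ 3))\<^sup>2 + (sin (n * x $ 3))\<^sup>2 = 1" by simp
  show "divergence (u t) x = 0"
    using divV[of "coord t x", folded eq_neg_iff_add_eq_0] rn
    by (simp add: divergence_def sum_3 partial_u partial_uh partial_u3 V A wave_def lift_def divA_def field_simps)
  note h1 = horizontal_identity[OF stretch1[of "coord t x"] self1[of "coord t x"] cs rn,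
      where L = "2 * lam * r" and q = "V1 (coord t x)" and s = "rate t" and ?q1.0 = "partial 1 V1 (coord t x)"
        and g = "amp t" and ?B0.0 = seed and ?q22.0 = "partial 2 (partial 2 V1) (coord t x)"
        and ?p22.0 = "partial 2 (partial 2 A1) (coord t x)"
        and ?q33.0 = "partial 3 (partial 3 V1) (coord t x)"
        and ?p33.0 = "partial 3 (partial 3 A1) (coord t x)"]
  note h2 = horizontal_identity[OF stretch2[of "coord t x"] self2[of "coord t x"] cs rn,
      where L = "2 * lam * r" and q = "V2 (coord t x)" and s = "rate t" and ?q1.0 = "partial 1 V2 (coord t x)"
        and g = "amp t" and ?B0.0 = seed and ?q22.0 = "partial 2 (partial 2 V2) (coord t x)"
        and ?p22.0 = "partial 2 (partial 2 A2) (coord t x)"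
        and ?q33.0 = "partial 3 (partial 3 V2) (coord t x)"
        and ?p33.0 = "partial 3 (partial 3 A2) (coord t x)"]
  note h3 = vertical_identity[OF rn,
      where s = "rate t" and g = "amp t" and ?B0.0 = seed and bb = "divA (coord t x)" and S = "sin (n * x $ 3)"
        and ?b1.0 = "partial 1 divA (coord t x)" and ?v1.0 = "V1 (coord t x)" and ?a1.0 = "A1 (coord t x)"
        and C = "cos (n * x $ 3)" and ?b2.0 = "partial 2 divA (coord t x)" and ?v2.0 = "V2 (coord t x)"
        and ?a2.0 = "A2 (coord t x)" and ?b3.0 = "partial 3 divA (coord t x)"
        and ?b22.0 = "partial 2 (partial 2 divA) (coord t x)"
        and ?b33.0 = "partial 3 (partial 3 divA) (coord t x)"]
  show "vector_derivative (\<lambda>s. u s x) (at t within {0..1}) + advection (u t) (u t) x + gradient (\<lambda>_. 0) x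
      = nu *\<^sub>R laplacian (u t) x + f t x"
    unfolding vec_eq_iff forall_3 g0 u_time_derivative[OF t] laplacian_def sum_3 partial2_u
      partial2_uh[OF V(1) A(1)] partial2_uh[OF V(2) A(2)] partial2_u3
    unfolding advection_def sum_3 partial_u
      partial_uh[OF V(1) A(1)] partial_uh[OF V(2) A(2)] partial_u3
      f_def u_def vector_add_component vector_scaleR_component vector_3 zero_index add_0_right
      real_scaleR_def fh_def f3_def uh_def u3_def
      wave_def lift_def material_def hlap_def second_harmonic_def nu_def mult_1_right
    using h1 h2 h3 by blast
qed

end

section \<open>Bounds on the force\<close>

context flow
begin

definition near :: "real^3 \<Rightarrow> real" where
  "near x = (if \<bar>centred (x $ 1)\<bar> \<le> 2 * r \<and> \<bar>centred (x $ 2)\<bar> \<le> 2 * r then 1 else 0)"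

definition near_bounded :: "real \<Rightarrow> (real^3 \<Rightarrow> real) \<Rightarrow> bool" where
  "near_bounded K h \<longleftrightarrow> smooth_on UNIV h \<and> (\<forall>x. \<bar>h x\<bar> \<le> K * near x \<and> (\<forall>j. \<bar>partial j h x\<bar> \<le> K * near x))"

lemma near_bounded_add: "near_bounded K h \<Longrightarrow> near_bounded L k \<Longrightarrow> near_bounded (K + L) (\<lambda>x. h x + k x)"
  unfolding near_bounded_def
  by (auto simp: partial_add smooth_on_add distrib_right intro!: abs_triangle_ineq[THEN order_trans] add_mono)

lemma near_nonneg: "near x \<ge> 0" by (simp add: near_def)

lemma near_bounded_mono: "near_bounded K h \<Longrightarrow> K \<le> L \<Longrightarrow> near_bounded L h"
  unfolding near_bounded_def by (meson mult_right_mono near_nonneg order_trans)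

lemma wave_bound:
  assumes P: "profile P" and B: "\<And>y. \<bar>P y\<bar> \<le> B" and T: "\<And>s. \<bar>T s\<bar> \<le> 1"
  shows "\<bar>wave P T t x\<bar> \<le> B * near x"
proof (cases "near x = 0")
  case True
  then have "2 * r < \<bar>centred (x $ 1)\<bar> \<or> 2 * r < \<bar>centred (x $ 2)\<bar>"
    by (auto simp: near_def split: if_splits)
  then have "\<bar>coord t x $ 2\<bar> > 2 \<or> \<bar>coord t x $ 3\<bar> > 2"
    using r by (auto simp: coord_def field_simps abs_divide)
  then have "wave P T t x = 0" using P by (auto simp: profile_def wave_def lift_def)
  then show ?thesis using True by simp
next
  case False
  then have "near x = 1" by (auto simp: near_def split: if_splits)
  moreover have "\<bar>wave P T t x\<bar> \<le> B * 1"
    unfolding wave_def lift_def abs_mult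
    by (intro mult_mono B T) (auto intro: order_trans[OF abs_ge_zero B])
  ultimately show ?thesis by simp
qed

lemma near_bounded_wave:
  assumes P: "profile P" and B: "\<And>y. \<bar>P y\<bar> \<le> B \<and> \<bar>partial 2 P y\<bar> \<le> B \<and> \<bar>partial 3 P y\<bar> \<le> B"
    and T: "smooth_on UNIV T" "\<And>s. (T has_real_derivative T' s) (at s)" "\<And>s. \<bar>T s\<bar> \<le> 1 \<and> \<bar>T' s\<bar> \<le> 1"
    and c: "\<bar>c\<bar> \<le> L" "\<bar>c\<bar> / r \<le> L"
    and cT: "(\<forall>s. T' s = 0) \<or> \<bar>c\<bar> * n \<le> L"
  shows "near_bounded (L * B) (\<lambda>x. c * wave P T t x)"
proof -
  have B0: "B \<ge> 0" using B[of 0] by linarith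
  have w: "\<bar>wave P T t x\<bar> \<le> B * near x" "\<bar>wave P T' t x\<bar> \<le> B * near x"
    "\<bar>wave (partial 2 P) T t x\<bar> \<le> B * near x" "\<bar>wave (partial 3 P) T t x\<bar> \<le> B * near x" for x
    using B T(3) by (auto intro!: wave_bound P profile_partial)
  have *: "\<bar>d * z\<bar> \<le> L * B * near x" if "\<bar>d\<bar> \<le> L" "\<bar>z\<bar> \<le> B * near x" for d z x
    using mult_mono[OF that] by (simp add: abs_mult mult.assoc order_trans[OF abs_ge_zero that(1)])
  have rp: "r > 0" using r by simp
  show ?thesis
    unfolding near_bounded_def
  proof (intro conjI allI)
    show "smooth_on UNIV (\<lambda>x. c * wave P T t x)" by (intro smooth smooth_wave P T)
    show "\<bar>c * wave P T t x\<bar> \<le> L * B * near x" for x by (intro * c w)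
    have pc: "partial j (\<lambda>x. c * wave P T t x) = (\<lambda>x. c * partial j (wave P T t) x)" for j
      by (intro partial_cmult_fun smooth_wave P T)
    fix x and j :: 3
    have "\<bar>c / r * wave (partial 2 P) T t x\<bar> \<le> L * B * near x"
      "\<bar>c / r * wave (partial 3 P) T t x\<bar> \<le> L * B * near x"
      using c(2) rp by (intro * w; simp add: abs_divide)+
    moreover have "\<bar>c * n * wave P T' t x\<bar> \<le> L * B * near x"
      using cT
    proof
      assume "\<forall>s. T' s = 0"
      moreover have "0 \<le> L * B * near x"
        using order_trans[OF abs_ge_zero c(1)] B0 near_nonneg by (intro mult_nonneg_nonneg)
      ultimately show ?thesis by (simp add: wave_def)
    next
      assume "\<bar>c\<bar> * n \<le> L"
      then show ?thesis using n_pos by (intro * w) (simp add: abs_mult)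
    qed
    ultimately show "\<bar>partial j (\<lambda>x. c * wave P T t x) x\<bar> \<le> L * B * near x"
      unfolding pc using exhaust_3[of j] by (auto simp: partial_wave[OF P T(2)] mult.assoc)
  qed
qed

lemma lam_nonneg: "lam \<ge> 0"
  using lam N(1) by (metis exp_le_cancel_iff exp_zero of_nat_1 of_nat_le_iff)

lemma n_ge: "n \<ge> 1 / r" "n \<ge> 1" "n \<ge> 6 * exp lam"
proof -
  have "real N \<le> 6 * real N" "6 * real N \<le> n" unfolding n_def using pi_gt3 by (auto intro!: mult_right_mono)
  moreover have "real N \<ge> 1" using N by simp
  ultimately show "n \<ge> 1 / r" "n \<ge> 1" "n \<ge> 6 * exp lam" using N(2) lam by linarith+
qed

lemma seed_bounds: "seed > 0" "seed \<le> r\<^sup>2" "seed * n = r\<^sup>2"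
  unfolding seed_def using n_ge n_pos r by (auto simp: field_simps)

lemma rate_bounds: "t \<in> {0..1} \<Longrightarrow> 0 \<le> rate t \<and> rate t \<le> 2 * lam"
  unfolding rate_def using lam_nonneg by (auto intro!: mult_left_le)

lemma amp_bound:
  assumes "t \<in> {0..1}" shows "\<bar>amp t\<bar> \<le> r\<^sup>2"
proof -
  have "lam * t\<^sup>2 - t \<le> lam"
    using assms lam_nonneg mult_left_le[of "t\<^sup>2" lam] by (simp add: power_le_one)
  then have "exp (lam * t\<^sup>2 - t) \<le> exp lam" by simp
  moreover have "exp lam \<ge> 1" using lam_nonneg by simp
  ultimately have "\<bar>exp (lam * t\<^sup>2 - t) - 1\<bar> \<le> exp lam" by (smt (verit) exp_gt_zero)
  also have "\<dots> \<le> n" using n_ge(3) by (smt (verit) exp_gt_zero)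
  finally have "\<bar>amp t\<bar> \<le> seed * n"
    unfolding amp_def abs_mult using seed_bounds(1) by (simp add: mult_left_mono)
  then show ?thesis by (simp add: seed_bounds)
qed

lemma nu_bounds: "nu \<le> r\<^sup>2" "nu * n \<le> 1" "nu > 0"
proof -
  have "1 / n \<le> r" using n_ge(1) n_pos r by (simp add: field_simps)
  then have "(1 / n)\<^sup>2 \<le> r\<^sup>2" using n_pos by (intro power_mono) auto
  then show "nu \<le> r\<^sup>2" by (simp add: nu_def power_divide)
  show "nu * n \<le> 1" "nu > 0" using n_ge(2) n_pos by (simp_all add: nu_def power2_eq_square)
qed

definition force_const :: real where "force_const = 4 * (1 + lam)\<^sup>2"

lemma force_const_ge: "force_const \<ge> 1" "force_const \<ge> 2 * lam" "force_const \<ge> 2 * lam + 1" "force_const \<ge> (2 * lam)\<^sup>2" "force_const \<ge> 4 * lam + 1"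
  using lam_nonneg unfolding force_const_def by (auto simp: power2_eq_square algebra_simps)

lemma near_eq:
  assumes "x \<in> cbox 0 One" "near x \<noteq> 0"
  shows "x \<in> cbox (vector [1/2 - 2 * r, 1/2 - 2 * r, 0]) (vector [1/2 + 2 * r, 1/2 + 2 * r, 1])"
proof -
  have c: "1/2 - 2 * r \<le> z \<and> z \<le> 1/2 + 2 * r" if "\<bar>centred z\<bar> \<le> 2 * r" "0 \<le> z" "z \<le> 1" for z
  proof -
    have "z \<noteq> 1" using that r by (auto simp: centred_def)
    with that have "\<lfloor>z\<rfloor> = 0" by (intro floor_unique) auto
    with that show ?thesis by (simp add: centred_def abs_le_iff)
  qed
  have "\<bar>centred (x $ 1)\<bar> \<le> 2 * r" "\<bar>centred (x $ 2)\<bar> \<le> 2 * r"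
    using assms(2) by (auto simp: near_def split: if_splits)
  with c assms(1)[unfolded mem_unit_cube] show ?thesis
    by (simp add: mem_box_cart forall_3)
qed

context
  fixes B t :: real
  assumes B: "B \<ge> 1" "\<And>P y. P \<in> profiles \<Longrightarrow> \<bar>P y\<bar> \<le> B \<and> \<bar>partial 2 P y\<bar> \<le> B \<and> \<bar>partial 3 P y\<bar> \<le> B"
    and t: "t \<in> {0..1}"
begin

lemma near_bounded_one:
  assumes "P \<in> profiles" "\<bar>c\<bar> \<le> force_const * r"
  shows "near_bounded (force_const * B) (\<lambda>x. c * wave P one t x)"
proof (rule near_bounded_wave[where T' = "\<lambda>_. 0"])
  have "force_const * r \<le> force_const" using r force_const_ge by (intro mult_left_le) auto
  then show "\<bar>c\<bar> \<le> force_const" using assms by linarith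
  show "\<bar>c\<bar> / r \<le> force_const" using assms r by (simp add: field_simps)
qed (use assms profile_profiles B(2) in \<open>auto intro: smooth_one\<close>)

lemma near_bounded_trig:
  assumes "P \<in> profiles" "\<bar>c\<bar> * n \<le> force_const" "T = sin \<or> T = cos \<or> T = sc"
  shows "near_bounded (force_const * B) (\<lambda>x. c * wave P T t x)"
proof -
  have c: "\<bar>c\<bar> \<le> force_const" "\<bar>c\<bar> / r \<le> force_const"
    using mult_left_mono[OF n_ge(2), of "\<bar>c\<bar>"] mult_left_mono[OF n_ge(1), of "\<bar>c\<bar>"] assms(2) by auto
  define T' :: "real \<Rightarrow> real" where "T' = (if T = sin then cos else if T = cos then (\<lambda>s. - sin s) else (\<lambda>s. cos s * cos s - sin s * sin s))"
  have d: "(T has_real_derivative T' s) (at s)" for s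
    using assms(3) unfolding T'_def by (auto intro!: derivative_eq_intros)
  have "\<bar>cos s * cos s - sin s * sin s\<bar> \<le> (1::real)" "\<bar>sin s * cos s\<bar> \<le> (1::real)" for s :: real
    using cos_double[of s] abs_cos_le_one[of "2 * s"] mult_mono[OF abs_sin_le_one abs_cos_le_one, of s s]
    by (auto simp: power2_eq_square abs_mult)
  then have T1: "\<bar>T s\<bar> \<le> 1 \<and> \<bar>T' s\<bar> \<le> 1" for s
    using assms(3) unfolding T'_def by auto
  show ?thesis
    using assms profile_profiles B(2) c T1 d smooth_waveforms by (intro near_bounded_wave[where T' = T']) auto
qed

lemma near_bounded_fh:
  assumes "P = V1 \<and> Q = A1 \<or> P = V2 \<and> Q = A2"
  shows "near_bounded (6 * (force_const * B)) (fh P Q t)"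
proof -
  have mem: "P \<in> profiles" "Q \<in> profiles" "material P \<in> profiles" "hlap P \<in> profiles" "hlap Q \<in> profiles"
    "(\<lambda>y. divA y * Q y) \<in> profiles"
    using assms by (auto simp: profiles_def)
  note g = amp_bound[OF t] and s = rate_bounds[OF t] and rp = r(1)
  have r1: "r \<le> 1" using r by simp
  have c1: "\<bar>2 * lam * r\<bar> \<le> force_const * r" using rp force_const_ge lam_nonneg by (simp add: abs_mult)
  have second_harmonic: "\<bar>(rate t)\<^sup>2 * r\<bar> \<le> force_const * r"
    using rp power_mono[of "rate t" "2 * lam" 2] s force_const_ge(4) by (simp add: abs_mult)
  have c3: "\<bar>- (nu * rate t / r)\<bar> \<le> force_const * r"
  proof -
    have "nu * rate t \<le> r\<^sup>2 * force_const" using s nu_bounds force_const_ge by (intro mult_mono) auto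
    then show ?thesis using rp s nu_bounds by (simp add: abs_mult abs_divide field_simps power2_eq_square)
  qed
  have c4: "\<bar>seed * (rate t - 1)\<bar> * n \<le> force_const"
  proof -
    have "\<bar>seed * (rate t - 1)\<bar> * n = r\<^sup>2 * \<bar>rate t - 1\<bar>"
      using seed_bounds by (simp add: abs_mult mult.commute mult.left_commute)
    also have "\<dots> \<le> 1 * (2 * lam + 1)" using s r1 rp by (intro mult_mono) (auto simp: power_le_one)
    finally show ?thesis using force_const_ge by simp
  qed
  have c5: "\<bar>- (nu * amp t / r\<^sup>2)\<bar> * n \<le> force_const"
  proof -
    have "\<bar>- (nu * amp t / r\<^sup>2)\<bar> * n = (nu * n) * (\<bar>amp t\<bar> / r\<^sup>2)"
      using nu_bounds by (simp add: abs_mult abs_divide)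
    also have "\<dots> \<le> 1 * 1" using nu_bounds g n_pos rp by (intro mult_mono) auto
    finally show ?thesis using force_const_ge by simp
  qed
  have c6: "\<bar>(amp t)\<^sup>2 / r\<bar> \<le> force_const * r"
  proof -
    have "(amp t)\<^sup>2 \<le> (r\<^sup>2)\<^sup>2" using g by (metis abs_ge_zero power2_abs power_mono)
    also have "\<dots> \<le> 1 * r\<^sup>2" using r1 rp unfolding power2_eq_square[of "r\<^sup>2"]
      by (intro mult_mono) (auto simp: power_le_one)
    finally have "(amp t)\<^sup>2 / r \<le> r" using rp by (simp add: field_simps power2_eq_square)
    also have "\<dots> \<le> force_const * r" using force_const_ge rp by simp
    finally show ?thesis using rp by simp
  qed
  have t4: "near_bounded (force_const * B) (\<lambda>x. seed * (rate t - 1) * wave Q cos t x)"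
    by (rule near_bounded_trig[OF mem(2) c4]) simp
  have t5: "near_bounded (force_const * B) (\<lambda>x. - (nu * amp t / r\<^sup>2) * wave (hlap Q) cos t x)"
    by (rule near_bounded_trig[OF mem(5) c5]) simp
  have "near_bounded (force_const * B + force_const * B + force_const * B + force_const * B + force_const * B + force_const * B) (fh P Q t)"
    unfolding fh_def[abs_def]
    by (intro near_bounded_add near_bounded_one[OF mem(1) c1] near_bounded_one[OF mem(3) second_harmonic] near_bounded_one[OF mem(4) c3] t4 t5
        near_bounded_one[OF mem(6) c6])
  then show ?thesis by (rule near_bounded_mono) simp
qed

lemma near_bounded_f3: "near_bounded (4 * (force_const * B)) (f3 t)"
proof -
  have mem: "divA \<in> profiles" "material divA \<in> profiles" "hlap divA \<in> profiles" "second_harmonic \<in> profiles"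
    by (auto simp: profiles_def)
  note g = amp_bound[OF t] and s = rate_bounds[OF t] and rp = r(1)
  have r1: "r \<le> 1" using r by simp
  have rr: "r\<^sup>2 \<le> r" "r\<^sup>2 \<le> 1" using r1 rp power_le_one[of r 2] by (simp_all add: power2_eq_square mult_left_le)
  have *: "\<bar>z / (n * d)\<bar> * n = \<bar>z\<bar> / d" if "d > 0" for z d :: real
    using n_pos that by (simp add: abs_divide abs_mult)
  have "\<bar>- ((rate t * (amp t + seed) - seed) / (n * r))\<bar> * n \<le> force_const"
  proof -
    have "\<bar>rate t * (amp t + seed) - seed\<bar> \<le> \<bar>rate t * (amp t + seed)\<bar> + \<bar>seed\<bar>" by (rule abs_triangle_ineq4)
    also have "\<dots> \<le> 2 * lam * (r + r) + r"
      unfolding abs_mult using g seed_bounds rr s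
      by (intro add_mono mult_mono) (auto intro: abs_triangle_ineq[THEN order_trans])
    also have "\<dots> = (4 * lam + 1) * r" by (simp add: algebra_simps)
    also have "\<dots> \<le> force_const * r" using force_const_ge(5) rp by (intro mult_right_mono) auto
    finally have "\<bar>rate t * (amp t + seed) - seed\<bar> / r \<le> force_const" using rp by (simp add: field_simps)
    then show ?thesis unfolding abs_minus_cancel *[OF rp] .
  qed
  moreover have "\<bar>- (amp t * rate t / (n * r))\<bar> * n \<le> force_const"
  proof -
    have "\<bar>amp t * rate t\<bar> \<le> r * (2 * lam)"
      unfolding abs_mult using g rr s by (intro mult_mono) auto
    also have "\<dots> \<le> r * force_const" using force_const_ge rp by (intro mult_left_mono) auto
    finally have "\<bar>amp t * rate t\<bar> / r \<le> force_const" using rp by (simp add: field_simps)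
    then show ?thesis unfolding abs_minus_cancel *[OF rp] .
  qed
  moreover have "\<bar>nu * amp t / (n * r ^ 3)\<bar> * n \<le> force_const"
  proof -
    have "\<bar>nu * amp t\<bar> \<le> r\<^sup>2 * r"
      unfolding abs_mult using g rr nu_bounds by (intro mult_mono) auto
    also have "\<dots> = 1 * r ^ 3" by (simp add: power2_eq_square power3_eq_cube)
    also have "\<dots> \<le> force_const * r ^ 3" using force_const_ge rp by (intro mult_right_mono) auto
    finally have "\<bar>nu * amp t\<bar> / r ^ 3 \<le> force_const" using rp by (simp add: field_simps)
    then show ?thesis using *[of "r ^ 3" "nu * amp t"] rp by simp
  qed
  moreover have "\<bar>(amp t)\<^sup>2 / (n * r\<^sup>2)\<bar> * n \<le> force_const"
  proof -
    have "\<bar>(amp t)\<^sup>2\<bar> \<le> r\<^sup>2 * 1"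
      unfolding power2_eq_square[of "amp t"] abs_mult using g rr by (intro mult_mono) auto
    also have "\<dots> \<le> r\<^sup>2 * force_const" using force_const_ge rp by (intro mult_left_mono) auto
    finally have "\<bar>(amp t)\<^sup>2\<bar> / r\<^sup>2 \<le> force_const" using rp by (simp add: field_simps)
    then show ?thesis using *[of "r\<^sup>2" "(amp t)\<^sup>2"] rp by simp
  qed
  ultimately have "near_bounded (force_const * B + force_const * B + force_const * B + force_const * B) (f3 t)"
    unfolding f3_def[abs_def] by (intro near_bounded_add near_bounded_trig mem) auto
  then show ?thesis by (rule near_bounded_mono) simp
qed

lemma f_bound:
  "norm (f t x) \<le> 48 * (force_const * B) * near x" "grad_norm (f t) x \<le> 48 * (force_const * B) * near x"
proof -
  have f: "near_bounded (6 * (force_const * B)) (fh V1 A1 t)" "near_bounded (6 * (force_const * B)) (fh V2 A2 t)" "near_bounded (4 * (force_const * B)) (f3 t)"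
    by (intro near_bounded_fh near_bounded_f3; simp)+
  note bds = f[unfolded near_bounded_def]
  have v: "norm (v :: real^3) \<le> 16 * (force_const * B) * near x"
    if "\<bar>v $ 1\<bar> \<le> 6 * (force_const * B) * near x" "\<bar>v $ 2\<bar> \<le> 6 * (force_const * B) * near x" "\<bar>v $ 3\<bar> \<le> 4 * (force_const * B) * near x" for v
    using norm_le_l1_cart[of v] that by (simp add: sum_3)
  have pos: "0 \<le> force_const * B * near x" using force_const_ge B near_nonneg by (intro mult_nonneg_nonneg) auto
  have "norm (f t x) \<le> 16 * (force_const * B) * near x"
    using bds by (intro v) (auto simp: f_def)
  then show "norm (f t x) \<le> 48 * (force_const * B) * near x" using pos by simp
  have "partial j (f t) x = vector [partial j (fh V1 A1 t) x, partial j (fh V2 A2 t) x, partial j (f3 t) x]" for j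
    unfolding f_def[abs_def] using bds by (intro partial_vector3) auto
  then have p: "norm (partial j (f t) x) \<le> 16 * (force_const * B) * near x" for j
    using bds by (intro v) auto
  have "grad_norm (f t) x = L2_set (\<lambda>j. norm (partial j (f t) x)) UNIV"
    by (simp add: grad_norm_def L2_set_def)
  also have "\<dots> \<le> (\<Sum>j\<in>UNIV. norm (partial j (f t) x))" by (rule L2_set_le_sum) simp
  also have "\<dots> \<le> (\<Sum>j\<in>(UNIV::3 set). 16 * (force_const * B) * near x)" by (intro sum_mono p)
  finally show "grad_norm (f t) x \<le> 48 * (force_const * B) * near x" by (simp add: mult.assoc)
qed

lemma W1p_norm_f:
  assumes p: "p \<ge> 1"
  shows "W1p_norm p (f t) \<le> (2 * (48 * (force_const * B)) powr p * (16 * r\<^sup>2)) powr (1 / p)"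
proof -
  define K where "K = 2 * (48 * (force_const * B)) powr p"
  define b1 b2 :: "real^3" where "b1 = vector [1/2 - 2 * r, 1/2 - 2 * r, 0]"
    and "b2 = vector [1/2 + 2 * r, 1/2 + 2 * r, 1]"
  define h where "h x = norm (f t x) powr p + grad_norm (f t) x powr p" for x
  have h: "h x \<le> K" "near x = 0 \<Longrightarrow> h x = 0" for x
  proof -
    have n1: "near x \<le> 1" by (simp add: near_def)
    have pos: "0 \<le> 48 * (force_const * B)" using force_const_ge B by simp
    have le: "48 * (force_const * B) * near x \<le> 48 * (force_const * B)" using n1 pos by (rule mult_left_le)
    have "norm (f t x) powr p \<le> (48 * (force_const * B)) powr p"
      using p le f_bound(1)[of x] by (intro powr_mono2) auto
    moreover have "grad_norm (f t) x powr p \<le> (48 * (force_const * B)) powr p"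
      using p le f_bound(2)[of x] by (intro powr_mono2) (auto simp: grad_norm_def intro: sum_nonneg)
    ultimately show "h x \<le> K" by (simp add: h_def K_def)
    assume "near x = 0"
    then have "norm (f t x) = 0" "grad_norm (f t) x = 0"
      using f_bound[of x] by (auto simp: grad_norm_def intro!: antisym sum_nonneg)
    then show "h x = 0" by (simp add: h_def)
  qed
  have h0: "h x \<ge> 0" for x by (simp add: h_def)
  have K0: "K \<ge> 0" by (simp add: K_def)
  have "torus_integral h \<le> (\<integral>x. indicator (cbox b1 b2) x *\<^sub>R K \<partial>lborel)"
    unfolding torus_integral_def set_lebesgue_integral_def
  proof (rule integral_mono')
    show "integrable lborel (\<lambda>x. indicator (cbox b1 b2) x *\<^sub>R K)"
      using emeasure_bounded_finite[OF bounded_cbox, of b1 b2]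
      by (intro integrable_scaleR_left integrable_real_indicator) auto
    fix x :: "real^3"
    show "indicator (cbox 0 One) x *\<^sub>R h x \<le> indicator (cbox b1 b2) x *\<^sub>R K"
      using h[of x] near_eq[of x, folded b1_def b2_def] K0
      by (cases "near x = 0") (auto simp: indicator_def)
    show "0 \<le> indicator (cbox b1 b2) x *\<^sub>R K" using K0 by simp
  qed
  also have "\<dots> = K * measure lborel (cbox b1 b2)" by simp
  also have "measure lborel (cbox b1 b2) = 16 * r\<^sup>2"
  proof -
    have "b1 \<in> cbox b1 b2" using r by (simp add: b1_def b2_def mem_box_cart forall_3)
    then have "cbox b1 b2 \<noteq> {}" by blast
    then have "measure lborel (cbox b1 b2) = (\<Prod>i\<in>UNIV. b2 $ i - b1 $ i)" by (rule content_cbox_cart)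
    also have "\<dots> = (4 * r) * ((4 * r) * 1)"
      unfolding UNIV_3 by (subst prod.insert; simp add: b1_def b2_def)+
    also have "\<dots> = 16 * r\<^sup>2" by (simp add: power2_eq_square)
    finally show ?thesis .
  qed
  finally have "torus_integral h \<le> K * (16 * r\<^sup>2)" .
  moreover have "0 \<le> torus_integral h"
    unfolding torus_integral_def set_lebesgue_integral_def
    by (intro Bochner_Integration.integral_nonneg) (simp add: h0)
  ultimately have "torus_integral h powr (1 / p) \<le> (K * (16 * r\<^sup>2)) powr (1 / p)"
    using p by (intro powr_mono2) auto
  then show ?thesis by (simp only: W1p_norm_def h_def[abs_def] K_def)
qed

end

end

section \<open>A rotating strain\<close>

lemma has_real_derivative_along_line:
  fixes g :: "real^3 \<Rightarrow> real"
  assumes "smooth_on UNIV g"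
  shows "((\<lambda>s. g (y + s *\<^sub>R axis j 1)) has_real_derivative partial j g y) (at 0)"
proof -
  have "((\<lambda>s. y + s *\<^sub>R axis j 1) has_derivative (\<lambda>h. h *\<^sub>R axis j 1)) (at 0)"
    by (auto intro!: derivative_eq_intros)
  moreover have d: "(g has_derivative frechet_derivative g (at y)) (at (y + 0 *\<^sub>R axis j 1))"
    using smooth_on_differentiable[OF assms, of y] by simp
  ultimately have "((\<lambda>s. g (y + s *\<^sub>R axis j 1)) has_derivative
      (\<lambda>h. frechet_derivative g (at y) (h *\<^sub>R axis j 1))) (at 0)"
    by (rule has_derivative_compose)
  also have "(\<lambda>h. frechet_derivative g (at y) (h *\<^sub>R axis j 1)) = (*) (partial j g y)"
    using linear_scale[OF has_derivative_linear[OF d]] by (simp add: fun_eq_iff partial_def)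
  finally show ?thesis by (simp add: has_field_derivative_def)
qed

lemma partial_along_line:
  fixes g :: "real^3 \<Rightarrow> real"
  assumes "smooth_on UNIV g" "((\<lambda>s. g (y + s *\<^sub>R axis j 1)) has_real_derivative d) (at 0)"
  shows "partial j g y = d"
  using has_real_derivative_along_line[OF assms(1)] assms(2) by (rule DERIV_unique)

lemma smooth_on_has_real_derivative:
  fixes g :: "real \<Rightarrow> real"
  assumes "smooth_on UNIV g"
  shows "(g has_real_derivative deriv g x) (at x)"
proof -
  from smooth_on_imp_has_derivative[OF assms, of x] obtain D where "(g has_derivative D) (at x)" by auto
  then have "g differentiable at x" by (auto simp: differentiable_def)
  then show ?thesis by (simp add: DERIV_deriv_iff_real_differentiable)
qed

lemma plateau_deriv: "(plateau has_real_derivative deriv plateau x) (at x)"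
  by (intro smooth_on_has_real_derivative smooth_on_plateau smooth_on_id)

lemma deriv_plateau_eq_0:
  assumes "\<bar>x\<bar> < 3/2" shows "deriv plateau x = 0"
proof (rule DERIV_imp_deriv)
  show "(plateau has_real_derivative 0) (at x)"
    by (rule has_field_derivative_transform_within_open[of "\<lambda>_. 1" _ _ "{-(3/2)<..<3/2}"])
       (use assms in \<open>auto simp: plateau_eq_1 abs_le_iff\<close>)
qed

text \<open>
  In the core, the velocity field generated by the stream function \<open>psi\<close> is a strain rotating with
  angle \<open>y $ 1\<close> plus a rigid rotation. Its trajectories are ellipses, on which \<open>qform\<close> is constant,
  whereas the stretching term amplifies the direction \<open>(- sin (y $ 1), cos (y $ 1))\<close>.
\<close>

definition psi :: "real^3 \<Rightarrow> real" where
  "psi y = ((y $ 2)\<^sup>2 + (y $ 3)\<^sup>2) / 2 + sin (2 * y $ 1) * ((y $ 3)\<^sup>2 - (y $ 2)\<^sup>2) / 2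
    + cos (2 * y $ 1) * (y $ 2) * (y $ 3)"

definition qform :: "real^3 \<Rightarrow> real" where
  "qform y = psi y + ((y $ 2)\<^sup>2 + (y $ 3)\<^sup>2) / 2"

definition stream :: "real^3 \<Rightarrow> real" where
  "stream y = plateau (y $ 2) * plateau (y $ 3) * psi y"

definition envelope :: "real^3 \<Rightarrow> real" where
  "envelope y = flat (1 - qform y)"

definition flow1 :: "real^3 \<Rightarrow> real" where "flow1 y = partial 3 stream y"
definition flow2 :: "real^3 \<Rightarrow> real" where "flow2 y = - partial 2 stream y"
definition dir1 :: "real^3 \<Rightarrow> real" where "dir1 y = - sin (y $ 1) * envelope y"
definition dir2 :: "real^3 \<Rightarrow> real" where "dir2 y = cos (y $ 1) * envelope y"

lemma psi_nonneg: "psi y \<ge> 0"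
proof -
  define X Y s c where d: "X = y $ 2" "Y = y $ 3" "s = sin (2 * y $ 1)" "c = cos (2 * y $ 1)"
  have sc: "s\<^sup>2 + c\<^sup>2 = 1" by (simp add: d)
  have "\<bar>s * ((Y\<^sup>2 - X\<^sup>2) / 2) + c * (X * Y)\<bar> \<le> (X\<^sup>2 + Y\<^sup>2) / 2"
  proof (rule power2_le_imp_le)
    have "(s * ((Y\<^sup>2 - X\<^sup>2) / 2) + c * (X * Y))\<^sup>2 + (s * (X * Y) - c * ((Y\<^sup>2 - X\<^sup>2) / 2))\<^sup>2
        = (s\<^sup>2 + c\<^sup>2) * ((X\<^sup>2 + Y\<^sup>2) / 2)\<^sup>2"
      by (simp add: power2_eq_square field_simps)
    then show "\<bar>s * ((Y\<^sup>2 - X\<^sup>2) / 2) + c * (X * Y)\<bar>\<^sup>2 \<le> ((X\<^sup>2 + Y\<^sup>2) / 2)\<^sup>2"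
      unfolding sc power2_abs by (metis le_add_same_cancel1 mult_1 zero_le_power2)
  qed simp
  then have "0 \<le> (X\<^sup>2 + Y\<^sup>2) / 2 + (s * ((Y\<^sup>2 - X\<^sup>2) / 2) + c * (X * Y))" by (simp only: abs_le_iff) linarith
  then show ?thesis by (simp add: psi_def d algebra_simps)
qed

lemma qform_ge: "qform y \<ge> ((y $ 2)\<^sup>2 + (y $ 3)\<^sup>2) / 2"
  using psi_nonneg[of y] by (simp add: qform_def)

lemma smooth_psi: "smooth_on UNIV psi"
  unfolding psi_def[abs_def] by (intro smooth)

lemma smooth_qform: "smooth_on UNIV qform"
  unfolding qform_def[abs_def] by (intro smooth smooth_psi)

lemma smooth_stream: "smooth_on UNIV stream"
  unfolding stream_def[abs_def] by (intro smooth smooth_psi)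

lemma smooth_envelope: "smooth_on UNIV envelope"
  unfolding envelope_def[abs_def] by (intro smooth smooth_qform)

lemma psi_periodic: "psi (y + axis 1 (2 * pi * of_int k)) = psi y"
proof -
  have "2 * (y + axis 1 (2 * pi * of_int k)) $ 1 = 2 * y $ 1 + 2 * pi * of_int (2 * k)"
    by (simp add: axis_def)
  then show ?thesis unfolding psi_def by (simp only: angle_shift) (simp add: axis_def)
qed

lemma envelope_eq_0:
  assumes "\<bar>y $ 2\<bar> \<ge> 3/2 \<or> \<bar>y $ 3\<bar> \<ge> 3/2" shows "qform y > 1" "envelope y = 0"
proof -
  have "9/4 \<le> z\<^sup>2" if "\<bar>z\<bar> \<ge> 3/2" for z :: real
    using power_mono[OF that, of 2] by (simp add: power2_eq_square)
  then have "9/4 \<le> (y $ 2)\<^sup>2 + (y $ 3)\<^sup>2"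
    using assms by (metis add_increasing add_increasing2 zero_le_power2)
  then have "1 < ((y $ 2)\<^sup>2 + (y $ 3)\<^sup>2) / 2" by simp
  then show "qform y > 1" using qform_ge[of y] by (rule less_le_trans)
  then show "envelope y = 0" by (simp add: envelope_def)
qed

lemma profile_stream: "profile stream"
  unfolding profile_def
proof (intro conjI allI impI)
  show "stream y = 0" if "2 < \<bar>y $ 2\<bar> \<or> 2 < \<bar>y $ 3\<bar>" for y
    using that by (auto simp: stream_def plateau_eq_0)
  show "stream (y + axis 1 (2 * pi * of_int k)) = stream y" for y k
    unfolding stream_def psi_periodic by (simp add: axis_def)
qed (rule smooth_stream)

lemma profile_envelope: "profile envelope"
  unfolding profile_def
proof (intro conjI allI impI)
  show "envelope y = 0" if "2 < \<bar>y $ 2\<bar> \<or> 2 < \<bar>y $ 3\<bar>" for y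
    using that by (intro envelope_eq_0) auto
  show "envelope (y + axis 1 (2 * pi * of_int k)) = envelope y" for y k
    unfolding envelope_def qform_def psi_periodic by (simp add: axis_def)
qed (rule smooth_envelope)

lemma profile_angle:
  assumes "profile P"
  shows "profile (\<lambda>y. - sin (y $ 1) * P y)" "profile (\<lambda>y. cos (y $ 1) * P y)"
  using assms unfolding profile_def
  by (auto simp: angle_shift axis_def intro!: smooth)

lemma profile_flow: "profile flow1" "profile flow2" "profile dir1" "profile dir2"
  unfolding flow1_def[abs_def] flow2_def[abs_def] dir1_def[abs_def] dir2_def[abs_def]
  by (intro profile_minus profile_partial profile_stream profile_envelope profile_angle)+

lemma partial_psi:
  "partial 1 psi y = cos (2 * y $ 1) * ((y $ 3)\<^sup>2 - (y $ 2)\<^sup>2) - 2 * sin (2 * y $ 1) * (y $ 2) * (y $ 3)"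
  "partial 2 psi y = (1 - sin (2 * y $ 1)) * y $ 2 + cos (2 * y $ 1) * y $ 3"
  "partial 3 psi y = (1 + sin (2 * y $ 1)) * y $ 3 + cos (2 * y $ 1) * y $ 2"
proof -
  have "psi (y + s *\<^sub>R axis 1 1) = ((y $ 2)\<^sup>2 + (y $ 3)\<^sup>2) / 2
      + sin (2 * (y $ 1 + s)) * ((y $ 3)\<^sup>2 - (y $ 2)\<^sup>2) / 2 + cos (2 * (y $ 1 + s)) * (y $ 2) * (y $ 3)"
    "psi (y + s *\<^sub>R axis 2 1) = ((y $ 2 + s)\<^sup>2 + (y $ 3)\<^sup>2) / 2
      + sin (2 * y $ 1) * ((y $ 3)\<^sup>2 - (y $ 2 + s)\<^sup>2) / 2 + cos (2 * y $ 1) * (y $ 2 + s) * (y $ 3)"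
    "psi (y + s *\<^sub>R axis 3 1) = ((y $ 2)\<^sup>2 + (y $ 3 + s)\<^sup>2) / 2
      + sin (2 * y $ 1) * ((y $ 3 + s)\<^sup>2 - (y $ 2)\<^sup>2) / 2 + cos (2 * y $ 1) * (y $ 2) * (y $ 3 + s)" for s
    by (simp_all add: psi_def axis_def)
  note line = this
  show "partial 1 psi y = cos (2 * y $ 1) * ((y $ 3)\<^sup>2 - (y $ 2)\<^sup>2) - 2 * sin (2 * y $ 1) * (y $ 2) * (y $ 3)"
    by (rule partial_along_line[OF smooth_psi], unfold line)
       (auto intro!: derivative_eq_intros simp: field_simps power2_eq_square)
  show "partial 2 psi y = (1 - sin (2 * y $ 1)) * y $ 2 + cos (2 * y $ 1) * y $ 3"
    by (rule partial_along_line[OF smooth_psi], unfold line)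
       (auto intro!: derivative_eq_intros simp: field_simps power2_eq_square)
  show "partial 3 psi y = (1 + sin (2 * y $ 1)) * y $ 3 + cos (2 * y $ 1) * y $ 2"
    by (rule partial_along_line[OF smooth_psi], unfold line)
       (auto intro!: derivative_eq_intros simp: field_simps power2_eq_square)
qed

lemmas psi_along_line = has_real_derivative_along_line[OF smooth_psi]

lemma plateau_along_line: "((\<lambda>s. plateau (c + s)) has_real_derivative deriv plateau c) (at 0)"
  using DERIV_shift[of plateau "deriv plateau c" 0 c] plateau_deriv[of c] by (simp add: add.commute)

lemma partial_qform:
  "partial 1 qform y = partial 1 psi y"
  "partial 2 qform y = partial 2 psi y + y $ 2"
  "partial 3 qform y = partial 3 psi y + y $ 3"
proof -
  have sq: "smooth_on UNIV (\<lambda>y::real^3. ((y $ 2)\<^sup>2 + (y $ 3)\<^sup>2) / 2)" by (intro smooth)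
  have "partial j qform y = partial j psi y + partial j (\<lambda>y. ((y $ 2)\<^sup>2 + (y $ 3)\<^sup>2) / 2) y" for j
    unfolding qform_def[abs_def] by (rule partial_add[OF smooth_psi sq])
  moreover have "partial 1 (\<lambda>y::real^3. ((y $ 2)\<^sup>2 + (y $ 3)\<^sup>2) / 2) y = 0"
    "partial 2 (\<lambda>y::real^3. ((y $ 2)\<^sup>2 + (y $ 3)\<^sup>2) / 2) y = y $ 2"
    "partial 3 (\<lambda>y::real^3. ((y $ 2)\<^sup>2 + (y $ 3)\<^sup>2) / 2) y = y $ 3"
    by (rule partial_along_line[OF sq], auto intro!: derivative_eq_intros simp: axis_def)+
  ultimately show "partial 1 qform y = partial 1 psi y" "partial 2 qform y = partial 2 psi y + y $ 2"
    "partial 3 qform y = partial 3 psi y + y $ 3" by simp_all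
qed

definition slope :: "real^3 \<Rightarrow> real" where
  "slope y = flat (1 - qform y) / (1 - qform y)\<^sup>2"

lemma partial_envelope: "partial j envelope y = - slope y * partial j qform y"
proof -
  have "((\<lambda>y. 1 - qform y) has_derivative (\<lambda>h. - frechet_derivative qform (at y) h)) (at y)"
    by (auto intro!: derivative_eq_intros smooth_on_differentiable smooth_qform)
  moreover have "(flat has_derivative (*) (slope y)) (at (1 - qform y))"
    using flat_deriv[of "1 - qform y"] by (simp add: has_field_derivative_def slope_def)
  ultimately have "(envelope has_derivative (\<lambda>h. slope y * - frechet_derivative qform (at y) h)) (at y)"
    unfolding envelope_def[abs_def] by (rule has_derivative_compose)
  from has_derivative_imp_partial[OF this] show ?thesis by (simp add: partial_def)
qed

lemma partial_angle:
  "partial 1 (\<lambda>y::real^3. - sin (y $ 1)) y = - cos (y $ 1)" "partial 2 (\<lambda>y::real^3. - sin (y $ 1)) y = 0"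
  "partial 3 (\<lambda>y::real^3. - sin (y $ 1)) y = 0"
  "partial 1 (\<lambda>y::real^3. cos (y $ 1)) y = - sin (y $ 1)" "partial 2 (\<lambda>y::real^3. cos (y $ 1)) y = 0"
  "partial 3 (\<lambda>y::real^3. cos (y $ 1)) y = 0"
  by (rule partial_along_line, intro smooth, auto intro!: derivative_eq_intros simp: axis_def)+

lemma partial_dir:
  "partial 1 dir1 y = - cos (y $ 1) * envelope y + sin (y $ 1) * slope y * partial 1 qform y"
  "partial 2 dir1 y = sin (y $ 1) * slope y * partial 2 qform y"
  "partial 3 dir1 y = sin (y $ 1) * slope y * partial 3 qform y"
  "partial 1 dir2 y = - sin (y $ 1) * envelope y - cos (y $ 1) * slope y * partial 1 qform y"
  "partial 2 dir2 y = - cos (y $ 1) * slope y * partial 2 qform y"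
  "partial 3 dir2 y = - cos (y $ 1) * slope y * partial 3 qform y"
proof -
  have s: "smooth_on UNIV (\<lambda>y::real^3. - sin (y $ 1))" "smooth_on UNIV (\<lambda>y::real^3. cos (y $ 1))"
    by (intro smooth)+
  have "partial j dir1 y = - sin (y $ 1) * partial j envelope y + partial j (\<lambda>y::real^3. - sin (y $ 1)) y * envelope y"
    "partial j dir2 y = cos (y $ 1) * partial j envelope y + partial j (\<lambda>y::real^3. cos (y $ 1)) y * envelope y" for j
    unfolding dir1_def[abs_def] dir2_def[abs_def] by (rule partial_mult[OF s(1) smooth_envelope] partial_mult[OF s(2) smooth_envelope])+
  then show
    "partial 1 dir1 y = - cos (y $ 1) * envelope y + sin (y $ 1) * slope y * partial 1 qform y"
    "partial 2 dir1 y = sin (y $ 1) * slope y * partial 2 qform y"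
    "partial 3 dir1 y = sin (y $ 1) * slope y * partial 3 qform y"
    "partial 1 dir2 y = - sin (y $ 1) * envelope y - cos (y $ 1) * slope y * partial 1 qform y"
    "partial 2 dir2 y = - cos (y $ 1) * slope y * partial 2 qform y"
    "partial 3 dir2 y = - cos (y $ 1) * slope y * partial 3 qform y"
    by (simp_all add: partial_envelope partial_angle)
qed

lemma flow_eq:
  "flow1 y = plateau (y $ 2) * (deriv plateau (y $ 3) * psi y + plateau (y $ 3) * partial 3 psi y)"
  "flow2 y = - plateau (y $ 3) * (deriv plateau (y $ 2) * psi y + plateau (y $ 2) * partial 2 psi y)"
proof -
  have line: "stream (y + s *\<^sub>R axis 3 1) = plateau (y $ 2) * plateau (y $ 3 + s) * psi (y + s *\<^sub>R axis 3 1)"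
    "stream (y + s *\<^sub>R axis 2 1) = plateau (y $ 2 + s) * plateau (y $ 3) * psi (y + s *\<^sub>R axis 2 1)" for s
    by (simp_all add: stream_def axis_def)
  show "flow1 y = plateau (y $ 2) * (deriv plateau (y $ 3) * psi y + plateau (y $ 3) * partial 3 psi y)"
    unfolding flow1_def
    by (rule partial_along_line[OF smooth_stream], unfold line,
        (rule derivative_eq_intros plateau_along_line psi_along_line refl)+) (simp add: algebra_simps)
  have "partial 2 stream y = plateau (y $ 3) * (deriv plateau (y $ 2) * psi y + plateau (y $ 2) * partial 2 psi y)"
    by (rule partial_along_line[OF smooth_stream], unfold line,
        (rule derivative_eq_intros plateau_along_line psi_along_line refl)+) (simp add: algebra_simps)
  then show "flow2 y = - plateau (y $ 3) * (deriv plateau (y $ 2) * psi y + plateau (y $ 2) * partial 2 psi y)"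
    by (simp add: flow2_def)
qed

lemma flow_core:
  assumes "\<bar>y $ 2\<bar> < 3/2" "\<bar>y $ 3\<bar> < 3/2"
  shows "flow1 y = partial 3 psi y" "flow2 y = - partial 2 psi y"
  using assms by (simp_all add: flow_eq plateau_eq_1 deriv_plateau_eq_0)

lemma partial_flow_core:
  assumes "\<bar>y $ 2\<bar> < 3/2" "\<bar>y $ 3\<bar> < 3/2"
  shows "partial 2 flow1 y = cos (2 * y $ 1)" "partial 3 flow1 y = 1 + sin (2 * y $ 1)"
    "partial 2 flow2 y = sin (2 * y $ 1) - 1" "partial 3 flow2 y = - cos (2 * y $ 1)"
proof -
  define U where "U = {z::real^3. \<bar>z $ 2\<bar> < 3/2 \<and> \<bar>z $ 3\<bar> < 3/2}"
  have U: "open U" "y \<in> U"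
    unfolding U_def using assms
    by (auto intro!: open_Collect_conj open_Collect_less continuous_intros)
  have eq: "partial j g y = partial j h y"
    if "smooth_on UNIV h" "\<And>z. z \<in> U \<Longrightarrow> h z = g z" for j g and h :: "real^3 \<Rightarrow> real"
    using has_derivative_transform_within_open[OF smooth_on_differentiable[OF that(1)] U that(2)]
      has_derivative_imp_partial by (metis partial_def)
  have s: "smooth_on UNIV (\<lambda>y::real^3. (1 + sin (2 * y $ 1)) * y $ 3 + cos (2 * y $ 1) * y $ 2)"
    "smooth_on UNIV (\<lambda>y::real^3. - ((1 - sin (2 * y $ 1)) * y $ 2 + cos (2 * y $ 1) * y $ 3))"
    by (intro smooth)+
  have e: "partial j flow1 y = partial j (\<lambda>y::real^3. (1 + sin (2 * y $ 1)) * y $ 3 + cos (2 * y $ 1) * y $ 2) y"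
    "partial j flow2 y = partial j (\<lambda>y::real^3. - ((1 - sin (2 * y $ 1)) * y $ 2 + cos (2 * y $ 1) * y $ 3)) y" for j
    by (rule eq[OF s(1)] eq[OF s(2)]; simp add: U_def flow_core partial_psi)+
  show "partial 2 flow1 y = cos (2 * y $ 1)" "partial 3 flow1 y = 1 + sin (2 * y $ 1)"
    unfolding e
    by (rule partial_along_line[OF s(1)], simp add: axis_def, auto intro!: derivative_eq_intros)+
  show "partial 2 flow2 y = sin (2 * y $ 1) - 1"
    unfolding e by (rule partial_along_line[OF s(2)], simp add: axis_def, auto intro!: derivative_eq_intros)
  show "partial 3 flow2 y = - cos (2 * y $ 1)"
    unfolding e by (rule partial_along_line[OF s(2)], simp add: axis_def, auto intro!: derivative_eq_intros)
qed

lemma div_flow: "partial 2 flow1 y + partial 3 flow2 y = 0"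
proof -
  have line: "flow1 (y + s *\<^sub>R axis 2 1) = plateau (y $ 2 + s) * (deriv plateau (y $ 3) * psi (y + s *\<^sub>R axis 2 1)
        + plateau (y $ 3) * ((1 + sin (2 * y $ 1)) * y $ 3 + cos (2 * y $ 1) * (y $ 2 + s)))"
    "flow2 (y + s *\<^sub>R axis 3 1) = - plateau (y $ 3 + s) * (deriv plateau (y $ 2) * psi (y + s *\<^sub>R axis 3 1)
        + plateau (y $ 2) * ((1 - sin (2 * y $ 1)) * y $ 2 + cos (2 * y $ 1) * (y $ 3 + s)))" for s
    by (simp_all add: flow_eq partial_psi axis_def)
  have "partial 2 flow1 y = deriv plateau (y $ 2) * (deriv plateau (y $ 3) * psi y + plateau (y $ 3) * partial 3 psi y)
      + plateau (y $ 2) * (deriv plateau (y $ 3) * partial 2 psi y + plateau (y $ 3) * cos (2 * y $ 1))"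
    by (rule partial_along_line[OF profile_smooth[OF profile_flow(1)]], unfold line,
        (rule derivative_eq_intros plateau_along_line psi_along_line refl)+) (simp add: partial_psi algebra_simps)
  moreover have "partial 3 flow2 y = - (deriv plateau (y $ 3) * (deriv plateau (y $ 2) * psi y + plateau (y $ 2) * partial 2 psi y)
      + plateau (y $ 3) * (deriv plateau (y $ 2) * partial 3 psi y + plateau (y $ 2) * cos (2 * y $ 1)))"
    by (rule partial_along_line[OF profile_smooth[OF profile_flow(2)]], unfold line,
        (rule derivative_eq_intros plateau_along_line psi_along_line refl)+) (simp add: partial_psi algebra_simps)
  ultimately show ?thesis by (simp add: algebra_simps)
qed

lemma dir_self:
  "dir1 y * partial 2 dir1 y + dir2 y * partial 3 dir1 y = (partial 2 dir1 y + partial 3 dir2 y) * dir1 y"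
  "dir1 y * partial 2 dir2 y + dir2 y * partial 3 dir2 y = (partial 2 dir1 y + partial 3 dir2 y) * dir2 y"
  by (simp_all add: partial_dir dir1_def dir2_def algebra_simps)

lemma dir_stretch:
  "partial 1 dir1 y + flow1 y * partial 2 dir1 y + flow2 y * partial 3 dir1 y
      + dir1 y * partial 2 flow1 y + dir2 y * partial 3 flow1 y = - dir1 y"
  "partial 1 dir2 y + flow1 y * partial 2 dir2 y + flow2 y * partial 3 dir2 y
      + dir1 y * partial 2 flow2 y + dir2 y * partial 3 flow2 y = - dir2 y"
proof -
  consider "qform y \<ge> 1" | "qform y < 1" by linarith
  then have "(partial 1 dir1 y + flow1 y * partial 2 dir1 y + flow2 y * partial 3 dir1 y
      + dir1 y * partial 2 flow1 y + dir2 y * partial 3 flow1 y = - dir1 y) \<and>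
    (partial 1 dir2 y + flow1 y * partial 2 dir2 y + flow2 y * partial 3 dir2 y
      + dir1 y * partial 2 flow2 y + dir2 y * partial 3 flow2 y = - dir2 y)"
  proof cases
    case 1
    then show ?thesis by (simp add: partial_dir dir1_def dir2_def envelope_def slope_def)
  next
    case 2
    then have core: "\<bar>y $ 2\<bar> < 3/2" "\<bar>y $ 3\<bar> < 3/2"
      using envelope_eq_0(1)[of y] by (meson not_less less_asym)+
    define X Y s c where d: "X = y $ 2" "Y = y $ 3" "s = sin (2 * y $ 1)" "c = cos (2 * y $ 1)"
    have sc: "s\<^sup>2 + c\<^sup>2 = 1" by (simp add: d)
    have transport: "partial 1 qform y + flow1 y * partial 2 qform y + flow2 y * partial 3 qform y = 0"
      unfolding partial_qform flow_core[OF core] partial_psi d[symmetric]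
      by (simp add: algebra_simps power2_eq_square)
    have a: "sin (y $ 1) = s * cos (y $ 1) - c * sin (y $ 1)" "cos (y $ 1) = c * cos (y $ 1) + s * sin (y $ 1)"
      using sin_diff[of "2 * y $ 1" "y $ 1"] cos_diff[of "2 * y $ 1" "y $ 1"] by (simp_all add: d)
    have "partial 1 dir1 y + flow1 y * partial 2 dir1 y + flow2 y * partial 3 dir1 y
        = - cos (y $ 1) * envelope y + sin (y $ 1) * slope y *
          (partial 1 qform y + flow1 y * partial 2 qform y + flow2 y * partial 3 qform y)"
      "partial 1 dir2 y + flow1 y * partial 2 dir2 y + flow2 y * partial 3 dir2 y
        = - sin (y $ 1) * envelope y - cos (y $ 1) * slope y *
          (partial 1 qform y + flow1 y * partial 2 qform y + flow2 y * partial 3 qform y)"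
      by (simp_all add: partial_dir algebra_simps)
    then have "partial 1 dir1 y + flow1 y * partial 2 dir1 y + flow2 y * partial 3 dir1 y = - cos (y $ 1) * envelope y"
      "partial 1 dir2 y + flow1 y * partial 2 dir2 y + flow2 y * partial 3 dir2 y = - sin (y $ 1) * envelope y"
      by (simp_all add: transport)
    moreover have "dir1 y * partial 2 flow1 y + dir2 y * partial 3 flow1 y
        = (s * cos (y $ 1) - c * sin (y $ 1)) * envelope y + cos (y $ 1) * envelope y"
      "dir1 y * partial 2 flow2 y + dir2 y * partial 3 flow2 y
        = - (c * cos (y $ 1) + s * sin (y $ 1)) * envelope y + sin (y $ 1) * envelope y"
      unfolding partial_flow_core[OF core] dir1_def dir2_def d by (simp_all add: algebra_simps)
    ultimately show ?thesis
      unfolding a[symmetric] by (simp add: dir1_def dir2_def)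
  qed
  then show "partial 1 dir1 y + flow1 y * partial 2 dir1 y + flow2 y * partial 3 dir1 y
      + dir1 y * partial 2 flow1 y + dir2 y * partial 3 flow1 y = - dir1 y"
    "partial 1 dir2 y + flow1 y * partial 2 dir2 y + flow2 y * partial 3 dir2 y
      + dir1 y * partial 2 flow2 y + dir2 y * partial 3 flow2 y = - dir2 y" by blast+
qed

lemma dir_norm: "(dir1 y)\<^sup>2 + (dir2 y)\<^sup>2 = (envelope y)\<^sup>2"
proof -
  have "(dir1 y)\<^sup>2 + (dir2 y)\<^sup>2 = ((sin (y $ 1))\<^sup>2 + (cos (y $ 1))\<^sup>2) * (envelope y)\<^sup>2"
    unfolding dir1_def dir2_def by (simp only: power_mult_distrib power2_minus distrib_right)
  then show ?thesis by simp
qed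

lemma envelope_ge:
  assumes "\<bar>y $ 2\<bar> \<le> 1/4" "\<bar>y $ 3\<bar> \<le> 1/4"
  shows "envelope y \<ge> flat (1/2)"
proof -
  define X Y s c where d: "X = y $ 2" "Y = y $ 3" "s = sin (2 * y $ 1)" "c = cos (2 * y $ 1)"
  have sq: "X\<^sup>2 \<le> 1/16" "Y\<^sup>2 \<le> 1/16" "\<bar>X * Y\<bar> \<le> 1/16"
    using power_mono[OF assms(1), of 2] power_mono[OF assms(2), of 2] mult_mono[OF assms]
    by (simp_all add: d power2_eq_square abs_mult)
  have "\<bar>Y\<^sup>2 - X\<^sup>2\<bar> \<le> 1/8" using sq zero_le_power2[of X] zero_le_power2[of Y] by linarith
  then have "\<bar>s\<bar> * \<bar>Y\<^sup>2 - X\<^sup>2\<bar> \<le> 1 * (1/8)" "\<bar>c\<bar> * \<bar>X * Y\<bar> \<le> 1 * (1/16)"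
    using sq by (intro mult_mono; simp add: d)+
  then have "s * (Y\<^sup>2 - X\<^sup>2) \<le> 1/8" "c * (X * Y) \<le> 1/16"
    using abs_ge_self[of "s * (Y\<^sup>2 - X\<^sup>2)"] abs_ge_self[of "c * (X * Y)"] unfolding abs_mult by linarith+
  moreover have "qform y = X\<^sup>2 + Y\<^sup>2 + s * (Y\<^sup>2 - X\<^sup>2) / 2 + c * (X * Y)"
    by (simp add: qform_def psi_def d)
  ultimately have "qform y \<le> 1/2" using sq by linarith
  then show ?thesis unfolding envelope_def by (intro flat_mono) simp
qed

section \<open>Dissipation\<close>

lemma dissipation_eq:
  fixes u :: "real \<Rightarrow> real^3 \<Rightarrow> real^3"
  assumes u: "smooth_torus_time u"
  defines "T \<equiv> \<lambda>t. integral (cbox 0 One) (\<lambda>x. \<Sum>j\<in>UNIV. (norm (partial j (u t) x))\<^sup>2)"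
  shows "continuous_on {0..1} T" "dissipation \<nu> u = \<nu> * integral {0..1} T"
proof -
  have c: "continuous_on ({0..1} \<times> cbox 0 One) (\<lambda>(t, x). \<Sum>j\<in>UNIV. (norm (partial j (u t) x))\<^sup>2)"
    using continuous_on_swap[OF smooth_torus_time_continuous[OF smooth_torus_time_partial[OF u]]]
    unfolding case_prod_unfold by (intro continuous_intros) auto
  then show T: "continuous_on {0..1} T"
    unfolding T_def by (rule integral_continuous_on_param)
  have "torus_integral (\<lambda>x. (grad_norm (u t) x)\<^sup>2) = T t" if t: "t \<in> {0..1}" for t
  proof -
    have "(\<lambda>x. (grad_norm (u t) x)\<^sup>2) = (\<lambda>x. \<Sum>j\<in>UNIV. (norm (partial j (u t) x))\<^sup>2)"
      by (simp add: grad_norm_def sum_nonneg)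
    moreover have "continuous_on UNIV (\<lambda>x. \<Sum>j\<in>UNIV. (norm (partial j (u t) x))\<^sup>2)"
      using smooth_on_imp_continuous_on[OF smooth_on_partial[OF smooth_torus_time_slice(1)[OF u t]]]
      by (intro continuous_intros)
    ultimately show ?thesis by (simp add: torus_integral_eq T_def)
  qed
  then have "set_lebesgue_integral lborel {0..1} (\<lambda>t. torus_integral (\<lambda>x. (grad_norm (u t) x)\<^sup>2)) =
      set_lebesgue_integral lborel {0..1} T"
    by (intro set_lebesgue_integral_cong) auto
  also have "\<dots> = integral {0..1} T"
    by (intro set_borel_integral_eq_integral borel_integrable_atLeastAtMost' T)
  finally show "dissipation \<nu> u = \<nu> * integral {0..1} T" by (simp add: dissipation_def)
qed

context flow
begin

text \<open>Shifting \<open>x $ 3\<close> by a quarter of the wave length exchanges sine and cosine.\<close>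

lemma integral_wave_sin2:
  assumes P: "profile P"
  shows "integral (cbox 0 One) (wave P (\<lambda>s. (sin s)\<^sup>2) t) = integral (cbox 0 One) (lift P t) / 2"
proof -
  have sq: "smooth_on UNIV (\<lambda>s::real. (sin s)\<^sup>2)" "smooth_on UNIV (\<lambda>s::real. (cos s)\<^sup>2)"
    by (intro smooth)+
  note c = smooth_wave(2)[OF P sq(1), THEN smooth_on_imp_continuous_on]
    smooth_wave(2)[OF P sq(2), THEN smooth_on_imp_continuous_on]
  have i: "wave P (\<lambda>s. (sin s)\<^sup>2) t integrable_on cbox 0 One" "wave P (\<lambda>s. (cos s)\<^sup>2) t integrable_on cbox 0 One"
    using c by (auto intro!: integrable_continuous intro: continuous_on_subset)
  define d where "d = 1 / (4 * real N)"
  have d: "0 \<le> d" "d \<le> 1" "n * d = pi / 2" using N by (auto simp: d_def n_def)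
  have sh: "wave P (\<lambda>s. (sin s)\<^sup>2) t (x + d *\<^sub>R axis 3 1) = wave P (\<lambda>s. (cos s)\<^sup>2) t x" for x
  proof -
    have "n * (x + d *\<^sub>R axis 3 1) $ 3 = n * x $ 3 + pi / 2"
      using d(3) by (simp add: axis_def distrib_left)
    then have "sin (n * (x + d *\<^sub>R axis 3 1) $ 3) = cos (n * x $ 3)" by (simp add: sin_add)
    then show ?thesis by (simp only: wave_def lift_def coord_def) (simp add: axis_def)
  qed
  have "integral (cbox 0 One) (wave P (\<lambda>s. (cos s)\<^sup>2) t) = integral (cbox 0 One) (wave P (\<lambda>s. (sin s)\<^sup>2) t)"
    using integral_cube_shift[OF c(1)[of t] periodic_wave d(1,2), where j = 3] by (simp add: sh angle_shift)
  moreover have "integral (cbox 0 One) (lift P t) =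
      integral (cbox 0 One) (\<lambda>x. wave P (\<lambda>s. (sin s)\<^sup>2) t x + wave P (\<lambda>s. (cos s)\<^sup>2) t x)"
    by (simp add: wave_def distrib_left[symmetric])
  ultimately show ?thesis using integral_add[OF i] by simp
qed

context
  fixes \<delta> :: real
  assumes \<delta>: "\<delta> \<ge> 0" "\<And>y. \<bar>y $ 2\<bar> \<le> 1/4 \<Longrightarrow> \<bar>y $ 3\<bar> \<le> 1/4 \<Longrightarrow> (A1 y)\<^sup>2 + (A2 y)\<^sup>2 \<ge> \<delta>"
begin

definition energy_profile :: "real^3 \<Rightarrow> real" where
  "energy_profile y = A1 y * A1 y + A2 y * A2 y"

lemma profile_energy: "profile energy_profile"
  unfolding energy_profile_def by (intro profile_add profile_mult A)

lemma integral_lift_ge: "integral (cbox 0 One) (lift energy_profile t) \<ge> \<delta> * r\<^sup>2 / 4"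
proof -
  define b1 b2 :: "real^3" where "b1 = vector [1/2 - r / 4, 1/2 - r / 4, 0]"
    and "b2 = vector [1/2 + r / 4, 1/2 + r / 4, 1]"
  have "b1 \<in> cbox b1 b2" using r by (simp add: b1_def b2_def mem_box_cart forall_3)
  then have ne: "cbox b1 b2 \<noteq> {}" by blast
  have sub: "cbox b1 b2 \<subseteq> cbox 0 One"
    unfolding subset_iff mem_unit_cube using r by (auto simp: b1_def b2_def mem_box_cart forall_3)
  have c: "lift energy_profile t integrable_on cbox c d" for c d
    using smooth_on_imp_continuous_on[OF smooth_lift_space[OF profile_energy]]
    by (auto intro!: integrable_continuous intro: continuous_on_subset)
  have "measure lborel (cbox b1 b2) = (\<Prod>i\<in>UNIV. b2 $ i - b1 $ i)"
    using ne by (rule content_cbox_cart)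
  also have "\<dots> = (r / 2) * ((r / 2) * 1)"
    unfolding UNIV_3 by (subst prod.insert; simp add: b1_def b2_def)+
  also have "\<dots> = r\<^sup>2 / 4" by (simp add: power2_eq_square)
  finally have "\<delta> * r\<^sup>2 / 4 = integral (cbox b1 b2) (\<lambda>x. \<delta>)" by simp
  also have "\<dots> \<le> integral (cbox b1 b2) (lift energy_profile t)"
  proof (rule integral_le)
    fix x assume x: "x \<in> cbox b1 b2"
    have cen: "\<bar>centred z / r\<bar> \<le> 1/4" if "1/2 - r/4 \<le> z" "z \<le> 1/2 + r/4" for z
    proof -
      have "\<lfloor>z\<rfloor> = 0" using that r by (intro floor_unique) auto
      then have "centred z = z - 1/2" by (simp add: centred_def)
      then have "\<bar>centred z\<bar> \<le> r / 4" using that by (intro abs_leI) linarith+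
      then show ?thesis using r by (simp add: abs_divide field_simps)
    qed
    have "\<delta> \<le> (A1 (coord t x))\<^sup>2 + (A2 (coord t x))\<^sup>2"
    proof (rule \<delta>(2))
      show "\<bar>coord t x $ 2\<bar> \<le> 1/4" "\<bar>coord t x $ 3\<bar> \<le> 1/4"
        unfolding coord_def vector_3
        by (rule cen; use x in \<open>simp add: b1_def b2_def mem_box_cart forall_3\<close>)+
    qed
    then show "\<delta> \<le> lift energy_profile t x" by (simp add: lift_def energy_profile_def power2_eq_square)
  qed (auto intro: c)
  also have "\<dots> \<le> integral (cbox 0 One) (lift energy_profile t)"
    using sub c by (intro integral_subset_le) (auto simp: lift_def energy_profile_def)
  finally show ?thesis .
qed

lemma grad_ge:
  "(\<Sum>j\<in>UNIV. (norm (partial j (u t) x))\<^sup>2) \<ge> (n * amp t)\<^sup>2 * wave energy_profile (\<lambda>s. (sin s)\<^sup>2) t x"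
proof -
  have "(\<Sum>j\<in>UNIV. (norm (partial j (u t) x))\<^sup>2) \<ge> (norm (partial 3 (u t) x))\<^sup>2"
    by (intro member_le_sum) auto
  moreover have "(norm (partial 3 (u t) x))\<^sup>2 = (partial 3 (u t) x $ 1)\<^sup>2 + (partial 3 (u t) x $ 2)\<^sup>2 + (partial 3 (u t) x $ 3)\<^sup>2"
    unfolding power2_norm_eq_inner inner_vec_def sum_3 by (simp add: power2_eq_square)
  moreover have "(partial 3 (u t) x $ 1)\<^sup>2 + (partial 3 (u t) x $ 2)\<^sup>2
      = (n * amp t)\<^sup>2 * wave energy_profile (\<lambda>s. (sin s)\<^sup>2) t x"
    by (simp add: partial_u partial_uh V A wave_def lift_def energy_profile_def power2_eq_square algebra_simps)
  ultimately show ?thesis by (smt (verit) zero_le_power2)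
qed

lemma amp_ge:
  assumes t: "1 - 1 / (1 + lam) \<le> t" "t \<le> 1" and N54: "N \<ge> 54"
  shows "amp t \<ge> r\<^sup>2 / 400"
proof -
  define \<tau> where "\<tau> = 1 / (1 + lam)"
  have \<tau>: "0 < \<tau>" "\<tau> \<le> 1" "lam * \<tau> \<le> 1" using lam_nonneg by (auto simp: \<tau>_def field_simps)
  have "1 - 2 * \<tau> \<le> (1 - \<tau>)\<^sup>2" by (simp add: power2_eq_square algebra_simps)
  also have "\<dots> \<le> t\<^sup>2" using t \<tau> by (intro power_mono) (auto simp: \<tau>_def)
  finally have "lam * (1 - 2 * \<tau>) \<le> lam * t\<^sup>2" using lam_nonneg by (rule mult_left_mono)
  then have "lam - 3 \<le> lam * t\<^sup>2 - t" using \<tau>(3) t(2) by (simp add: algebra_simps)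
  then have "exp (lam - 3) \<le> exp (lam * t\<^sup>2 - t)" by simp
  moreover have "exp (lam - 3) \<ge> real N / 27"
  proof -
    have "exp (3 * 1) \<le> (3::real) ^ 3"
      unfolding exp_of_nat_mult[of 3, simplified] using exp_le by (intro power_mono) auto
    then have "real N / 27 \<le> real N / exp 3" using N by (intro divide_left_mono) auto
    then show ?thesis by (simp add: exp_diff lam)
  qed
  moreover have "54 \<le> real N" using N54 by simp
  ultimately have "real N / 54 \<le> exp (lam * t\<^sup>2 - t) - 1" by linarith
  then have "seed * (real N / 54) \<le> amp t"
    unfolding amp_def using seed_bounds(1) by (intro mult_left_mono) auto
  moreover have "r\<^sup>2 / 400 \<le> seed * (real N / 54)"
  proof -
    have "pi < 3.7" using pi_less_4 pi_approx by simp
    then have "r\<^sup>2 * (108 * pi) \<le> r\<^sup>2 * 400" by (intro mult_left_mono) auto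
    then have "r\<^sup>2 / 400 \<le> r\<^sup>2 / (108 * pi)" by (simp add: field_simps)
    also have "\<dots> = seed * (real N / 54)" using N by (simp add: seed_def n_def)
    finally show ?thesis .
  qed
  ultimately show ?thesis by linarith
qed

lemma dissipation_ge:
  assumes N54: "N \<ge> 54"
  shows "dissipation nu u \<ge> \<delta> / 1280000 * r ^ 6 / (1 + lam)"
proof -
  define T where "T = (\<lambda>t. integral (cbox 0 One) (\<lambda>x. \<Sum>j\<in>UNIV. (norm (partial j (u t) x))\<^sup>2))"
  note d = dissipation_eq[OF smooth_torus_time_u, folded T_def]
  define \<tau> where "\<tau> = 1 / (1 + lam)"
  have \<tau>: "0 < \<tau>" "\<tau> \<le> 1" using lam_nonneg by (auto simp: \<tau>_def field_simps)
  define K where "K = n\<^sup>2 * (\<delta> / 1280000 * r ^ 6)"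
  have iT: "(\<lambda>x. \<Sum>j\<in>UNIV. (norm (partial j (u t) x))\<^sup>2) integrable_on cbox 0 One" if "t \<in> {0..1}" for t
  proof -
    have "continuous_on UNIV (partial j (u t))" for j
      using smooth_on_imp_continuous_on[OF smooth_on_partial[OF smooth_torus_time_slice(1)[OF smooth_torus_time_u that]]] .
    then have "continuous_on (cbox 0 One) (partial j (u t))" for j
      using continuous_on_subset by blast
    then show ?thesis by (intro integrable_continuous continuous_intros)
  qed
  have T: "T t \<ge> K" if t: "t \<in> {1 - \<tau>..1}" for t
  proof -
    have t01: "t \<in> {0..1}" using t \<tau> by auto
    have sq: "smooth_on UNIV (\<lambda>s::real. (sin s)\<^sup>2)" by (intro smooth)
    have "wave energy_profile (\<lambda>s. (sin s)\<^sup>2) t integrable_on cbox 0 One"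
      using smooth_on_imp_continuous_on[OF smooth_wave(2)[OF profile_energy sq]]
      by (auto intro!: integrable_continuous intro: continuous_on_subset)
    then have "(n * amp t)\<^sup>2 * integral (cbox 0 One) (wave energy_profile (\<lambda>s. (sin s)\<^sup>2) t) \<le> T t"
      unfolding T_def integral_mult_right[symmetric]
      by (intro integral_le integrable_on_mult_right iT t01 grad_ge)
    then have le: "(n * amp t)\<^sup>2 * (integral (cbox 0 One) (lift energy_profile t) / 2) \<le> T t"
      unfolding integral_wave_sin2[OF profile_energy] .
    have "r\<^sup>2 / 400 \<le> amp t" using t by (intro amp_ge N54) (auto simp: \<tau>_def)
    then have "(n * (r\<^sup>2 / 400))\<^sup>2 \<le> (n * amp t)\<^sup>2"
      using n_pos by (intro power_mono mult_left_mono) auto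
    then have "(n * (r\<^sup>2 / 400))\<^sup>2 * (\<delta> * r\<^sup>2 / 4 / 2) \<le> (n * amp t)\<^sup>2 * (integral (cbox 0 One) (lift energy_profile t) / 2)"
      using \<delta>(1) integral_lift_ge[of t] by (intro mult_mono divide_right_mono) auto
    moreover have "(n * (r\<^sup>2 / 400))\<^sup>2 * (\<delta> * r\<^sup>2 / 4 / 2) = K"
      by (simp add: K_def power2_eq_square power_numeral_reduce)
    ultimately show ?thesis using le by linarith
  qed
  have T0: "T t \<ge> 0" if "t \<in> {0..1}" for t
    unfolding T_def using iT[OF that] by (intro Henstock_Kurzweil_Integration.integral_nonneg) (auto intro: sum_nonneg)
  have iT': "T integrable_on {a..1}" if "a \<ge> 0" for a
    by (rule integrable_continuous_interval, rule continuous_on_subset[OF d(1)]) (use that in auto)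
  have "\<tau> * K = integral {1 - \<tau>..1} (\<lambda>_. K)" using \<tau> by simp
  also have "\<dots> \<le> integral {1 - \<tau>..1} T"
    using \<tau> by (intro integral_le iT' T) auto
  also have "\<dots> \<le> integral {0..1} T"
    using \<tau> by (intro integral_subset_le iT') (auto intro: T0)
  finally have "nu * (\<tau> * K) \<le> dissipation nu u"
    unfolding d(2) using nu_bounds(3) by (intro mult_left_mono) auto
  moreover have "nu * (\<tau> * K) = \<delta> / 1280000 * r ^ 6 / (1 + lam)"
    using n_pos by (simp add: nu_def K_def \<tau>_def)
  ultimately show ?thesis by simp
qed

end

end

interpretation fp: flow_profiles flow1 flow2 dir1 dir2
  by unfold_locales (rule profile_flow)+

lemma real_sequence_bounded:
  fixes X :: "nat \<Rightarrow> real"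
  assumes "X \<longlonglongrightarrow> L"
  obtains K where "K > 0" "\<And>M. X M \<le> K"
proof -
  have "Bseq X" using assms convergentI convergent_imp_Bseq by blast
  then obtain K where "K > 0" "\<And>M. norm (X M) \<le> K" unfolding Bseq_def by blast
  with that show thesis by (metis abs_le_D1 real_norm_def)
qed

theorem theorem1p2:
  shows "\<exists>(\<nu> :: nat \<Rightarrow> real) (f :: nat \<Rightarrow> real \<Rightarrow> real^3 \<Rightarrow> real^3) (u0 :: real^3 \<Rightarrow> real^3).
    (\<forall>m. \<nu> m > 0) \<and> decseq \<nu> \<and> \<nu> \<longlonglongrightarrow> 0 \<and>
    (\<forall>m. smooth_torus_time (f m)) \<and> smooth_torus u0 \<and>
    (\<forall>p::real. 1 \<le> p \<longrightarrow> (SUP m. C_W1p_norm p (f m)) < \<infinity>) \<and>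
    (\<exists>C>0. \<forall>m. \<exists>u.
       NS_velocity (\<nu> m) (f m) u0 u \<and>
       (\<forall>v. NS_velocity (\<nu> m) (f m) u0 v \<longrightarrow> (\<forall>t\<in>{0..1}. \<forall>x. v t x = u t x)) \<and>
       dissipation (\<nu> m) u \<ge> C * exp (- (ln (1 / \<nu> m) powr (2/3))))"
proof -
  define M where "M m = m + 3" for m :: nat
  define N where "N m = (2::nat) ^ (M m)\<^sup>2" for m
  define r where "r m = 1 / (2::real) ^ M m" for m
  define lam where "lam m = ln (real (N m))" for m
  have NM: "real (N m) = 2 ^ (M m)\<^sup>2" for m by (simp add: N_def)
  have lam: "lam m = (M m)\<^sup>2 * ln 2" for m
    unfolding lam_def NM by (simp add: ln_realpow)
  have M3: "M m \<ge> 3" for m by (simp add: M_def)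
  have cell: "cell (lam m) (r m) (N m)" for m
  proof
    show "exp (lam m) = real (N m)" by (simp add: lam_def N_def)
    show "0 < r m" by (simp add: r_def)
    have "(2::real) ^ 3 \<le> 2 ^ M m" using M3 by (intro power_increasing) auto
    then show "r m \<le> 1 / 8" by (simp add: r_def field_simps)
    show "1 \<le> N m" by (simp add: N_def)
    have "M m \<le> (M m)\<^sup>2" by (simp add: power2_eq_square)
    then have "(2::real) ^ M m \<le> 2 ^ (M m)\<^sup>2" by (intro power_increasing) auto
    then show "1 / r m \<le> real (N m)" by (simp add: r_def NM)
  qed
  have flow: "flow (lam m) (r m) (N m) flow1 flow2 dir1 dir2" for m
    using cell[of m] fp.flow_profiles_axioms
    by (simp add: flow_def flow_axioms_def dir_stretch dir_self div_flow fp.divA_def)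
  define \<nu> where "\<nu> m = flow.nu (N m)" for m
  define f where "f m = flow.f (lam m) (r m) (N m) flow1 flow2 dir1 dir2" for m
  define u where "u m = flow.u (lam m) (r m) (N m) flow1 flow2 dir1 dir2" for m
  have \<nu>: "\<nu> m = 1 / (2 * pi * 2 ^ (M m)\<^sup>2)\<^sup>2" for m
    unfolding \<nu>_def flow.nu_def[OF flow] cell.n_def[OF cell] NM ..
  have \<nu>_pos: "\<nu> m > 0" for m by (simp add: \<nu>)
  have ns: "NS_solution (\<nu> m) (f m) (\<lambda>_. 0) (u m) (\<lambda>_ _. 0)" for m
    unfolding \<nu>_def f_def u_def by (rule flow.NS_solution_u[OF flow])
  obtain B where B: "B \<ge> 1" "\<And>P y. P \<in> fp.profiles \<Longrightarrow> \<bar>P y\<bar> \<le> B \<and> \<bar>partial 2 P y\<bar> \<le> B \<and> \<bar>partial 3 P y\<bar> \<le> B"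
    using finite_profiles_bounded[OF fp.finite_profiles fp.profile_profiles] by blast
  have "decseq \<nu>"
    unfolding decseq_Suc_iff \<nu> by (intro allI divide_left_mono power_mono mult_left_mono power_increasing) (auto simp: M_def)
  moreover have "\<nu> \<longlonglongrightarrow> 0"
  proof (rule tendsto_sandwich[of "\<lambda>_. 0"])
    have "\<nu> m \<le> (1 / 2) ^ m" for m
    proof -
      have "m \<le> M m" by (simp add: M_def)
      also have "M m \<le> (M m)\<^sup>2" by (simp add: power2_eq_square)
      finally have "m \<le> (M m)\<^sup>2" .
      then have "(2::real) ^ m \<le> 2 ^ (M m)\<^sup>2" by (intro power_increasing) auto
      also have "\<dots> \<le> 2 * pi * 2 ^ (M m)\<^sup>2" using pi_gt3 by simp
      finally have a: "2 ^ m \<le> 2 * pi * 2 ^ (M m)\<^sup>2" .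
      then have "1 \<le> 2 * pi * 2 ^ (M m)\<^sup>2" using one_le_power[of "2::real" m] by linarith
      then have "2 * pi * 2 ^ (M m)\<^sup>2 \<le> (2 * pi * 2 ^ (M m)\<^sup>2)\<^sup>2"
        by (intro self_le_power) auto
      with a have "2 ^ m \<le> (2 * pi * 2 ^ (M m)\<^sup>2)\<^sup>2" by linarith
      then show ?thesis unfolding \<nu> power_divide by (auto intro!: divide_left_mono)
    qed
    then show "\<forall>\<^sub>F m in sequentially. \<nu> m \<le> (1 / 2) ^ m" by simp
    show "(\<lambda>m. (1 / 2) ^ m) \<longlonglongrightarrow> (0::real)" by (intro LIMSEQ_power_zero) auto
  qed (use \<nu>_pos in \<open>auto intro!: always_eventually less_imp_le\<close>)
  moreover have "smooth_torus_time (f m)" for m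
    unfolding f_def by (rule flow.smooth_torus_time_f[OF flow])
  moreover have "smooth_torus (\<lambda>_. 0 :: real^3)"
    by (simp add: smooth_torus_def periodic_def smooth_on_const)
  moreover have "(SUP m. C_W1p_norm p (f m)) < \<infinity>" if p: "1 \<le> p" for p :: real
  proof -
    define X where "X k = (1 + (real k)\<^sup>2) powr (2 * p) * (1 / 4) ^ k" for k :: nat
    have "X \<longlonglongrightarrow> 0" unfolding X_def using p by real_asymp
    then obtain K where K: "K > 0" "\<And>k. X k \<le> K"
      using real_sequence_bounded by blast
    define Z where "Z = (32 * (192 * B) powr p * K) powr (1 / p)"
    have "W1p_norm p (f m t) \<le> Z" if t: "t \<in> {0..1}" for m t
    proof -
      let ?k = "M m"
      have L: "flow.force_const (lam m) = 4 * (1 + lam m)\<^sup>2" by (rule flow.force_const_def[OF flow])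
      have l: "0 \<le> lam m" "lam m \<le> (real ?k)\<^sup>2"
        unfolding lam using ln_2_less_1 by (auto intro: mult_left_le)
      have "W1p_norm p (f m t) \<le> (2 * (48 * (flow.force_const (lam m) * B)) powr p * (16 * (r m)\<^sup>2)) powr (1 / p)"
        unfolding f_def by (rule flow.W1p_norm_f[OF flow B t p])
      also have "\<dots> \<le> Z"
        unfolding Z_def
      proof (intro powr_mono2)
        have "48 * (flow.force_const (lam m) * B) \<le> 192 * B * (1 + (real ?k)\<^sup>2)\<^sup>2"
        proof -
          have "(1 + lam m)\<^sup>2 \<le> (1 + (real ?k)\<^sup>2)\<^sup>2" using l by (intro power_mono) auto
          then have "192 * B * (1 + lam m)\<^sup>2 \<le> 192 * B * (1 + (real ?k)\<^sup>2)\<^sup>2" using B by (intro mult_left_mono) auto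
          then show ?thesis by (simp add: L mult_ac)
        qed
        then have "(48 * (flow.force_const (lam m) * B)) powr p \<le> (192 * B * (1 + (real ?k)\<^sup>2)\<^sup>2) powr p"
          using p B by (intro powr_mono2) (auto simp: L)
        also have "\<dots> = (192 * B) powr p * (1 + (real ?k)\<^sup>2) powr (2 * p)"
        proof -
          have "(1 + (real ?k)\<^sup>2)\<^sup>2 = (1 + (real ?k)\<^sup>2) powr 2"
            by (rule powr_numeral[symmetric]) (simp add: add_pos_nonneg)
          then have "((1 + (real ?k)\<^sup>2)\<^sup>2) powr p = (1 + (real ?k)\<^sup>2) powr (2 * p)"
            by (simp only: powr_powr)
          then show ?thesis using B by (simp add: powr_mult)
        qed
        finally have "2 * (48 * (flow.force_const (lam m) * B)) powr p * (16 * (r m)\<^sup>2)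
            \<le> 2 * ((192 * B) powr p * (1 + (real ?k)\<^sup>2) powr (2 * p)) * (16 * (r m)\<^sup>2)"
          by (intro mult_right_mono mult_left_mono) auto
        moreover have r2: "(r m)\<^sup>2 = (1 / 4) ^ ?k"
        proof -
          have "(r m)\<^sup>2 = ((1 / 2)\<^sup>2) ^ ?k"
            unfolding r_def power_one_over by (simp only: power_mult[symmetric] power_divide mult.commute power_one)
          also have "(1 / 2 :: real)\<^sup>2 = 1 / 4" by (simp add: power2_eq_square)
          finally show ?thesis .
        qed
        moreover have "2 * ((192 * B) powr p * (1 + (real ?k)\<^sup>2) powr (2 * p)) * (16 * (r m)\<^sup>2)
            = 32 * (192 * B) powr p * X ?k" by (simp add: X_def r2)
        moreover have "32 * (192 * B) powr p * X ?k \<le> 32 * (192 * B) powr p * K"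
          using K by (intro mult_left_mono) auto
        ultimately show "2 * (48 * (flow.force_const (lam m) * B)) powr p * (16 * (r m)\<^sup>2) \<le> 32 * (192 * B) powr p * K"
          by linarith
      qed (use p in auto)
      finally show ?thesis .
    qed
    then have "C_W1p_norm p (f m) \<le> ennreal Z" for m
      unfolding C_W1p_norm_def by (intro SUP_least ennreal_leI)
    then have "(SUP m. C_W1p_norm p (f m)) \<le> ennreal Z" by (rule SUP_least)
    also have "\<dots> < \<infinity>" by simp
    finally show ?thesis .
  qed
  moreover have "\<exists>C>0. \<forall>m. \<exists>u.
       NS_velocity (\<nu> m) (f m) (\<lambda>_. 0) u \<and>
       (\<forall>v. NS_velocity (\<nu> m) (f m) (\<lambda>_. 0) v \<longrightarrow> (\<forall>t\<in>{0..1}. \<forall>x. v t x = u t x)) \<and>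
       dissipation (\<nu> m) u \<ge> C * exp (- (ln (1 / \<nu> m) powr (2/3)))"
  proof -
    define \<delta> where "\<delta> = (flat (1/2))\<^sup>2"
    have \<delta>_pos: "\<delta> > 0" using flat_pos[of "1/2"] by (simp add: \<delta>_def)
    have \<delta>: "(dir1 y)\<^sup>2 + (dir2 y)\<^sup>2 \<ge> \<delta>" if "\<bar>y $ 2\<bar> \<le> 1/4" "\<bar>y $ 3\<bar> \<le> 1/4" for y
      unfolding dir_norm \<delta>_def using envelope_ge[OF that] flat_nonneg by (intro power_mono) auto
    define X where "X k = exp (- (real k powr (4/3))) * (1 + (real k)\<^sup>2) * 64 ^ k" for k :: nat
    have "X \<longlonglongrightarrow> 0" unfolding X_def by real_asymp
    then obtain K where K: "K > 0" "\<And>k. X k \<le> K"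
      using real_sequence_bounded by blast
    define C where "C = \<delta> / 1280000 / K"
    have "dissipation (\<nu> m) (u m) \<ge> C * exp (- (ln (1 / \<nu> m) powr (2/3)))" for m
    proof -
      let ?k = "M m"
      have l: "0 \<le> lam m" "lam m \<le> (real ?k)\<^sup>2"
        unfolding lam using ln_2_less_1 by (auto intro: mult_left_le)
      have "(54::nat) \<le> 2 ^ 9" by simp
      also have "\<dots> \<le> 2 ^ (M m)\<^sup>2"
        using power_mono[OF M3, of 2] by (intro power_increasing) auto
      finally have "54 \<le> N m" by (simp add: N_def)
      from flow.dissipation_ge[OF flow less_imp_le[OF \<delta>_pos] \<delta> this]
      have "\<delta> / 1280000 * (r m) ^ 6 / (1 + lam m) \<le> dissipation (\<nu> m) (u m)"
        by (simp only: \<nu>_def u_def)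
      moreover have "C * exp (- (ln (1 / \<nu> m) powr (2/3))) \<le> \<delta> / 1280000 * (r m) ^ 6 / (1 + lam m)"
      proof -
        have "(real ?k)\<^sup>2 \<le> ln (1 / \<nu> m)"
        proof -
          have "ln (1 / \<nu> m) = 2 * (ln (2 * pi) + (real ?k)\<^sup>2 * ln 2)"
            unfolding \<nu> by (simp add: ln_realpow ln_mult)
          moreover have "ln (2 * pi) \<ge> 0" using pi_gt3 by simp
          moreover have "(real ?k)\<^sup>2 * 1 \<le> (real ?k)\<^sup>2 * (2 * ln 2)"
            using ln2_ge_two_thirds by (intro mult_left_mono) auto
          then have "(real ?k)\<^sup>2 \<le> 2 * ((real ?k)\<^sup>2 * ln 2)" by simp
          ultimately show ?thesis unfolding distrib_left by linarith
        qed
        then have "((real ?k)\<^sup>2) powr (2/3) \<le> ln (1 / \<nu> m) powr (2/3)" by (intro powr_mono2) auto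
        also have "((real ?k)\<^sup>2) powr (2/3) = real ?k powr (4/3)"
        proof -
          have "(real ?k)\<^sup>2 = real ?k powr 2"
            by (rule powr_numeral[symmetric]) (simp add: M_def)
          then have "((real ?k)\<^sup>2) powr (2/3) = real ?k powr (2 * (2/3))" by (simp only: powr_powr)
          then show ?thesis by simp
        qed
        finally have "exp (- (ln (1 / \<nu> m) powr (2/3))) \<le> exp (- (real ?k powr (4/3)))" by simp
        also have "\<dots> = X ?k * (r m) ^ 6 / (1 + (real ?k)\<^sup>2)"
        proof -
          have "(64::real) ^ ?k * (r m) ^ 6 = 1"
          proof -
            have "(64::real) ^ ?k = (2 ^ 6) ^ ?k" by simp
            also have "\<dots> = (2 ^ ?k) ^ 6" by (simp only: power_mult[symmetric] mult.commute)
            finally show ?thesis by (simp add: r_def power_divide)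
          qed
          moreover have "1 + (real ?k)\<^sup>2 \<noteq> 0" by (smt (verit) zero_le_power2)
          ultimately show ?thesis by (simp add: X_def)
        qed
        also have "\<dots> \<le> K * (r m) ^ 6 / (1 + lam m)"
          using K l by (intro frac_le mult_right_mono) (auto simp: r_def)
        finally have "C * exp (- (ln (1 / \<nu> m) powr (2/3))) \<le> C * (K * (r m) ^ 6 / (1 + lam m))"
          using \<delta>_pos K by (intro mult_left_mono) (auto simp: C_def)
        also have "\<dots> = \<delta> / 1280000 * (r m) ^ 6 / (1 + lam m)"
          using K by (simp add: C_def)
        finally show ?thesis .
      qed
      ultimately show ?thesis by linarith
    qed
    moreover have "NS_velocity (\<nu> m) (f m) (\<lambda>_. 0) (u m)" for m
      unfolding NS_velocity_def using ns by blast
    moreover have "v t x = u m t x"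
      if "NS_velocity (\<nu> m) (f m) (\<lambda>_. 0) v" "t \<in> {0..1}" for m v t x
      using that NS_unique[OF ns[of m] _ less_imp_le[OF \<nu>_pos]] unfolding NS_velocity_def by blast
    moreover have "C > 0" using \<delta>_pos K by (simp add: C_def)
    ultimately show ?thesis by blast
  qed
  ultimately show ?thesis using \<nu>_pos by blast
qed

end
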